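(* Let $V$ be a simple Euclidean Jordan algebra with symmetric cone $\Omega$, let $\sigma$ be an involutive Jordan automorphism of $V$, and let $\Omega_\sigma^+=\{a\in\Omega:\sigma(a)=a\}$, $\Omega_\sigma^-=\{b\in\Omega:\sigma(b)=b^{-1}\}$. Let $G$ be the identity component of $G(\Omega)=\{g\in\operatorname{GL}(V):g(\Omega)=\Omega\}$ and $K$ the identity component of the group $\operatorname{Aut}(V)$ of Jordan automorphisms. Then the map $$\Psi_\sigma:\Omega_\sigma^+\times\Omega_\sigma^-\times K\to G,\qquad \Psi_\sigma(a,b,k)=P(a^{1/2})\,P(b^{1/2})\,k,$$ is a real analytic diffeomorphism. More explicitly, for $g\in G$, let $x:=\bigl((gg^* )e\bigr)^{1/2}\in\Omega$ and define $$a:=x\mathbin{\#}\sigma(x)\in\Omega_\sigma^+,\qquad b:=x\mathbin{\natural}\sigma(x^{-1})\in\Omega_\sigma^-.$$ Then $$\Psi_\sigma^{-1}(g)=\bigl(a,\ b,\ P(b^{-1/2})\,P(a^{-1/2})\,g\bigr).$$ Equivalently, every $g\in G$ admits a unique factorization $g=P(a^{1/2})\,P(b^{1/2})\,k$ with $a\in\Omega_\sigma^+$, $b\in\Omega_\sigma^-$, $k\in K$.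
   Context: A Euclidean Jordan algebra is a finite-dimensional real inner product space $V$ with a bilinear product $(x,y)\mapsto xy$ satisfying $xy=yx$, $x(x^2y)=x^2(xy)$, $\langle xy,z\rangle=\langle y,xz\rangle$, and having a unit element $e$; it is simple if it has no nontrivial ideals. Its symmetric cone is $\Omega=\operatorname{int}\{x^2:x\in V\}$. For $x\in V$, $L(x)y=xy$ and $P(x)=2L(x)^2-L(x^2)$ (quadratic representation). Every $x\in V$ has a spectral decomposition $x=\sum_{j=1}^r\lambda_jc_j$, with $(c_1,\dots,c_r)$ a Jordan frame (pairwise orthogonal primitive idempotents with sum $e$) and $\lambda_j\in\mathbb R$ the spectral values; $\operatorname{tr}(x)=\sum_j\lambda_j$; for $x\in\Omega$ all $\lambda_j>0$ and $x^\alpha=\sum_j\lambda_j^\alpha c_j$ for $\alpha\in\mathbb R$ (so $x^{-1}$ is the Jordan inverse). The inner product used on $V$ is $\langle x,y\rangle=\operatorname{tr}(xy)$, and $g^*$ denotes the adjoint of $g\in\operatorname{GL}(V)$ with respect to it. For $a,b\in\Omega$, the metric geometric mean is $a\mathbin{\#}b=P(a^{1/2})\bigl(P(a^{-1/2})b\bigr)^{1/2}$ and the spectral geometric mean is $a\mathbin{\natural}b=P\bigl((a^{-1}\mathbin{\#}b)^{1/2}\bigr)a$. An involutive Jordan automorphism is a linear bijection $\sigma:V\to V$ with $\sigma(xy)=\sigma(x)\sigma(y)$ and $\sigma^2=\operatorname{id}$. The sets $\Omega_\sigma^\pm$ are regarded as embedded (real-analytic) submanifolds of $\Omega$: $\Omega_\sigma^\pm=\exp(V^\pm)$,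 where $V^\pm=\{x\in V:\sigma(x)=\pm x\}$ and $\exp$ is the Jordan exponential. $G$ and $K$ are Lie groups as (identity components of) closed subgroups of $\operatorname{GL}(V)$. *)

theory Defs
  imports "HOL-Analysis.Analysis"
begin

section \<open>Euclidean Jordan algebras\<close>

class euclidean_jordan_algebra = euclidean_space +
  fixes jprod :: "'a \<Rightarrow> 'a \<Rightarrow> 'a"  (infixl "\<odot>" 70)
    and jone :: 'a
  assumes jprod_add_left: "(x + y) \<odot> z = x \<odot> z + y \<odot> z"
    and jprod_scaleR_left: "(r *\<^sub>R x) \<odot> y = r *\<^sub>R (x \<odot> y)"
    and jprod_commute: "x \<odot> y = y \<odot> x"
    and jordan_identity: "x \<odot> ((x \<odot> x) \<odot> y) = (x \<odot> x) \<odot> (x \<odot> y)"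
    and inner_jprod: "(x \<odot> y) \<bullet> z = y \<bullet> (x \<odot> z)"
    and jprod_jone: "jone \<odot> x = x"

definition jordan_ideal :: "'a::euclidean_jordan_algebra set \<Rightarrow> bool" where
  "jordan_ideal I \<longleftrightarrow> subspace I \<and> (\<forall>x\<in>I. \<forall>y. x \<odot> y \<in> I)"

text \<open>The zero algebra is excluded by class \<^class>\<open>euclidean_space\<close>.\<close>

definition simple_jordan_algebra :: "'a::euclidean_jordan_algebra itself \<Rightarrow> bool" where
  "simple_jordan_algebra _ \<longleftrightarrow> (\<forall>I :: 'a set. jordan_ideal I \<longrightarrow> I = {0} \<or> I = UNIV)"

lemma bounded_linear_jprod:
  fixes x :: "'a::euclidean_jordan_algebra"
  shows "bounded_linear (\<lambda>y. x \<odot> y)"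
proof -
  have "linear (\<lambda>y. x \<odot> y)"
    by (rule linearI) (metis jprod_add_left jprod_commute, metis jprod_scaleR_left jprod_commute)
  then show ?thesis
    by (simp add: linear_conv_bounded_linear)
qed

definition symmetric_cone :: "'a::euclidean_jordan_algebra set" where
  "symmetric_cone = interior (range (\<lambda>x. x \<odot> x))"

text \<open>Endomorphisms of the algebra are elements of the normed space \<open>'a \<Rightarrow>\<^sub>L 'a\<close>,
  which carries the topology and the analytic structure of the linear groups below.\<close>

definition jmult :: "'a::euclidean_jordan_algebra \<Rightarrow> 'a \<Rightarrow>\<^sub>L 'a" where
  "jmult x = Blinfun (\<lambda>y. x \<odot> y)"

lemma jmult_apply: "blinfun_apply (jmult x) y = x \<odot> y"
  by (simp add: jmult_def bounded_linear_Blinfun_apply bounded_linear_jprod)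

definition quad_rep :: "'a::euclidean_jordan_algebra \<Rightarrow> 'a \<Rightarrow>\<^sub>L 'a" where
  "quad_rep x = 2 *\<^sub>R (jmult x o\<^sub>L jmult x) - jmult (x \<odot> x)"

lemma quad_rep_apply:
  "blinfun_apply (quad_rep x) y = 2 *\<^sub>R (x \<odot> (x \<odot> y)) - (x \<odot> x) \<odot> y"
  by (simp add: quad_rep_def jmult_apply blinfun.bilinear_simps)


section \<open>Spectral calculus\<close>

definition jidempotent :: "'a::euclidean_jordan_algebra \<Rightarrow> bool" where
  "jidempotent c \<longleftrightarrow> c \<odot> c = c"

definition primitive_idempotent :: "'a::euclidean_jordan_algebra \<Rightarrow> bool" where
  "primitive_idempotent c \<longleftrightarrow> jidempotent c \<and> c \<noteq> 0 \<and>
     \<not> (\<exists>d f. jidempotent d \<and> jidempotent f \<and> d \<noteq> 0 \<and> f \<noteq> 0 \<and> d \<odot> f = 0 \<and> c = d + f)"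

text \<open>The members of a Jordan frame are automatically distinct (an idempotent orthogonal to itself
  vanishes), so a frame is given as a finite set, and the spectral values as a function on it.\<close>

definition jordan_frame :: "'a::euclidean_jordan_algebra set \<Rightarrow> bool" where
  "jordan_frame C \<longleftrightarrow> finite C \<and> (\<forall>c\<in>C. primitive_idempotent c) \<and>
     pairwise (\<lambda>c d. c \<odot> d = 0) C \<and> \<Sum>C = jone"

definition spectral_decomposition ::
    "'a::euclidean_jordan_algebra \<Rightarrow> 'a set \<Rightarrow> ('a \<Rightarrow> real) \<Rightarrow> bool" where
  "spectral_decomposition x C l \<longleftrightarrow> jordan_frame C \<and> x = (\<Sum>c\<in>C. l c *\<^sub>R c)"

definition jtrace :: "'a::euclidean_jordan_algebra \<Rightarrow> real" where
  "jtrace x = (THE t. \<exists>C l. spectral_decomposition x C l \<and> t = (\<Sum>c\<in>C. l c))"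

text \<open>Meaningful for \<open>x \<in> symmetric_cone\<close>, where all spectral values are positive.\<close>

definition jpowr :: "'a::euclidean_jordan_algebra \<Rightarrow> real \<Rightarrow> 'a"  (infixr "powj" 80) where
  "x powj \<alpha> = (THE y. \<exists>C l. spectral_decomposition x C l \<and> y = (\<Sum>c\<in>C. (l c powr \<alpha>) *\<^sub>R c))"

definition metric_geometric_mean ::
    "'a::euclidean_jordan_algebra \<Rightarrow> 'a \<Rightarrow> 'a"  (infixl "\<sharp>" 75) where
  "a \<sharp> b = quad_rep (a powj (1/2)) ((quad_rep (a powj (-1/2)) b) powj (1/2))"

definition spectral_geometric_mean ::
    "'a::euclidean_jordan_algebra \<Rightarrow> 'a \<Rightarrow> 'a"  (infixl "\<natural>" 75) where
  "a \<natural> b = quad_rep (((a powj (-1)) \<sharp> b) powj (1/2)) a"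


section \<open>Automorphisms and groups\<close>

definition jordan_automorphism :: "('a::euclidean_jordan_algebra \<Rightarrow> 'a) \<Rightarrow> bool" where
  "jordan_automorphism f \<longleftrightarrow> linear f \<and> bij f \<and> (\<forall>x y. f (x \<odot> y) = f x \<odot> f y)"

definition involutive_jordan_automorphism :: "('a::euclidean_jordan_algebra \<Rightarrow> 'a) \<Rightarrow> bool" where
  "involutive_jordan_automorphism \<sigma> \<longleftrightarrow> jordan_automorphism \<sigma> \<and> \<sigma> \<circ> \<sigma> = id"

definition cone_fixed :: "('a::euclidean_jordan_algebra \<Rightarrow> 'a) \<Rightarrow> 'a set" where
  "cone_fixed \<sigma> = {a \<in> symmetric_cone. \<sigma> a = a}"

definition cone_inverted :: "('a::euclidean_jordan_algebra \<Rightarrow> 'a) \<Rightarrow> 'a set" where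
  "cone_inverted \<sigma> = {b \<in> symmetric_cone. \<sigma> b = b powj (-1)}"

definition Aut_group :: "('a::euclidean_jordan_algebra \<Rightarrow>\<^sub>L 'a) set" where
  "Aut_group = {k. jordan_automorphism (blinfun_apply k)}"

definition cone_group :: "('a::euclidean_jordan_algebra \<Rightarrow>\<^sub>L 'a) set" where
  "cone_group = {g. bij (blinfun_apply g) \<and> blinfun_apply g ` symmetric_cone = symmetric_cone}"

definition Aut_group0 :: "('a::euclidean_jordan_algebra \<Rightarrow>\<^sub>L 'a) set" where
  "Aut_group0 = connected_component_set Aut_group id_blinfun"

definition cone_group0 :: "('a::euclidean_jordan_algebra \<Rightarrow>\<^sub>L 'a) set" where
  "cone_group0 = connected_component_set cone_group id_blinfun"

fun Psi :: "'a::euclidean_jordan_algebra \<times> 'a \<times> ('a \<Rightarrow>\<^sub>L 'a) \<Rightarrow> ('a \<Rightarrow>\<^sub>L 'a)" where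
  "Psi (a, b, k) = quad_rep (a powj (1/2)) o\<^sub>L quad_rep (b powj (1/2)) o\<^sub>L k"


section \<open>Real analytic maps\<close>

text \<open>\<open>multilinear_map n m\<close>: the value \<open>m v\<close> depends only on \<open>v 0, \<dots>, v (n - 1)\<close> and
  is linear in each of them.\<close>

definition multilinear_map :: "nat \<Rightarrow> ((nat \<Rightarrow> 'a::real_vector) \<Rightarrow> 'b::real_vector) \<Rightarrow> bool" where
  "multilinear_map n m \<longleftrightarrow>
     (\<forall>v w. (\<forall>i<n. v i = w i) \<longrightarrow> m v = m w) \<and>
     (\<forall>v. \<forall>i<n. linear (\<lambda>x. m (v(i := x))))"

text \<open>Expansion in a convergent power series, in the coordinate-free form usual for normed spaces:
  the degree \<open>n\<close> term is the restriction to the diagonal of an \<open>n\<close>-linear map of norm at most \<open>M n\<close>,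
  and \<open>\<Sum>n. M n * r ^ n\<close> converges. In finite dimension this is the usual notion.\<close>

definition real_analytic_at ::
    "('a::real_normed_vector \<Rightarrow> 'b::real_normed_vector) \<Rightarrow> 'a \<Rightarrow> bool" where
  "real_analytic_at f p \<longleftrightarrow> (\<exists>r m M. r > 0 \<and>
     (\<forall>n. multilinear_map n (m n) \<and> (\<forall>v. norm (m n v) \<le> M n * (\<Prod>i<n. norm (v i)))) \<and>
     summable (\<lambda>n. M n * r ^ n) \<and>
     (\<forall>h. norm h < r \<longrightarrow> (\<lambda>n. m n (\<lambda>_. h)) sums f (p + h)))"

text \<open>Real analyticity on a subset \<open>S\<close> of a normed space is local extendability to a real analytic
  map on an open set. If \<open>S\<close> is an embedded analytic submanifold, this is analyticity for the
  induced manifold structure.\<close>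

definition real_analytic_map_on ::
    "'a::real_normed_vector set \<Rightarrow> ('a \<Rightarrow> 'b::real_normed_vector) \<Rightarrow> bool" where
  "real_analytic_map_on S f \<longleftrightarrow>
     (\<forall>p\<in>S. \<exists>U F. open U \<and> p \<in> U \<and> (\<forall>q\<in>U. real_analytic_at F q) \<and> (\<forall>x\<in>S \<inter> U. F x = f x))"

definition real_analytic_diffeomorphism ::
    "'a::real_normed_vector set \<Rightarrow> 'b::real_normed_vector set \<Rightarrow> ('a \<Rightarrow> 'b) \<Rightarrow> bool" where
  "real_analytic_diffeomorphism M N f \<longleftrightarrow>
     bij_betw f M N \<and> real_analytic_map_on M f \<and> real_analytic_map_on N (inv_into M f)"

end

theory Submission
  imports Defs
begin

text \<open>
  The map \<open>Psi\<close> is inverted explicitly. If \<open>g = P(a\<^sup>1\<^sup>/\<^sup>2) P(b\<^sup>1\<^sup>/\<^sup>2) k\<close>, then \<open>k\<close> fixes the unit and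
  \<open>x = g jone = P(a\<^sup>1\<^sup>/\<^sup>2) b\<close>; applying \<open>\<sigma>\<close>, which fixes \<open>a\<close> and inverts \<open>b\<close>, gives
  \<open>\<sigma> x = P(a\<^sup>1\<^sup>/\<^sup>2) b\<^sup>-\<^sup>1 = P(a) x\<^sup>-\<^sup>1\<close>. The Riccati equation \<open>P(a) x\<^sup>-\<^sup>1 = \<sigma> x\<close> has the unique solution
  \<open>a = x \<sharp> \<sigma> x\<close> in the cone, and then \<open>b\<close> and \<open>k\<close> are determined as well. Conversely, for any \<open>x\<close> in
  the cone the symmetry of the geometric mean makes \<open>a\<close> a fixed point of \<open>\<sigma>\<close> and the Riccati equation
  makes \<open>\<sigma>\<close> invert \<open>b\<close> (\<open>involution_factorization\<close>).

  This rests on the spectral theorem and on order-theoretic properties of the cone of squares. The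
  spectral theorem comes from the eigenvectors of multiplication by \<open>x\<close> in a subspace of elements with
  commuting multiplications (\<open>idempotent_decomposition\<close>). Multiplication by an idempotent is a
  nonnegative operator; this makes the cone self-dual, and a resolvent argument then shows that \<open>P(x)\<close>
  maps the cone to itself for \<open>x\<close> in the cone (\<open>quad_rep_square_cone\<close>). An automorphism of the cone
  that fixes the unit preserves the extreme points of the order interval between \<open>0\<close> and the unit,
  which are the idempotents, and so it is a Jordan automorphism (\<open>unital_cone_map_automorphism\<close>).
  Hence every \<open>g\<close> in the cone group has a polar decomposition \<open>g = P(y\<^sup>1\<^sup>/\<^sup>2) k\<close> with \<open>y = g jone\<close>; as
  automorphisms are orthogonal for the trace form, \<open>g g\<^sup>* = P(g jone)\<close> (\<open>cone_group_adjoint\<close>).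
  Consequently \<open>x = (g g\<^sup>* jone)\<^sup>1\<^sup>/\<^sup>2 = g jone\<close>, and the fundamental formula
  \<open>P(P(x) y) = P(x) P(y) P(x)\<close> holds on the cone.

  The identity components are matched by connectedness of the cone and continuity of the polar
  decomposition. For analyticity, convergent power series are handled in a majorant norm that is
  compatible with bilinear maps and with countable sums. The operations \<open>x\<^sup>1\<^sup>/\<^sup>2\<close> and \<open>x\<^sup>-\<^sup>1\<close>, applied to a
  given analytic germ, solve a quadratic fixed point equation, and Picard iteration in this norm yields
  their power series (\<open>power_bound_fixpoint\<close>).
  Every map in question is built from these two operations by linear and bilinear maps.
\<close>

section \<open>Jordan identities\<close>

interpretation jprod: bounded_bilinear "jprod :: 'a::euclidean_jordan_algebra \<Rightarrow> 'a \<Rightarrow> 'a"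
proof -
  have "bilinear (jprod :: 'a \<Rightarrow> 'a \<Rightarrow> 'a)"
    unfolding bilinear_def
    by (auto intro!: linearI simp: jprod_add_left jprod_scaleR_left)
      (metis jprod_add_left jprod_commute, metis jprod_scaleR_left jprod_commute)
  then show "bounded_bilinear (jprod :: 'a \<Rightarrow> 'a \<Rightarrow> 'a)"
    by (simp add: bilinear_conv_bounded_bilinear)
qed

lemma jprod_jone_right [simp]: "x \<odot> jone = x"
  by (metis jprod_commute jprod_jone)

declare jprod_jone [simp] jprod.zero_left [simp] jprod.zero_right [simp]

lemma inner_jprod_left: "x \<bullet> (a \<odot> y) = (a \<odot> x) \<bullet> y" for x y a :: "'a::euclidean_jordan_algebra"
  by (simp only: inner_jprod)

lemma jone_inner_square: "jone \<bullet> (x \<odot> x) = x \<bullet> x" for x :: "'a::euclidean_jordan_algebra"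
  by (simp add: inner_jprod_left)

lemma jordan_identity_linearized:
  fixes x y z w :: "'a::euclidean_jordan_algebra"
  shows "x \<odot> ((y \<odot> z) \<odot> w) + y \<odot> ((z \<odot> x) \<odot> w) + z \<odot> ((x \<odot> y) \<odot> w)
       = (y \<odot> z) \<odot> (x \<odot> w) + (z \<odot> x) \<odot> (y \<odot> w) + (x \<odot> y) \<odot> (z \<odot> w)"
proof -
  define J where "J a = a \<odot> ((a \<odot> a) \<odot> w) - (a \<odot> a) \<odot> (a \<odot> w)" for a
  have J0: "J a = 0" for a
    by (simp add: J_def jordan_identity)
  have "J (x + y + z) - J (x + y) - J (y + z) - J (x + z) + J x + J y + J z
     = 2 *\<^sub>R (x \<odot> ((y \<odot> z) \<odot> w) + y \<odot> ((z \<odot> x) \<odot> w) + z \<odot> ((x \<odot> y) \<odot> w)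
       - ((y \<odot> z) \<odot> (x \<odot> w) + (z \<odot> x) \<odot> (y \<odot> w) + (x \<odot> y) \<odot> (z \<odot> w)))"
    by (simp add: J_def jprod.add_left jprod.add_right jprod_commute[of z x]
        jprod_commute[of y x] jprod_commute[of z y] scaleR_2 algebra_simps)
  then show ?thesis
    by (simp add: J0)
qed

text \<open>Reading the linearized identity as an identity between operators applied to its first
  argument expresses multiplication by a triple product through multiplications by products of
  fewer factors.\<close>

lemma jmult_triple_product:
  fixes y z w u :: "'a::euclidean_jordan_algebra"
  shows "((y \<odot> z) \<odot> w) \<odot> u = (y \<odot> z) \<odot> (w \<odot> u) + (y \<odot> w) \<odot> (z \<odot> u) + (z \<odot> w) \<odot> (y \<odot> u)
     - y \<odot> (w \<odot> (z \<odot> u)) - z \<odot> (w \<odot> (y \<odot> u))"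
  using jordan_identity_linearized[of u y z w]
  by (simp add: jprod_commute algebra_simps)

lemma jordan_commutator:
  fixes x w u :: "'a::euclidean_jordan_algebra"
  shows "2 *\<^sub>R (x \<odot> ((x \<odot> w) \<odot> u)) + w \<odot> ((x \<odot> x) \<odot> u)
       = 2 *\<^sub>R ((x \<odot> w) \<odot> (x \<odot> u)) + (x \<odot> x) \<odot> (w \<odot> u)"
  using jordan_identity_linearized[of x x w u]
  by (simp add: scaleR_2 jprod_commute[of w x] algebra_simps)

section \<open>Idempotents\<close>

lemma idempotent_cubic:
  fixes c :: "'a::euclidean_jordan_algebra"
  assumes "c \<odot> c = c"
  shows "2 *\<^sub>R (c \<odot> (c \<odot> (c \<odot> u))) = 3 *\<^sub>R (c \<odot> (c \<odot> u)) - c \<odot> u"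
proof -
  have three: "(3::real) *\<^sub>R v = v + v + v" for v :: 'a
    by (metis (no_types) scaleR_2 scaleR_left_distrib numeral_Bit1 one_add_one scaleR_one numeral_plus_one semiring_norm(5) numeral_One)
  show ?thesis
    using jmult_triple_product[of c c c u] assms
    by (simp add: scaleR_2 three algebra_simps)
qed

text \<open>On the eigenvalues \<open>0, 1/2, 1\<close> of multiplication by an idempotent, \<open>t = t\<^sup>2 + 4 (t - t\<^sup>2)\<^sup>2\<close>.\<close>

lemma idempotent_inner:
  fixes c :: "'a::euclidean_jordan_algebra"
  assumes "c \<odot> c = c"
  shows "(c \<odot> w) \<bullet> w = (norm (c \<odot> w))\<^sup>2 + 4 * (norm (c \<odot> w - c \<odot> (c \<odot> w)))\<^sup>2"
proof -
  have sa: "(c \<odot> a) \<bullet> b = a \<bullet> (c \<odot> b)" for a b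
    by (rule inner_jprod)
  define A B C D where "A = c \<odot> w" and "B = c \<odot> A" and "C = c \<odot> B" and "D = c \<odot> C"
  have C: "2 *\<^sub>R C = 3 *\<^sub>R B - A"
    unfolding A_def B_def C_def by (rule idempotent_cubic[OF assms])
  have D: "2 *\<^sub>R D = 3 *\<^sub>R C - B"
    unfolding D_def C_def B_def by (rule idempotent_cubic[OF assms])
  have "2 * (C \<bullet> w) = 3 * (B \<bullet> w) - A \<bullet> w" "2 * (D \<bullet> w) = 3 * (C \<bullet> w) - B \<bullet> w"
    using arg_cong[OF C, of "\<lambda>v. v \<bullet> w"] arg_cong[OF D, of "\<lambda>v. v \<bullet> w"]
    by (simp_all add: inner_diff_left)
  moreover have "A \<bullet> A = B \<bullet> w" "A \<bullet> B = C \<bullet> w" "B \<bullet> B = D \<bullet> w"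
    unfolding D_def C_def B_def A_def by (simp_all add: sa)
  ultimately show ?thesis
    unfolding A_def[symmetric] B_def[symmetric]
    by (simp add: power2_norm_eq_inner inner_diff_left inner_diff_right inner_commute)
qed

lemma idempotent_inner_nonneg:
  fixes c :: "'a::euclidean_jordan_algebra"
  assumes "c \<odot> c = c"
  shows "0 \<le> (c \<odot> w) \<bullet> w"
  by (simp add: idempotent_inner[OF assms])

lemma idempotent_inner_eq_0:
  fixes c :: "'a::euclidean_jordan_algebra"
  assumes "c \<odot> c = c" and "(c \<odot> w) \<bullet> w = 0"
  shows "c \<odot> w = 0"
  using assms(2) unfolding idempotent_inner[OF assms(1)]
  by (simp add: add_nonneg_eq_0_iff)

text \<open>An idempotent \<open>d\<close> is its own square, so \<open>c \<bullet> d\<close> is the value at \<open>d\<close> of the nonnegative quadratic form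
  given by multiplication by \<open>c\<close>.\<close>

lemma idempotents_inner:
  fixes c d :: "'a::euclidean_jordan_algebra"
  assumes "c \<odot> c = c" and "d \<odot> d = d"
  shows "0 \<le> c \<bullet> d" and "c \<bullet> d = 0 \<longleftrightarrow> c \<odot> d = 0"
proof -
  have *: "c \<bullet> d = (c \<odot> d) \<bullet> d"
    by (metis assms(2) inner_jprod_left jprod_commute)
  show "0 \<le> c \<bullet> d"
    unfolding * by (rule idempotent_inner_nonneg[OF assms(1)])
  show "c \<bullet> d = 0 \<longleftrightarrow> c \<odot> d = 0"
    using * idempotent_inner_eq_0[OF assms(1), of d] by auto
qed

lemma orthogonal_idempotents_commute:
  fixes c d :: "'a::euclidean_jordan_algebra"
  assumes "c \<odot> c = c" and "c \<odot> d = 0"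
  shows "c \<odot> (d \<odot> u) = d \<odot> (c \<odot> u)"
  using jordan_commutator[of c d u] assms by simp

text \<open>Decompositions of the unit as they arise from eigenspaces; splitting the idempotents into
  primitive ones refines them to Jordan frames.\<close>

definition idempotent_partition :: "'a::euclidean_jordan_algebra set \<Rightarrow> bool" where
  "idempotent_partition C \<longleftrightarrow> finite C \<and> (\<forall>c\<in>C. c \<odot> c = c \<and> c \<noteq> 0) \<and>
     pairwise (\<lambda>c d. c \<odot> d = 0) C \<and> \<Sum>C = jone"

definition jcomb :: "'a::euclidean_jordan_algebra set \<Rightarrow> ('a \<Rightarrow> real) \<Rightarrow> 'a" where
  "jcomb C l = (\<Sum>c\<in>C. l c *\<^sub>R c)"

lemma jordan_frame_partition: "jordan_frame C \<Longrightarrow> idempotent_partition C"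
  by (auto simp: jordan_frame_def idempotent_partition_def primitive_idempotent_def jidempotent_def)

context
  fixes C :: "'a::euclidean_jordan_algebra set"
  assumes C: "idempotent_partition C"
begin

lemma partition_facts:
  shows "finite C" and "c \<in> C \<Longrightarrow> c \<odot> c = c" and "c \<in> C \<Longrightarrow> c \<noteq> 0"
    and "c \<in> C \<Longrightarrow> d \<in> C \<Longrightarrow> c \<noteq> d \<Longrightarrow> c \<odot> d = 0" and "\<Sum>C = jone"
  using C by (auto simp: idempotent_partition_def pairwise_def)

lemma jcomb_jprod_member: "c \<in> C \<Longrightarrow> jcomb C l \<odot> c = l c *\<^sub>R c"
proof -
  assume c: "c \<in> C"
  have "jcomb C l \<odot> c = (\<Sum>d\<in>C. if d = c then l c *\<^sub>R c else 0)"
    unfolding jcomb_def jprod.sum_left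
    by (rule sum.cong) (use c partition_facts in \<open>auto simp: jprod.scaleR_left\<close>)
  then show ?thesis
    using c partition_facts(1) by simp
qed

lemma jcomb_jprod: "jcomb C l \<odot> jcomb C m = jcomb C (\<lambda>c. l c * m c)"
proof -
  have "jcomb C l \<odot> jcomb C m = (\<Sum>c\<in>C. m c *\<^sub>R (jcomb C l \<odot> c))"
    unfolding jcomb_def[of C m] jprod.sum_right by (simp add: jprod.scaleR_right)
  also have "\<dots> = jcomb C (\<lambda>c. l c * m c)"
    unfolding jcomb_def[of C "\<lambda>c. l c * m c"]
    by (rule sum.cong) (simp_all add: jcomb_jprod_member mult.commute)
  finally show ?thesis .
qed

lemma jcomb_one: "jcomb C (\<lambda>c. 1) = jone"
  by (simp add: jcomb_def partition_facts)

lemma jcomb_commute: "jcomb C l \<odot> (jcomb C m \<odot> u) = jcomb C m \<odot> (jcomb C l \<odot> u)"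
proof -
  have "c \<odot> (d \<odot> u) = d \<odot> (c \<odot> u)" if "c \<in> C" "d \<in> C" for c d
    using that partition_facts orthogonal_idempotents_commute by metis
  then show ?thesis
    unfolding jcomb_def jprod.sum_right jprod.sum_left
    by (subst sum.swap) (simp add: jprod.scaleR_left jprod.scaleR_right mult.commute cong: sum.cong)
qed

lemma jcomb_inner_member: "c \<in> C \<Longrightarrow> jcomb C l \<bullet> c = l c * (c \<bullet> c)"
  by (metis inner_commute inner_jprod_left inner_scaleR_right jcomb_jprod_member jprod_commute
      jprod_jone_right partition_facts(2))

lemma partition_orthogonal: "c \<in> C \<Longrightarrow> d \<in> C \<Longrightarrow> c \<noteq> d \<Longrightarrow> c \<bullet> d = 0"
  using partition_facts idempotents_inner(2) by metis

lemma partition_card_le: "card C \<le> DIM('a)"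
proof -
  have "pairwise orthogonal C"
    by (auto simp: pairwise_def orthogonal_def partition_orthogonal)
  then have "independent C"
    using partition_facts(3) by (intro pairwise_orthogonal_independent) auto
  then show ?thesis
    using independent_card_le by blast
qed

lemma jcomb_linear:
  "jcomb C l + jcomb C m = jcomb C (\<lambda>c. l c + m c)"
  "jcomb C l - jcomb C m = jcomb C (\<lambda>c. l c - m c)"
  "r *\<^sub>R jcomb C l = jcomb C (\<lambda>c. r * l c)"
  by (simp_all add: jcomb_def sum.distrib sum_subtractf scaleR_left_distrib scaleR_left_diff_distrib
      scaleR_sum_right)

end

text \<open>If \<open>jcomb C l = jcomb D m\<close>, the only nonzero terms of \<open>\<Sum>c\<in>C. \<Sum>d\<in>D. c \<odot> d = jone\<close> are those
  with \<open>l c = m d\<close>, since symmetry of multiplication by this element gives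
  \<open>(l c - m d) * (c \<bullet> d) = 0\<close>.\<close>

lemma jcomb_calculus_unique:
  fixes C D :: "'a::euclidean_jordan_algebra set"
  assumes C: "idempotent_partition C" and D: "idempotent_partition D"
    and eq: "jcomb C l = jcomb D m"
  shows "jcomb C (\<lambda>c. f (l c)) = jcomb D (\<lambda>d. f (m d))"
proof -
  note fC = partition_facts[OF C] and fD = partition_facts[OF D]
  have key: "f (l c) *\<^sub>R (c \<odot> d) = f (m d) *\<^sub>R (c \<odot> d)" if "c \<in> C" "d \<in> D" for c d
  proof (cases "c \<odot> d = 0")
    case False
    have "(jcomb C l \<odot> c) \<bullet> d = c \<bullet> (jcomb D m \<odot> d)"
      using eq by (simp add: inner_jprod)
    then have "l c * (c \<bullet> d) = m d * (c \<bullet> d)"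
      using that by (simp add: jcomb_jprod_member[OF C] jcomb_jprod_member[OF D])
    moreover have "c \<bullet> d \<noteq> 0"
      using False that fC fD idempotents_inner(2) by metis
    ultimately show ?thesis by simp
  qed simp
  have "jcomb C (\<lambda>c. f (l c)) = (\<Sum>c\<in>C. \<Sum>d\<in>D. f (l c) *\<^sub>R (c \<odot> d))"
    unfolding jcomb_def
    by (rule sum.cong) (simp_all add: fD(5) flip: scaleR_sum_right jprod.sum_right)
  also have "\<dots> = (\<Sum>c\<in>C. \<Sum>d\<in>D. f (m d) *\<^sub>R (c \<odot> d))"
    by (intro sum.cong refl key)
  also have "\<dots> = (\<Sum>d\<in>D. \<Sum>c\<in>C. f (m d) *\<^sub>R (c \<odot> d))"
    by (rule sum.swap)
  also have "\<dots> = jcomb D (\<lambda>d. f (m d))"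
    unfolding jcomb_def
    by (rule sum.cong) (simp_all add: fC(5) flip: scaleR_sum_right jprod.sum_left)
  finally show ?thesis .
qed

section \<open>The spectral theorem\<close>

text \<open>A maximizer of the Rayleigh quotient on the unit sphere of an invariant subspace.\<close>

lemma symmetric_eigenvector:
  fixes A :: "'a::euclidean_space \<Rightarrow> 'a"
  assumes A: "linear A" and sym: "\<And>x y. A x \<bullet> y = x \<bullet> A y"
    and W: "subspace W" and inv: "\<And>w. w \<in> W \<Longrightarrow> A w \<in> W" and ne: "W \<noteq> {0}"
  obtains q \<mu> where "q \<in> W" "norm q = 1" "A q = \<mu> *\<^sub>R q"
proof -
  interpret linear A by (rule A)
  define S where "S = W \<inter> sphere 0 1"
  have S1: "compact S"
    unfolding S_def using closed_subspace[OF W] by (simp add: closed_Int_compact)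
  obtain w where "w \<in> W" "w \<noteq> 0"
    using ne subspace_0[OF W] by auto
  then have "w /\<^sub>R norm w \<in> S"
    using subspace_scale[OF W] by (simp add: S_def)
  then have S2: "S \<noteq> {}" by auto
  have S3: "continuous_on S (\<lambda>x. A x \<bullet> x)"
    using linear_continuous_on[OF A[unfolded linear_conv_bounded_linear]] by (intro continuous_intros)
  obtain q where q: "q \<in> S" and max: "\<And>y. y \<in> S \<Longrightarrow> A y \<bullet> y \<le> A q \<bullet> q"
    using continuous_attains_sup[OF S1 S2 S3] by blast
  define \<mu> where "\<mu> = A q \<bullet> q"
  have qW: "q \<in> W" and q1: "norm q = 1" "q \<bullet> q = 1"
    using q by (auto simp: S_def dot_square_norm)
  have le: "A y \<bullet> y \<le> \<mu> * (y \<bullet> y)" if "y \<in> W" for y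
  proof (cases "y = 0")
    case False
    have "y /\<^sub>R norm y \<in> S"
      using False subspace_scale[OF W that] by (simp add: S_def)
    then have "A (y /\<^sub>R norm y) \<bullet> (y /\<^sub>R norm y) \<le> \<mu>"
      unfolding \<mu>_def by (rule max)
    moreover have "A (y /\<^sub>R norm y) \<bullet> (y /\<^sub>R norm y) = (A y \<bullet> y) / (y \<bullet> y)"
      by (simp add: scale dot_square_norm power2_eq_square divide_inverse)
    ultimately show ?thesis
      using False by (simp add: pos_divide_le_eq)
  qed (simp add: zero)
  define v where "v = A q - \<mu> *\<^sub>R q"
  have vW: "v \<in> W"
    unfolding v_def by (intro subspace_diff[OF W] subspace_scale[OF W] inv qW)
  have "v \<bullet> v = 0"
  proof (rule ccontr)
    assume "v \<bullet> v \<noteq> 0"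
    then have vv: "v \<bullet> v > 0" by (simp add: less_le)
    define B where "B = \<mu> * (v \<bullet> v) - A v \<bullet> v"
    have expand: "2 * t * (v \<bullet> v) \<le> t\<^sup>2 * B" for t
    proof -
      have "q + t *\<^sub>R v \<in> W"
        by (intro subspace_add[OF W] subspace_scale[OF W] qW vW)
      then have *: "A (q + t *\<^sub>R v) \<bullet> (q + t *\<^sub>R v) \<le> \<mu> * ((q + t *\<^sub>R v) \<bullet> (q + t *\<^sub>R v))"
        by (rule le)
      have e1: "A v \<bullet> q = A q \<bullet> v"
        using sym[of v q] by (simp add: inner_commute)
      have e2: "A q \<bullet> v = v \<bullet> v + \<mu> * (q \<bullet> v)"
      proof -
        have "A q \<bullet> v - \<mu> * (q \<bullet> v) = v \<bullet> v"
          by (subst (3) v_def) (simp add: inner_diff_left)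
        then show ?thesis by simp
      qed
      have "A (q + t *\<^sub>R v) \<bullet> (q + t *\<^sub>R v) = \<mu> + 2 * t * (A q \<bullet> v) + t\<^sup>2 * (A v \<bullet> v)"
        by (simp add: add scale inner_add_left inner_add_right e1 \<mu>_def power2_eq_square
            distrib_left)
      moreover have "(q + t *\<^sub>R v) \<bullet> (q + t *\<^sub>R v) = 1 + 2 * t * (q \<bullet> v) + t\<^sup>2 * (v \<bullet> v)"
        by (simp add: inner_add_left inner_add_right q1 inner_commute[of v q] power2_eq_square
            distrib_left)
      ultimately show ?thesis
        using * unfolding e2 B_def by (simp add: algebra_simps)
    qed
    define t where "t = (v \<bullet> v) / (\<bar>B\<bar> + 1)"
    have t: "t > 0" using vv by (simp add: t_def)
    have "2 * (v \<bullet> v) \<le> t * B"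
      using expand[of t] t by (simp add: power2_eq_square)
    also have "\<dots> \<le> t * (\<bar>B\<bar> + 1)"
      using t by (intro mult_left_mono) auto
    also have "\<dots> = v \<bullet> v"
      unfolding t_def by simp
    finally show False using vv by simp
  qed
  then have "A q = \<mu> *\<^sub>R q" by (simp add: v_def)
  then show thesis using that qW q1 by blast
qed

lemma symmetric_eigen_decomposition:
  fixes A :: "'a::euclidean_space \<Rightarrow> 'a"
  assumes A: "linear A" and sym: "\<And>x y. A x \<bullet> y = x \<bullet> A y"
    and W: "subspace W" and inv: "\<And>w. w \<in> W \<Longrightarrow> A w \<in> W" and v: "v \<in> W"
  shows "\<exists>\<Lambda> u. finite \<Lambda> \<and> (\<forall>t. u t \<in> W \<and> A (u t) = t *\<^sub>R u t) \<and> v = (\<Sum>t\<in>\<Lambda>. u t)"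
  using W inv v
proof (induction "dim W" arbitrary: W v rule: less_induct)
  case less
  interpret linear A by (rule A)
  show ?case
  proof (cases "W = {0}")
    case True
    then show ?thesis
      using less.prems(3) by (intro exI[of _ "{}"] exI[of _ "\<lambda>_. 0"]) (simp add: zero)
  next
    case False
    obtain q \<mu> where q: "q \<in> W" "norm q = 1" "A q = \<mu> *\<^sub>R q"
      using symmetric_eigenvector[OF A sym less.prems(1,2) False] by blast
    define W' where "W' = W \<inter> {w. q \<bullet> w = 0}"
    have W': "subspace W'"
      unfolding W'_def by (intro subspace_inter less.prems subspace_hyperplane)
    have q1: "q \<bullet> q = 1" using q(2) by (simp add: dot_square_norm)
    have "q \<notin> W'"
      using q1 by (simp add: W'_def)
    moreover have "W' \<subseteq> W"
      by (simp add: W'_def)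
    ultimately have "W' \<subset> W"
      using q(1) by (metis psubsetI)
    then have dim: "dim W' < dim W"
      using dim_psubset[of W' W] W' less.prems(1) by (simp add: span_eq_iff[THEN iffD2])
    have inv': "A w \<in> W'" if "w \<in> W'" for w
      using that less.prems(2) q(3) sym[of q w] by (simp add: W'_def)
    define v' where "v' = v - (q \<bullet> v) *\<^sub>R q"
    have "v' \<in> W'"
      using less.prems(3) q q1 subspace_diff[OF less.prems(1)] subspace_scale[OF less.prems(1)]
      by (simp add: W'_def v'_def inner_diff_right)
    then have "\<exists>\<Lambda> u. finite \<Lambda> \<and> (\<forall>t. u t \<in> W' \<and> A (u t) = t *\<^sub>R u t) \<and> v' = (\<Sum>t\<in>\<Lambda>. u t)"
      using less.hyps[OF dim W'] inv' by blast
    then obtain \<Lambda> u where \<Lambda>: "finite \<Lambda>"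
      and u': "\<forall>t. u t \<in> W' \<and> A (u t) = t *\<^sub>R u t" and v': "v' = (\<Sum>t\<in>\<Lambda>. u t)"
      by (elim exE conjE)
    then have u: "\<And>t. u t \<in> W'" "\<And>t. A (u t) = t *\<^sub>R u t"
      by blast+
    \<comment> \<open>Off \<open>\<Lambda>\<close> the vectors \<open>u t\<close> are cut to \<open>0\<close>, so that the new eigenvalue may be added to \<open>\<Lambda>\<close>.\<close>
    define u' where "u' t = (if t \<in> \<Lambda> then u t else 0) + (if t = \<mu> then (q \<bullet> v) *\<^sub>R q else 0)" for t
    have "(\<Sum>t\<in>insert \<mu> \<Lambda>. u' t) = (\<Sum>t\<in>insert \<mu> \<Lambda>. if t \<in> \<Lambda> then u t else 0) + (q \<bullet> v) *\<^sub>R q"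
      unfolding u'_def using \<Lambda> by (simp add: sum.distrib)
    also have "(\<Sum>t\<in>insert \<mu> \<Lambda>. if t \<in> \<Lambda> then u t else 0) = v'"
      unfolding v' using \<Lambda> by (intro sum.mono_neutral_cong_right) auto
    finally have "v = (\<Sum>t\<in>insert \<mu> \<Lambda>. u' t)"
      by (simp add: v'_def)
    moreover have "u' t \<in> W \<and> A (u' t) = t *\<^sub>R u' t" for t
    proof -
      have "u t \<in> W" using u(1) by (simp add: W'_def)
      then show ?thesis
        using q u(2) subspace_add[OF less.prems(1)] subspace_scale[OF less.prems(1)]
          subspace_0[OF less.prems(1)]
        by (auto simp: u'_def add scale zero scaleR_right_distrib)
    qed
    ultimately show ?thesis
      using \<Lambda> by (intro exI[of _ "insert \<mu> \<Lambda>"] exI[of _ u']) simp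
  qed
qed

text \<open>Decompose the unit into eigenvectors of multiplication by \<open>x\<close>, staying inside the set \<open>W\<close> of
  elements whose multiplications commute with those by \<open>x\<close> and by \<open>x \<odot> x\<close>; the Jordan identity makes
  \<open>W\<close> invariant under multiplication by \<open>x\<close>. Two eigenvectors in \<open>W\<close> for different eigenvalues have
  product \<open>0\<close>, because that product is an eigenvector for both; hence the components of the unit are
  orthogonal idempotents.\<close>

lemma idempotent_decomposition:
  fixes x :: "'a::euclidean_jordan_algebra"
  shows "\<exists>C l. idempotent_partition C \<and> x = jcomb C l"
proof -
  define W where "W = {w. (\<forall>u. x \<odot> (w \<odot> u) = w \<odot> (x \<odot> u)) \<and>
    (\<forall>u. (x \<odot> x) \<odot> (w \<odot> u) = w \<odot> ((x \<odot> x) \<odot> u))}"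
  have W: "subspace W"
    unfolding subspace_def W_def
    by (auto simp: jprod.add_left jprod.add_right jprod.scaleR_left jprod.scaleR_right jprod.zero_left
        jprod.zero_right)
  have inv: "x \<odot> w \<in> W" if w: "w \<in> W" for w
  proof -
    have c1: "x \<odot> (w \<odot> u) = w \<odot> (x \<odot> u)" and c2: "(x \<odot> x) \<odot> (w \<odot> u) = w \<odot> ((x \<odot> x) \<odot> u)" for u
      using w by (auto simp: W_def)
    have c3: "x \<odot> ((x \<odot> x) \<odot> u) = (x \<odot> x) \<odot> (x \<odot> u)" for u
      by (rule jordan_identity)
    have d1: "x \<odot> ((x \<odot> w) \<odot> u) = (x \<odot> w) \<odot> (x \<odot> u)" for u
      using jordan_commutator[of x w u] c2[of u] by simp
    have e1: "((x \<odot> x) \<odot> w) \<odot> u = (x \<odot> x) \<odot> (w \<odot> u) + 2 *\<^sub>R ((x \<odot> w) \<odot> (x \<odot> u))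
        - 2 *\<^sub>R (x \<odot> (w \<odot> (x \<odot> u)))" for u
      using jmult_triple_product[of x x w u] by (simp add: scaleR_2)
    have e2: "x \<odot> (((x \<odot> x) \<odot> w) \<odot> u) = ((x \<odot> x) \<odot> w) \<odot> (x \<odot> u)" for u
      unfolding e1 by (simp add: jprod.add_right jprod.diff_right jprod.scaleR_right c1 c3 d1)
    have f1: "((x \<odot> x) \<odot> x) \<odot> u = (x \<odot> x) \<odot> (x \<odot> u) + 2 *\<^sub>R ((x \<odot> x) \<odot> (x \<odot> u))
        - 2 *\<^sub>R (x \<odot> (x \<odot> (x \<odot> u)))" for u
      using jmult_triple_product[of x x x u] by (simp add: scaleR_2)
    have f2: "w \<odot> (((x \<odot> x) \<odot> x) \<odot> u) = ((x \<odot> x) \<odot> x) \<odot> (w \<odot> u)" for u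
      unfolding f1 by (simp add: jprod.add_right jprod.diff_right jprod.scaleR_right c1 c2)
    have d2: "(x \<odot> x) \<odot> ((x \<odot> w) \<odot> u) = (x \<odot> w) \<odot> ((x \<odot> x) \<odot> u)" for u
    proof -
      have g: "x \<odot> x \<odot> w = w \<odot> (x \<odot> x)" "x \<odot> (x \<odot> x) = x \<odot> x \<odot> x"
        by (simp_all add: jprod_commute)
      have "x \<odot> x \<odot> (x \<odot> w \<odot> u) + x \<odot> (w \<odot> (x \<odot> x) \<odot> u) + w \<odot> (x \<odot> x \<odot> x \<odot> u) =
          x \<odot> w \<odot> (x \<odot> x \<odot> u) + w \<odot> (x \<odot> x) \<odot> (x \<odot> u) + x \<odot> x \<odot> x \<odot> (w \<odot> u)"
        using jordan_identity_linearized[of "x \<odot> x" x w u] .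
      then show ?thesis
        using e2[of u] f2[of u] unfolding g by simp
    qed
    show ?thesis
      unfolding W_def using d1 d2 by simp
  qed
  have "jone \<in> W" by (simp add: W_def)
  moreover have "linear (jprod x)"
    by (rule bounded_linear.linear[OF jprod.bounded_linear_right])
  ultimately obtain \<Lambda> u where \<Lambda>: "finite \<Lambda>" and u: "\<And>t. u t \<in> W" "\<And>t. x \<odot> u t = t *\<^sub>R u t"
    and one: "jone = (\<Sum>t\<in>\<Lambda>. u t)"
    using symmetric_eigen_decomposition[of "jprod x" W jone] W inv inner_jprod[of x] by metis
  have orth: "u t \<odot> u \<mu> = 0" if "t \<noteq> \<mu>" for t \<mu>
  proof -
    have "x \<odot> (u t \<odot> u \<mu>) = \<mu> *\<^sub>R (u t \<odot> u \<mu>)"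
      using u(1)[of t] u(2)[of \<mu>] by (simp add: W_def jprod.scaleR_right)
    moreover have "x \<odot> (u \<mu> \<odot> u t) = t *\<^sub>R (u \<mu> \<odot> u t)"
      using u(1)[of \<mu>] u(2)[of t] by (simp add: W_def jprod.scaleR_right)
    ultimately show ?thesis
      using that by (simp add: jprod_commute[of "u \<mu>"])
  qed
  have idem: "u t \<odot> u t = u t" if "t \<in> \<Lambda>" for t
  proof -
    have "u t = u t \<odot> (\<Sum>t\<in>\<Lambda>. u t)" unfolding one[symmetric] by simp
    also have "\<dots> = (\<Sum>\<mu>\<in>\<Lambda>. if \<mu> = t then u t \<odot> u t else 0)"
      unfolding jprod.sum_right by (rule sum.cong) (auto simp: orth)
    finally show ?thesis using that \<Lambda> by simp
  qed
  define \<Lambda>' where "\<Lambda>' = {t\<in>\<Lambda>. u t \<noteq> 0}"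
  have \<Lambda>': "finite \<Lambda>'" "\<Lambda>' \<subseteq> \<Lambda>" using \<Lambda> by (auto simp: \<Lambda>'_def)
  have inj: "inj_on u \<Lambda>'"
    by (rule inj_onI) (metis (mono_tags, lifting) \<Lambda>'_def idem mem_Collect_eq orth)
  define l where "l = inv_into \<Lambda>' u"
  have l: "l (u t) = t" if "t \<in> \<Lambda>'" for t
    using that inj by (simp add: l_def)
  have one': "jone = (\<Sum>t\<in>\<Lambda>'. u t)"
    unfolding one \<Lambda>'_def using \<Lambda> by (intro sum.mono_neutral_right) auto
  have "idempotent_partition (u ` \<Lambda>')"
    unfolding idempotent_partition_def
  proof (intro conjI)
    show "\<Sum>(u ` \<Lambda>') = jone"
      using inj by (simp add: one' sum.reindex)
    show "pairwise (\<lambda>c d. c \<odot> d = 0) (u ` \<Lambda>')"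
      unfolding pairwise_def by (metis imageE orth)
  qed (use \<Lambda>' idem in \<open>auto simp: \<Lambda>'_def\<close>)
  moreover have "x = jcomb (u ` \<Lambda>') l"
  proof -
    have "x = x \<odot> (\<Sum>t\<in>\<Lambda>'. u t)" unfolding one'[symmetric] by simp
    also have "\<dots> = (\<Sum>t\<in>\<Lambda>'. l (u t) *\<^sub>R u t)"
      unfolding jprod.sum_right by (rule sum.cong) (auto simp: u(2) l)
    finally show ?thesis
      using inj by (simp add: jcomb_def sum.reindex)
  qed
  ultimately show ?thesis by blast
qed

text \<open>Among all decompositions of \<open>x\<close> choose one with the largest number of idempotents. If one of
  these splits as \<open>d + f\<close>, both parts are orthogonal to the other idempotents, because inner products
  of idempotents are nonnegative, and so the decomposition could be refined.\<close>

lemma spectral_decomposition_exists: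
  fixes x :: "'a::euclidean_jordan_algebra"
  shows "\<exists>C l. spectral_decomposition x C l"
proof -
  define P where "P = (\<lambda>(C :: 'a set, l). idempotent_partition C \<and> x = jcomb C l)"
  obtain C0 l0 where "P (C0, l0)"
    using idempotent_decomposition[of x] by (auto simp: P_def)
  moreover have "\<forall>y. P y \<longrightarrow> card (fst y) < Suc DIM('a)"
    using partition_card_le by (auto simp: P_def less_Suc_eq_le)
  ultimately obtain y where "P y" and ymax: "\<And>z. P z \<Longrightarrow> card (fst z) \<le> card (fst y)"
    using ex_has_greatest_nat[of P "(C0, l0)" "\<lambda>y. card (fst y)" "Suc DIM('a)"] by blast
  then obtain C l where C: "idempotent_partition C" and x: "x = jcomb C l" and y: "y = (C, l)"
    by (cases y) (auto simp: P_def)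
  have max: "card D \<le> card C" if "idempotent_partition D" "x = jcomb D m" for D m
    using ymax[of "(D, m)"] that by (simp add: P_def y)
  note fC = partition_facts[OF C]
  have "primitive_idempotent c" if c: "c \<in> C" for c
  proof (rule ccontr)
    assume "\<not> primitive_idempotent c"
    then obtain d f where d: "d \<odot> d = d" "d \<noteq> 0" and f: "f \<odot> f = f" "f \<noteq> 0"
      and df: "d \<odot> f = 0" "c = d + f"
      using fC c by (auto simp: primitive_idempotent_def jidempotent_def)
    have orth: "d \<odot> c' = 0 \<and> f \<odot> c' = 0" if c': "c' \<in> C - {c}" for c'
    proof -
      have "c' \<odot> c' = c'" "c \<bullet> c' = 0"
        using c' c fC partition_orthogonal[OF C] by auto
      moreover from this have "0 \<le> d \<bullet> c'" "0 \<le> f \<bullet> c'"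
        using d f idempotents_inner(1) by metis+
      ultimately have "d \<bullet> c' = 0" "f \<bullet> c' = 0"
        by (auto simp: df(2) inner_add_left)
      then show ?thesis
        using d f \<open>c' \<odot> c' = c'\<close> idempotents_inner(2) by metis
    qed
    define D where "D = insert d (insert f (C - {c}))"
    have nd: "d \<notin> C - {c}" "f \<notin> C - {c}" "d \<noteq> f"
      using orth d f df by metis+
    have fin: "finite (C - {c})"
      using fC by simp
    have "idempotent_partition D"
      unfolding idempotent_partition_def
    proof (intro conjI)
      have "\<Sum>D = (d + f) + \<Sum>(C - {c})"
        unfolding D_def using nd fin by (simp add: add.assoc)
      then show "\<Sum>D = jone"
        using trans[OF sum.remove[OF fC(1) c, of "\<lambda>x. x", symmetric] fC(5)]
        unfolding df(2)[symmetric] by (rule trans)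
      show "pairwise (\<lambda>c d. c \<odot> d = 0) D"
      proof -
        have "f \<odot> d = 0"
          using df(1) jprod_commute[of f d] by simp
        moreover have "c' \<odot> d = 0 \<and> c' \<odot> f = 0" if "c' \<in> C - {c}" for c'
          using orth[OF that] jprod_commute[of c'] by metis
        ultimately show ?thesis
          unfolding pairwise_def D_def using orth df(1) fC(4) by auto
      qed
    qed (use fin fC d f in \<open>auto simp: D_def\<close>)
    moreover have "x = jcomb D (l(d := l c, f := l c))"
    proof -
      have "(\<Sum>c'\<in>C - {c}. (l(d := l c, f := l c)) c' *\<^sub>R c') = (\<Sum>c'\<in>C - {c}. l c' *\<^sub>R c')"
        using nd by (intro sum.cong) auto
      then have "jcomb D (l(d := l c, f := l c)) = l c *\<^sub>R (d + f) + (\<Sum>c'\<in>C - {c}. l c' *\<^sub>R c')"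
        unfolding jcomb_def D_def using nd fin by (simp add: scaleR_right_distrib)
      then show ?thesis
        unfolding x df(2)[symmetric] by (simp add: jcomb_def sum.remove[OF fC(1) c])
    qed
    ultimately have "card D \<le> card C" by (rule max)
    moreover have "card D = Suc (Suc (card (C - {c})))"
      unfolding D_def using nd fin by simp
    ultimately show False
      using card_Suc_Diff1[OF fC(1) c] by simp
  qed
  then have "jordan_frame C"
    using C by (auto simp: jordan_frame_def idempotent_partition_def)
  then show ?thesis
    using x by (auto simp: spectral_decomposition_def jcomb_def)
qed

text \<open>The power of \<open>x\<close> is read off from any decomposition into orthogonal idempotents, primitive or not.\<close>

lemma powj_jcomb:
  fixes C :: "'a::euclidean_jordan_algebra set"
  assumes C: "idempotent_partition C"
  shows "jcomb C l powj \<alpha> = jcomb C (\<lambda>c. l c powr \<alpha>)"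
  unfolding jpowr_def
proof (rule the_equality)
  have *: "y = jcomb C (\<lambda>c. l c powr \<alpha>)"
    if "spectral_decomposition (jcomb C l) D m" "y = (\<Sum>c\<in>D. (m c powr \<alpha>) *\<^sub>R c)" for D m y
    using that jcomb_calculus_unique[OF C, of D l m "\<lambda>t. t powr \<alpha>"]
    by (simp add: spectral_decomposition_def jordan_frame_partition jcomb_def)
  then show "y = jcomb C (\<lambda>c. l c powr \<alpha>)"
    if "\<exists>D m. spectral_decomposition (jcomb C l) D m \<and> y = (\<Sum>c\<in>D. (m c powr \<alpha>) *\<^sub>R c)" for y
    using that by blast
  show "\<exists>D m. spectral_decomposition (jcomb C l) D m \<and>
      jcomb C (\<lambda>c. l c powr \<alpha>) = (\<Sum>c\<in>D. (m c powr \<alpha>) *\<^sub>R c)"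
    using spectral_decomposition_exists[of "jcomb C l"] * by metis
qed

section \<open>The cone of squares\<close>

definition square_cone :: "'a::euclidean_jordan_algebra set" where
  "square_cone = range (\<lambda>x. x \<odot> x)"

lemma square_in_square_cone [simp]: "x \<odot> x \<in> square_cone"
  by (simp add: square_cone_def)

lemma idempotent_in_square_cone: "c \<odot> c = c \<Longrightarrow> c \<in> square_cone"
  by (metis square_in_square_cone)

lemma square_cone_inner_nonneg:
  fixes u v :: "'a::euclidean_jordan_algebra"
  assumes "u \<in> square_cone" "v \<in> square_cone"
  shows "0 \<le> u \<bullet> v"
proof -
  obtain w w' where u: "u = w \<odot> w" and v: "v = w' \<odot> w'"
    using assms by (auto simp: square_cone_def)
  obtain C l where C: "idempotent_partition C" and w: "w = jcomb C l"
    using idempotent_decomposition by blast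
  have *: "(c \<odot> w') \<bullet> w' = c \<bullet> (w' \<odot> w')" for c
    unfolding jprod_commute[of c] by (rule inner_jprod_left[symmetric])
  have "u \<bullet> v = (\<Sum>c\<in>C. l c * l c * ((c \<odot> w') \<bullet> w'))"
    unfolding u w v jcomb_jprod[OF C]
    unfolding jcomb_def inner_sum_left
    by (simp add: *)
  also have "\<dots> \<ge> 0"
    using partition_facts(2)[OF C]
    by (intro sum_nonneg mult_nonneg_nonneg[OF zero_le_square] idempotent_inner_nonneg) auto
  finally show ?thesis .
qed

lemma jcomb_in_square_cone:
  fixes C :: "'a::euclidean_jordan_algebra set"
  assumes C: "idempotent_partition C"
  shows "jcomb C l \<in> square_cone \<longleftrightarrow> (\<forall>c\<in>C. 0 \<le> l c)"
proof
  assume *: "jcomb C l \<in> square_cone"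
  show "\<forall>c\<in>C. 0 \<le> l c"
  proof
    fix c assume c: "c \<in> C"
    then have "0 \<le> l c * (c \<bullet> c)"
      using square_cone_inner_nonneg[OF * idempotent_in_square_cone] partition_facts[OF C]
      by (metis jcomb_inner_member[OF C])
    then show "0 \<le> l c"
      using inner_gt_zero_iff[of c, THEN iffD2, OF partition_facts(3)[OF C c]] by (auto simp: zero_le_mult_iff)
  qed
next
  assume "\<forall>c\<in>C. 0 \<le> l c"
  then have "jcomb C l = jcomb C (\<lambda>c. sqrt (l c)) \<odot> jcomb C (\<lambda>c. sqrt (l c))"
    unfolding jcomb_jprod[OF C] by (simp add: jcomb_def)
  then show "jcomb C l \<in> square_cone" by simp
qed

text \<open>An element that pairs nonnegatively with its own spectral idempotents has nonnegative spectral
  values, and so it is a square. This is self-duality of the cone.\<close>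

lemma square_cone_iff_inner:
  fixes u :: "'a::euclidean_jordan_algebra"
  shows "u \<in> square_cone \<longleftrightarrow> (\<forall>v\<in>square_cone. 0 \<le> u \<bullet> v)"
proof
  assume *: "\<forall>v\<in>square_cone. 0 \<le> u \<bullet> v"
  obtain C l where C: "idempotent_partition C" and u: "u = jcomb C l"
    using idempotent_decomposition by blast
  have "0 \<le> l c" if c: "c \<in> C" for c
  proof -
    have "0 \<le> u \<bullet> c"
      using * c partition_facts[OF C] idempotent_in_square_cone by metis
    then show ?thesis
      using inner_gt_zero_iff[of c, THEN iffD2, OF partition_facts(3)[OF C c]] unfolding u jcomb_inner_member[OF C c]
      by (auto simp: zero_le_mult_iff)
  qed
  then show "u \<in> square_cone"
    unfolding u by (simp add: jcomb_in_square_cone[OF C])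
qed (simp add: square_cone_inner_nonneg)

lemma square_cone_add: "u \<in> square_cone \<Longrightarrow> v \<in> square_cone \<Longrightarrow> u + v \<in> square_cone"
  by (subst square_cone_iff_inner) (simp add: inner_add_left square_cone_inner_nonneg)

lemma square_cone_scaleR: "u \<in> square_cone \<Longrightarrow> 0 \<le> r \<Longrightarrow> r *\<^sub>R u \<in> square_cone"
  by (subst square_cone_iff_inner) (simp add: square_cone_inner_nonneg)

lemma closed_square_cone: "closed (square_cone :: 'a::euclidean_jordan_algebra set)"
proof -
  have "square_cone = (\<Inter>v\<in>square_cone. {u :: 'a. 0 \<le> u \<bullet> v})"
    using square_cone_iff_inner by auto
  moreover have "closed (\<Inter>v\<in>square_cone. {u :: 'a. 0 \<le> u \<bullet> v})"
    by (intro closed_INT ballI closed_Collect_le continuous_intros)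
  ultimately show ?thesis by metis
qed

lemma square_cone_inner_jone_eq_0:
  fixes u :: "'a::euclidean_jordan_algebra"
  assumes "u \<in> square_cone" "u \<bullet> jone = 0"
  shows "u = 0"
proof -
  obtain w where "u = w \<odot> w" using assms(1) by (auto simp: square_cone_def)
  moreover from this have "w \<bullet> w = 0"
    using assms(2) jone_inner_square[of w] by (simp add: inner_commute)
  ultimately show ?thesis by simp
qed

text \<open>The unit is an interior point of the cone: it pairs with a square \<open>w \<odot> w\<close> to \<open>w \<bullet> w\<close>, which dominates
  the norm of \<open>w \<odot> w\<close> up to a constant, and the cone is self-dual.\<close>

lemma symmetric_cone_iff:
  fixes x :: "'a::euclidean_jordan_algebra"
  shows "x \<in> symmetric_cone \<longleftrightarrow> (\<exists>\<epsilon>>0. x - \<epsilon> *\<^sub>R jone \<in> square_cone)"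
proof
  assume "x \<in> symmetric_cone"
  then obtain r where r: "r > 0" "cball x r \<subseteq> square_cone"
    by (auto simp: symmetric_cone_def mem_interior_cball square_cone_def)
  define \<epsilon> where "\<epsilon> = r / (norm (jone :: 'a) + 1)"
  have "norm (jone :: 'a) + 1 > 0" by (simp add: add_nonneg_pos)
  then have \<epsilon>: "\<epsilon> > 0" "\<epsilon> * norm (jone :: 'a) \<le> r"
    using r by (simp_all add: \<epsilon>_def field_simps)
  then have "x - \<epsilon> *\<^sub>R jone \<in> cball x r" by (simp add: dist_norm)
  then show "\<exists>\<epsilon>>0. x - \<epsilon> *\<^sub>R jone \<in> square_cone" using r \<epsilon> by blast
next
  assume "\<exists>\<epsilon>>0. x - \<epsilon> *\<^sub>R jone \<in> square_cone"
  then obtain \<epsilon> where \<epsilon>: "\<epsilon> > 0" "x - \<epsilon> *\<^sub>R jone \<in> square_cone" by blast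
  obtain K where K: "K > 0" "\<And>a b :: 'a. norm (a \<odot> b) \<le> norm a * norm b * K"
    using jprod.pos_bounded by blast
  have "ball x (\<epsilon> / K) \<subseteq> square_cone"
  proof
    fix y assume "y \<in> ball x (\<epsilon> / K)"
    then have y: "norm (y - x) * K \<le> \<epsilon>"
      using K by (simp add: dist_norm norm_minus_commute pos_less_divide_eq)
    have "0 \<le> (\<epsilon> *\<^sub>R jone + (y - x)) \<bullet> v" if "v \<in> square_cone" for v
    proof -
      obtain w where v: "v = w \<odot> w" using \<open>v \<in> square_cone\<close> by (auto simp: square_cone_def)
      have "\<bar>(y - x) \<bullet> v\<bar> \<le> norm (y - x) * (norm w * norm w * K)"
        using Cauchy_Schwarz_ineq2[of "y - x" v] mult_left_mono[OF K(2)[of w w], of "norm (y - x)"]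
        unfolding v by auto
      also have "\<dots> = norm (y - x) * K * (w \<bullet> w)"
        by (simp add: dot_square_norm power2_eq_square)
      also have "\<dots> \<le> \<epsilon> * (w \<bullet> w)"
        by (intro mult_right_mono y) simp
      finally show ?thesis
        unfolding v by (simp add: inner_add_left jone_inner_square)
    qed
    then have "\<epsilon> *\<^sub>R jone + (y - x) \<in> square_cone"
      by (subst square_cone_iff_inner) blast
    from square_cone_add[OF this \<epsilon>(2)] show "y \<in> square_cone" by simp
  qed
  moreover have "\<epsilon> / K > 0" using \<epsilon> K by simp
  ultimately show "x \<in> symmetric_cone"
    by (auto simp: symmetric_cone_def mem_interior square_cone_def)
qed

lemma jcomb_in_symmetric_cone:
  fixes C :: "'a::euclidean_jordan_algebra set"
  assumes C: "idempotent_partition C"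
  shows "jcomb C l \<in> symmetric_cone \<longleftrightarrow> (\<forall>c\<in>C. 0 < l c)"
proof -
  have *: "jcomb C l - \<epsilon> *\<^sub>R jone = jcomb C (\<lambda>c. l c - \<epsilon>)" for \<epsilon>
    unfolding jcomb_one[OF C, symmetric] by (simp add: jcomb_linear[OF C])
  show ?thesis
  proof
    assume "jcomb C l \<in> symmetric_cone"
    then show "\<forall>c\<in>C. 0 < l c"
      by (fastforce simp: symmetric_cone_iff * jcomb_in_square_cone[OF C])
  next
    assume pos: "\<forall>c\<in>C. 0 < l c"
    define \<epsilon> where "\<epsilon> = Min (insert 1 (l ` C))"
    have "\<epsilon> > 0" "\<forall>c\<in>C. \<epsilon> \<le> l c"
      using pos partition_facts(1)[OF C] by (auto simp: \<epsilon>_def)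
    then show "jcomb C l \<in> symmetric_cone"
      by (auto simp: symmetric_cone_iff * jcomb_in_square_cone[OF C])
  qed
qed

lemma symmetric_cone_subset_square_cone: "symmetric_cone \<subseteq> square_cone"
  using interior_subset unfolding symmetric_cone_def square_cone_def .

lemma open_symmetric_cone: "open symmetric_cone"
  by (simp add: symmetric_cone_def)

lemma jone_in_symmetric_cone: "jone \<in> symmetric_cone"
  unfolding symmetric_cone_iff
  by (rule exI[of _ 1]) (metis diff_self jprod.zero_left scaleR_one square_in_square_cone zero_less_one)

lemma square_cone_add_jone:
  assumes "x \<in> square_cone" "0 < \<epsilon>" shows "x + \<epsilon> *\<^sub>R jone \<in> symmetric_cone"
  unfolding symmetric_cone_iff using assms by (intro exI[of _ \<epsilon>]) simp

lemma connected_symmetric_cone: "connected (symmetric_cone :: 'a::euclidean_jordan_algebra set)"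
proof -
  have "convex (range (\<lambda>x :: 'a. x \<odot> x))"
    unfolding convex_def square_cone_def[symmetric]
    by (auto intro: square_cone_add square_cone_scaleR)
  then show ?thesis
    by (simp add: symmetric_cone_def convex_connected convex_interior)
qed

section \<open>Powers of elements of the cone\<close>

lemma symmetric_cone_cases:
  assumes "x \<in> symmetric_cone"
  obtains C l where "idempotent_partition C" "x = jcomb C l" "\<forall>c\<in>C. 0 < l c"
proof -
  obtain C l where C: "idempotent_partition C" "x = jcomb C l"
    using idempotent_decomposition by blast
  then have "\<forall>c\<in>C. 0 < l c" using assms jcomb_in_symmetric_cone by blast
  then show thesis using that C by blast
qed

lemma jcomb_cong: "(\<And>c. c \<in> C \<Longrightarrow> l c = m c) \<Longrightarrow> jcomb C l = jcomb C m"
  by (simp add: jcomb_def)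

lemma powj_in_cone:
  assumes "x \<in> symmetric_cone" shows "x powj \<alpha> \<in> symmetric_cone"
  using assms by (rule symmetric_cone_cases) (fastforce simp: powj_jcomb jcomb_in_symmetric_cone)

lemma powj_powj:
  assumes "x \<in> symmetric_cone" shows "(x powj \<alpha>) powj \<beta> = x powj (\<alpha> * \<beta>)"
  using assms by (rule symmetric_cone_cases) (simp add: powj_jcomb powr_powr)

lemma powj_one:
  assumes "x \<in> symmetric_cone" shows "x powj 1 = x"
  using assms by (rule symmetric_cone_cases) (auto simp: powj_jcomb intro!: jcomb_cong)

lemma powj_zero:
  assumes "x \<in> symmetric_cone" shows "x powj 0 = jone"
  using assms
proof (rule symmetric_cone_cases)
  fix C l assume C: "idempotent_partition C" "x = jcomb C l" "\<forall>c\<in>C. 0 < l c"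
  then have "x powj 0 = jcomb C (\<lambda>c. 1)"
    by (auto simp: powj_jcomb intro!: jcomb_cong)
  then show ?thesis by (simp add: jcomb_one[OF C(1)])
qed

lemma powj_add:
  assumes "x \<in> symmetric_cone" shows "x powj \<alpha> \<odot> x powj \<beta> = x powj (\<alpha> + \<beta>)"
  using assms by (rule symmetric_cone_cases) (simp add: powj_jcomb jcomb_jprod powr_add)

lemma powj_half_square:
  assumes "y \<in> symmetric_cone" shows "(y \<odot> y) powj (1/2) = y"
proof -
  have "y \<odot> y = y powj 2"
    using powj_add[OF assms, of 1 1] by (simp add: powj_one[OF assms])
  then show ?thesis
    by (simp add: powj_powj[OF assms] powj_one[OF assms])
qed

lemma square_powj_half:
  assumes "x \<in> symmetric_cone" shows "x powj (1/2) \<odot> x powj (1/2) = x"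
  using assms by (simp add: powj_add powj_one)

lemma square_in_symmetric_cone: "y \<in> symmetric_cone \<Longrightarrow> y \<odot> y \<in> symmetric_cone"
  using powj_add[of y 1 1] powj_in_cone[of y 2] by (simp add: powj_one)

section \<open>The quadratic representation\<close>

lemma quad_rep_jone_arg: "quad_rep x jone = x \<odot> x"
  by (simp add: quad_rep_apply scaleR_2)

lemma quad_rep_jone: "quad_rep jone = id_blinfun"
  by (rule blinfun_eqI) (simp add: quad_rep_apply scaleR_2)

lemma quad_rep_self_adjoint: "quad_rep x u \<bullet> v = u \<bullet> quad_rep x v"
  for x :: "'a::euclidean_jordan_algebra"
  by (simp add: quad_rep_apply inner_diff_left inner_diff_right inner_jprod)

text \<open>For \<open>x\<close> and \<open>y\<close> in a set with commuting multiplications that is closed under products, the triple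
  product identity expands multiplication by \<open>(x \<odot> x) \<odot> (y \<odot> y)\<close> in two ways, according to the
  bracketing of this product. Comparison of the two expansions evaluates the square of multiplication
  by \<open>x \<odot> y\<close>, and both terms of the quadratic representation of \<open>x \<odot> y\<close> are then known.\<close>

lemma quad_rep_jprod:
  fixes x y :: "'a::euclidean_jordan_algebra"
  assumes comm: "\<And>a b u. a \<in> S \<Longrightarrow> b \<in> S \<Longrightarrow> a \<odot> (b \<odot> u) = b \<odot> (a \<odot> u)"
    and closed: "\<And>a b. a \<in> S \<Longrightarrow> b \<in> S \<Longrightarrow> a \<odot> b \<in> S" and x: "x \<in> S" and y: "y \<in> S"
  shows "quad_rep x (quad_rep y u) = quad_rep (x \<odot> y) u"
proof -
  define z p q where "z = x \<odot> y" and "p = x \<odot> x" and "q = y \<odot> y"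
  have mem: "p \<in> S" "q \<in> S" "z \<in> S"
    using x y closed by (auto simp: z_def p_def q_def)
  note c = comm[OF mem(2) mem(1)] comm[OF mem(3) mem(1)] comm[OF x mem(1)] comm[OF y mem(1)]
    comm[OF mem(3) mem(2)] comm[OF x mem(2)] comm[OF y mem(2)]
    comm[OF x mem(3)] comm[OF y mem(3)] comm[OF y x]
  note lin = jprod.add_right jprod.diff_right jprod.scaleR_right
  have assoc: "(a \<odot> b) \<odot> d = a \<odot> (b \<odot> d)" if "a \<in> S" "b \<in> S" "d \<in> S" for a b d
    using comm[OF that(1,3), of b] by (simp add: jprod_commute)
  have xq: "x \<odot> q = q \<odot> x" and zx: "z \<odot> x = p \<odot> y" and zy: "z \<odot> y = q \<odot> x" and zz: "z \<odot> z = p \<odot> q"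
    and zxy: "(p \<odot> y) \<odot> y = p \<odot> q" and yx: "y \<odot> x = z"
    unfolding z_def p_def q_def using assoc[OF x y x] assoc[OF x x y] assoc[OF x y y]
      assoc[of "x \<odot> x" y y] assoc[of "x \<odot> y" x y] comm[OF x y, of x] comm[OF x y, of "x \<odot> y"]
      assoc[OF x y, of "x \<odot> y"] assoc[OF x x, of "y \<odot> y"] closed x y
    by (simp_all add: jprod_commute)
  have a1: "(q \<odot> x) \<odot> v = q \<odot> (x \<odot> v) + 2 *\<^sub>R (z \<odot> (y \<odot> v)) - 2 *\<^sub>R (x \<odot> (y \<odot> (y \<odot> v)))" for v
    using jmult_triple_product[of y y x v] by (simp add: yx q_def[symmetric] scaleR_2 c)
  have a2: "(p \<odot> y) \<odot> v = p \<odot> (y \<odot> v) + 2 *\<^sub>R (z \<odot> (x \<odot> v)) - 2 *\<^sub>R (x \<odot> (x \<odot> (y \<odot> v)))" for v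
    using jmult_triple_product[of x x y v] by (simp add: z_def[symmetric] p_def[symmetric] scaleR_2 c)
  have e1: "(p \<odot> q) \<odot> u = p \<odot> (q \<odot> u) + 2 *\<^sub>R ((q \<odot> x) \<odot> (x \<odot> u)) - 2 *\<^sub>R (q \<odot> (x \<odot> (x \<odot> u)))"
    using jmult_triple_product[of x x q u] by (simp add: p_def[symmetric] xq scaleR_2 c)
  have e2: "(p \<odot> q) \<odot> u = (p \<odot> y) \<odot> (y \<odot> u) + (q \<odot> x) \<odot> (x \<odot> u) + z \<odot> (z \<odot> u)
      - 2 *\<^sub>R (z \<odot> (x \<odot> (y \<odot> u)))"
    using jmult_triple_product[of z x y u]
    by (simp add: zx zy zxy z_def[symmetric] scaleR_2 c)
  have sq: "z \<odot> (z \<odot> u) = p \<odot> (q \<odot> u) + 2 *\<^sub>R (z \<odot> (x \<odot> (y \<odot> u)))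
     - p \<odot> (y \<odot> (y \<odot> u)) - q \<odot> (x \<odot> (x \<odot> u))"
    using e1 e2 unfolding a1 a2 by (simp add: lin c scaleR_2 algebra_simps)
  have "quad_rep z u = 2 *\<^sub>R (z \<odot> (z \<odot> u)) - (p \<odot> q) \<odot> u"
    by (simp add: quad_rep_apply zz)
  also have "\<dots> = quad_rep x (quad_rep y u)"
    unfolding e1 a1 sq quad_rep_apply p_def[symmetric] q_def[symmetric]
    by (simp add: lin c scaleR_2 algebra_simps)
  finally show ?thesis by (simp add: z_def)
qed

lemma quad_rep_jcomb:
  assumes C: "idempotent_partition C"
  shows "quad_rep (jcomb C l) (quad_rep (jcomb C m) u) = quad_rep (jcomb C (\<lambda>c. l c * m c)) u"
  using quad_rep_jprod[of "range (jcomb C)" "jcomb C l" "jcomb C m" u]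
  by (force simp: jcomb_commute[OF C] jcomb_jprod[OF C])

lemma quad_rep_powj_add:
  assumes "x \<in> symmetric_cone"
  shows "quad_rep (x powj \<alpha>) (quad_rep (x powj \<beta>) u) = quad_rep (x powj (\<alpha> + \<beta>)) u"
  using assms by (rule symmetric_cone_cases) (simp add: powj_jcomb quad_rep_jcomb powr_add)

section \<open>Invariance of the cone\<close>

text \<open>For an idempotent \<open>c\<close>, this map acts as \<open>a\<close>, \<open>b\<close> and \<open>1\<close> on the eigenspaces of multiplication
  by \<open>c\<close> for the eigenvalues \<open>1\<close>, \<open>1/2\<close> and \<open>0\<close>.\<close>

definition peirce_map :: "'a::euclidean_jordan_algebra \<Rightarrow> real \<Rightarrow> real \<Rightarrow> 'a \<Rightarrow> 'a" where
  "peirce_map c a b w = w + (4 * b - a - 3) *\<^sub>R (c \<odot> w) + (2 * a - 4 * b + 2) *\<^sub>R (c \<odot> (c \<odot> w))"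

lemma peirce_map_mult:
  fixes c :: "'a::euclidean_jordan_algebra"
  assumes "c \<odot> c = c"
  shows "peirce_map c a b (peirce_map c a' b' w) = peirce_map c (a * a') (b * b') w"
proof -
  define A B where "A = c \<odot> w" and "B = c \<odot> A"
  have half: "v = (1/2) *\<^sub>R (2 *\<^sub>R v)" for v :: 'a by simp
  have C: "c \<odot> B = (3/2) *\<^sub>R B - (1/2) *\<^sub>R A"
    unfolding A_def B_def
    by (subst half, subst idempotent_cubic[OF assms]) (simp add: scaleR_diff_right)
  have D: "c \<odot> (c \<odot> B) = (7/4) *\<^sub>R B - (3/4) *\<^sub>R A"
    unfolding C by (simp add: jprod.diff_right jprod.scaleR_right C B_def[symmetric] scaleR_diff_right
        flip: scaleR_left_diff_distrib)
  have gen: "(w + p' *\<^sub>R A + q' *\<^sub>R B) + p *\<^sub>R (c \<odot> (w + p' *\<^sub>R A + q' *\<^sub>R B))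
      + q *\<^sub>R (c \<odot> (c \<odot> (w + p' *\<^sub>R A + q' *\<^sub>R B)))
    = w + (p + p' - (p * q' + q * p') / 2 - 3/4 * (q * q')) *\<^sub>R A
        + (q + q' + p * p' + 3/2 * (p * q' + q * p') + 7/4 * (q * q')) *\<^sub>R B" for p q p' q'
    by (rule vector_eq_rdot[THEN iffD1], rule allI)
      (simp add: jprod.add_right jprod.scaleR_right jprod.diff_right C D A_def[symmetric]
        B_def[symmetric] inner_add_left inner_diff_left, simp add: field_simps)
  define p q p' q' where "p = 4 * b - a - 3" and "q = 2 * a - 4 * b + 2"
    and "p' = 4 * b' - a' - 3" and "q' = 2 * a' - 4 * b' + 2"
  have st: "p + p' - (p * q' + q * p') / 2 - 3/4 * (q * q') = 4 * (b * b') - a * a' - 3"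
    and st': "q + q' + p * p' + 3/2 * (p * q' + q * p') + 7/4 * (q * q') = 2 * (a * a') - 4 * (b * b') + 2"
    by (simp_all add: p_def q_def p'_def q'_def field_simps)
  show ?thesis
    unfolding peirce_map_def A_def[symmetric] B_def[symmetric] p_def[symmetric] q_def[symmetric]
      p'_def[symmetric] q'_def[symmetric] gen st st' ..
qed

lemma peirce_map_one: "peirce_map c 1 1 w = w"
  by (simp add: peirce_map_def)

lemma quad_rep_peirce_map:
  fixes c :: "'a::euclidean_jordan_algebra"
  assumes "c \<odot> c = c"
  shows "quad_rep (jone + (s - 1) *\<^sub>R c) w = peirce_map c (s\<^sup>2) s w"
proof -
  define t where "t = s - 1"
  have "quad_rep (jone + t *\<^sub>R c) w = w + (2 * t - t\<^sup>2) *\<^sub>R (c \<odot> w) + (2 * t\<^sup>2) *\<^sub>R (c \<odot> (c \<odot> w))"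
    by (rule vector_eq_rdot[THEN iffD1], rule allI)
      (simp add: quad_rep_apply jprod.add_left jprod.add_right jprod.scaleR_left jprod.scaleR_right
        assms power2_eq_square inner_add_left inner_diff_left, simp add: algebra_simps)
  moreover have "s = t + 1" by (simp add: t_def)
  ultimately show ?thesis
    by (simp add: peirce_map_def power2_eq_square algebra_simps)
qed

text \<open>Write \<open>w = w\<^sub>+ - w\<^sub>-\<close> by its positive and negative spectral values, so that
  \<open>w\<^sub>+ \<odot> w\<^sub>- = 0\<close>. If \<open>v = w - h *\<^sub>R (c \<odot> w)\<close> is in the cone, pairing \<open>v\<close> with \<open>w\<^sub>-\<close> leaves only terms
  in \<open>w\<^sub>-\<close>, and forces \<open>w\<^sub>- = 0\<close>. The map \<open>v \<mapsto> w\<close> is \<open>peirce_map c (1 / (1 - h)) (1 / (1 - h / 2))\<close>.\<close>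

lemma resolvent_square_cone:
  fixes c :: "'a::euclidean_jordan_algebra"
  assumes c: "c \<odot> c = c" and h: "h < 1" and v: "v \<in> square_cone"
  shows "peirce_map c (1 / (1 - h)) (1 / (1 - h / 2)) v \<in> square_cone"
proof -
  define w where "w = peirce_map c (1 / (1 - h)) (1 / (1 - h / 2)) v"
  have "peirce_map c (1 - h) (1 - h / 2) w = v"
    unfolding w_def peirce_map_mult[OF c] using h by (simp add: peirce_map_one)
  then have vw: "v = w - h *\<^sub>R (c \<odot> w)"
    by (simp add: peirce_map_def)
  obtain C l where C: "idempotent_partition C" and w: "w = jcomb C l"
    using idempotent_decomposition by blast
  define p n where "p = jcomb C (\<lambda>d. max (l d) 0)" and "n = jcomb C (\<lambda>d. max (- l d) 0)"
  have "w = p - n"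
    unfolding w p_def n_def jcomb_linear[OF C] by (rule jcomb_cong) auto
  have "p \<odot> n = jcomb C (\<lambda>d. 0)"
    unfolding p_def n_def jcomb_jprod[OF C] by (rule jcomb_cong) auto
  then have pn: "p \<odot> n = 0"
    by (simp add: jcomb_def)
  have pn1: "p \<bullet> n = 0"
    using inner_jprod[of p jone n] pn by simp
  have pn2: "(c \<odot> p) \<bullet> n = 0"
    using inner_jprod[of p c n] pn by (simp add: jprod_commute)
  have n: "n \<in> square_cone"
    unfolding n_def by (simp add: jcomb_in_square_cone[OF C])
  define q where "q = (c \<odot> n) \<bullet> n"
  have q0: "0 \<le> q"
    unfolding q_def by (rule idempotent_inner_nonneg[OF c])
  have "(jone - c) \<odot> (jone - c) = jone - c"
    by (simp add: jprod.diff_left jprod.diff_right c)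
  from idempotent_inner_nonneg[OF this, of n] have q1: "q \<le> n \<bullet> n"
    by (simp add: q_def jprod.diff_left inner_diff_left)
  have "0 \<le> v \<bullet> n"
    by (rule square_cone_inner_nonneg[OF v n])
  also have "v \<bullet> n = h * q - n \<bullet> n"
    unfolding vw \<open>w = p - n\<close>
    by (simp add: inner_diff_left jprod.diff_right pn1 pn2 q_def algebra_simps)
  finally have *: "n \<bullet> n \<le> h * q" by simp
  have "n \<bullet> n \<le> 0"
  proof (cases "h \<le> 0")
    case True
    then show ?thesis using * q0 by (meson mult_nonpos_nonneg order_trans)
  next
    case False
    then have "h * q \<le> h * (n \<bullet> n)" using q1 by simp
    then have "(1 - h) * (n \<bullet> n) \<le> 0" using * by (simp add: algebra_simps)
    then show ?thesis using h by (simp add: mult_le_0_iff)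
  qed
  then have "n \<bullet> n = 0"
    using inner_ge_zero[of n] by linarith
  then have "n = 0" by simp
  then have "w = p" using \<open>w = p - n\<close> by simp
  then show ?thesis
    unfolding w_def[symmetric] by (simp add: p_def jcomb_in_square_cone[OF C])
qed

text \<open>Powers of these resolvents converge to the one-parameter group
  \<open>peirce_map c (exp t) (exp (t / 2))\<close>.\<close>

lemma quad_rep_idempotent_square_cone:
  fixes c :: "'a::euclidean_jordan_algebra"
  assumes c: "c \<odot> c = c" and s: "0 < s" and v: "v \<in> square_cone"
  shows "quad_rep (jone + (s - 1) *\<^sub>R c) v \<in> square_cone"
proof -
  define t where "t = 2 * ln s"
  have pow: "peirce_map c ((1 / (1 - h)) ^ n) ((1 / (1 - h / 2)) ^ n) v \<in> square_cone" if "h < 1" for h n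
  proof (induction n)
    case (Suc n)
    from resolvent_square_cone[OF c that this] show ?case
      by (simp only: peirce_map_mult[OF c] power_Suc)
  qed (simp add: peirce_map_one v)
  define a b where "a n = (1 / (1 - t / real n)) ^ n" and "b n = (1 / (1 - t / real n / 2)) ^ n" for n
  have lim: "(\<lambda>n. (1 / (1 - r / real n)) ^ n) \<longlonglongrightarrow> exp r" for r
  proof -
    have "(\<lambda>n. inverse ((1 + (- r) / real n) ^ n)) \<longlonglongrightarrow> inverse (exp (- r))"
      by (intro tendsto_inverse tendsto_exp_limit_sequentially) simp
    then show ?thesis
      by (simp add: exp_minus power_one_over divide_inverse power_inverse)
  qed
  have a: "a \<longlonglongrightarrow> exp t" and b: "b \<longlonglongrightarrow> exp (t / 2)"
    unfolding a_def b_def using lim[of t] lim[of "t / 2"] by (simp_all add: mult.commute)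
  have "(\<lambda>n. peirce_map c (a n) (b n) v) \<longlonglongrightarrow> peirce_map c (exp t) (exp (t / 2)) v"
    unfolding peirce_map_def by (intro tendsto_intros a b)
  moreover have "eventually (\<lambda>n. peirce_map c (a n) (b n) v \<in> square_cone) sequentially"
  proof -
    obtain N :: nat where N: "\<bar>t\<bar> < real N" using reals_Archimedean2 by blast
    have "peirce_map c (a n) (b n) v \<in> square_cone" if "n \<ge> N" for n
    proof -
      have "real N \<le> real n" using that by simp
      then have "t < real n" "0 < real n" using N by linarith+
      then have "t / real n < 1" by (simp add: divide_simps)
      from pow[OF this, of n] show ?thesis by (simp add: a_def b_def)
    qed
    then show ?thesis by (auto simp: eventually_sequentially)
  qed
  ultimately have "peirce_map c (exp t) (exp (t / 2)) v \<in> square_cone"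
    using Lim_in_closed_set[OF closed_square_cone] by (metis trivial_limit_sequentially)
  moreover have "exp t = s\<^sup>2" "exp (t / 2) = s"
    using s by (simp_all add: t_def exp_double)
  ultimately show ?thesis by (simp add: quad_rep_peirce_map[OF c])
qed

text \<open>The element \<open>x\<close> is the product of the commuting factors \<open>jone + (l c - 1) *\<^sub>R c\<close> over its spectral
  idempotents, and the quadratic representation is multiplicative on these.\<close>

lemma quad_rep_square_cone:
  fixes x :: "'a::euclidean_jordan_algebra"
  assumes "x \<in> symmetric_cone" and v: "v \<in> square_cone"
  shows "quad_rep x v \<in> square_cone"
  using assms(1)
proof (rule symmetric_cone_cases)
  fix C :: "'a set" and l
  assume C: "idempotent_partition C" and x: "x = jcomb C l" and l: "\<forall>c\<in>C. 0 < l c"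
  note fC = partition_facts[OF C]
  have "quad_rep (jcomb C (\<lambda>c. if c \<in> S then l c else 1)) v \<in> square_cone" if "S \<subseteq> C" for S
    using finite_subset[OF that fC(1)] that
  proof (induction S rule: finite_induct)
    case empty
    then show ?case by (simp add: jcomb_one[OF C] quad_rep_jone v)
  next
    case (insert d S)
    have d: "d \<in> C" using insert by simp
    have "jcomb C (\<lambda>c. if c = d then l d else 1) = jcomb C (\<lambda>c. 1 + (l d - 1) * (if c = d then 1 else 0))"
      by (rule jcomb_cong) simp
    also have "\<dots> = jone + (l d - 1) *\<^sub>R jcomb C (\<lambda>c. if c = d then 1 else 0)"
      by (simp only: jcomb_linear[OF C] jcomb_one[OF C, symmetric])
    also have "jcomb C (\<lambda>c. if c = d then 1 else 0) = (\<Sum>c\<in>C. if c = d then d else 0)"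
      unfolding jcomb_def by (rule sum.cong) auto
    also have "\<dots> = d" using fC(1) d by simp
    finally have one: "jcomb C (\<lambda>c. if c = d then l d else 1) = jone + (l d - 1) *\<^sub>R d" .
    have "jcomb C (\<lambda>c. if c \<in> insert d S then l c else 1)
        = jcomb C (\<lambda>c. (if c = d then l d else 1) * (if c \<in> S then l c else 1))"
      using insert by (intro jcomb_cong) auto
    then show ?case
      using quad_rep_idempotent_square_cone[OF fC(2)[OF d], of "l d"] insert l
      by (simp add: one flip: quad_rep_jcomb[OF C])
  qed
  from this[of C] have "quad_rep (jcomb C (\<lambda>c. if c \<in> C then l c else 1)) v \<in> square_cone"
    by simp
  moreover have "x = jcomb C (\<lambda>c. if c \<in> C then l c else 1)"
    unfolding x by (rule jcomb_cong) simp
  ultimately show ?thesis by simp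
qed

lemma quad_rep_powj_inverse:
  assumes "x \<in> symmetric_cone"
  shows "quad_rep (x powj \<alpha>) (quad_rep (x powj (- \<alpha>)) u) = u"
    and "quad_rep (x powj (- \<alpha>)) (quad_rep (x powj \<alpha>) u) = u"
  by (simp_all add: quad_rep_powj_add[OF assms] powj_zero[OF assms] quad_rep_jone)

lemma quad_rep_powj_jone:
  "x \<in> symmetric_cone \<Longrightarrow> quad_rep (x powj \<alpha>) jone = x powj (2 * \<alpha>)"
  by (simp add: quad_rep_jone_arg powj_add)

lemma linear_bij_symmetric_cone:
  fixes f :: "'a::euclidean_jordan_algebra \<Rightarrow> 'a"
  assumes "linear f" "bij f" "f ` square_cone = square_cone"
  shows "f ` symmetric_cone = symmetric_cone"
  using interior_surjective_linear_image[of f "square_cone"] assms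
  by (simp add: symmetric_cone_def square_cone_def bij_is_surj)

lemma quad_rep_cone_group:
  fixes x :: "'a::euclidean_jordan_algebra"
  assumes x: "x \<in> symmetric_cone"
  shows "quad_rep x \<in> cone_group"
proof -
  define y where "y = x powj (-1)"
  have inv: "quad_rep x (quad_rep y u) = u" "quad_rep y (quad_rep x u) = u" for u
    unfolding y_def using quad_rep_powj_inverse[OF x, of 1 u] by (simp_all add: powj_one[OF x])
  then have bij: "bij (quad_rep x)"
    by (intro o_bij[of "quad_rep y"]) auto
  have "y \<in> symmetric_cone"
    using powj_in_cone[OF x] by (simp add: y_def)
  have "quad_rep x ` square_cone = square_cone"
  proof
    show "square_cone \<subseteq> quad_rep x ` square_cone"
      using quad_rep_square_cone[OF \<open>y \<in> symmetric_cone\<close>] inv(1) by (metis image_eqI subsetI)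
  qed (use quad_rep_square_cone[OF x] in blast)
  then show ?thesis
    using bij linear_bij_symmetric_cone[of "quad_rep x"]
    by (simp add: cone_group_def bounded_linear.linear[OF blinfun.bounded_linear_right])
qed

lemma quad_rep_symmetric_cone:
  "x \<in> symmetric_cone \<Longrightarrow> v \<in> symmetric_cone \<Longrightarrow> quad_rep x v \<in> symmetric_cone"
  using quad_rep_cone_group[of x] by (auto simp: cone_group_def)

lemma cone_group_comp: "g \<in> cone_group \<Longrightarrow> h \<in> cone_group \<Longrightarrow> g o\<^sub>L h \<in> cone_group"
proof -
  assume *: "g \<in> cone_group" "h \<in> cone_group"
  then have "(blinfun_apply g \<circ> blinfun_apply h) ` symmetric_cone = symmetric_cone"
    unfolding image_comp[symmetric] by (simp add: cone_group_def)
  then show ?thesis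
    using * by (simp add: cone_group_def blinfun_compose.rep_eq bij_comp)
qed

lemma quad_rep_inject:
  fixes x :: "'a::euclidean_jordan_algebra"
  assumes "x \<in> symmetric_cone" "quad_rep x u = quad_rep x v"
  shows "u = v"
  using quad_rep_powj_inverse(2)[OF assms(1), of 1] assms(2) by (metis powj_one[OF assms(1)])

lemma quad_rep_powj_minus_one:
  fixes x :: "'a::euclidean_jordan_algebra"
  assumes x: "x \<in> symmetric_cone"
  shows "quad_rep x (x powj (-1)) = x" and "quad_rep (x powj (1/2)) (x powj (-1)) = jone"
    and "quad_rep (x powj (-1/2)) x = jone" and "quad_rep (x powj (1/2)) jone = x"
proof -
  have *: "quad_rep (x powj \<alpha>) (x powj \<beta>) = x powj (2 * \<alpha> + \<beta>)" for \<alpha> \<beta>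
    using quad_rep_powj_add[OF x, of \<alpha> "\<beta> / 2" jone]
    by (simp add: quad_rep_powj_jone[OF x] algebra_simps)
  show "quad_rep x (x powj (-1)) = x" "quad_rep (x powj (1/2)) (x powj (-1)) = jone"
    "quad_rep (x powj (-1/2)) x = jone" "quad_rep (x powj (1/2)) jone = x"
    using *[of 1 "-1"] *[of "1/2" "-1"] *[of "-1/2" 1] *[of "1/2" 0]
    by (simp_all add: powj_one[OF x] powj_zero[OF x])
qed

section \<open>Automorphisms of the cone that fix the unit\<close>

text \<open>The cone of squares is the closure of the symmetric cone.\<close>

lemma linear_square_cone_image:
  fixes f :: "'a::euclidean_jordan_algebra \<Rightarrow> 'a"
  assumes f: "linear f" and im: "f ` symmetric_cone \<subseteq> symmetric_cone" and u: "u \<in> square_cone"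
  shows "f u \<in> square_cone"
proof -
  have "(\<lambda>n. f u + (1 / real (Suc n)) *\<^sub>R f jone) \<longlonglongrightarrow> f u + 0 *\<^sub>R f jone"
    by (intro tendsto_intros LIMSEQ_Suc[OF lim_1_over_n])
  moreover have "f u + (1 / real (Suc n)) *\<^sub>R f jone \<in> square_cone" for n
  proof -
    have "f (u + (1 / real (Suc n)) *\<^sub>R jone) \<in> symmetric_cone"
      using im square_cone_add_jone[OF u, of "1 / real (Suc n)"] by auto
    then show ?thesis
      using symmetric_cone_subset_square_cone by (auto simp: linear_add[OF f] linear_scale[OF f])
  qed
  ultimately show ?thesis
    using closed_sequentially[OF closed_square_cone] by fastforce
qed

text \<open>The idempotents are the extreme points of the order interval between \<open>0\<close> and the unit. Here:
  if \<open>f c\<close> had a spectral value strictly between \<open>0\<close> and \<open>1\<close>, with idempotent \<open>d\<close>, then a positive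
  multiple \<open>z\<close> of the preimage of \<open>d\<close> would lie below both \<open>c\<close> and \<open>jone - c\<close>, and such a \<open>z\<close> is
  \<open>0\<close>.\<close>

lemma unital_cone_map_idempotent:
  fixes f :: "'a::euclidean_jordan_algebra \<Rightarrow> 'a"
  assumes f: "linear f" and bij: "bij f" and im: "f ` symmetric_cone = symmetric_cone"
    and one: "f jone = jone" and c: "c \<odot> c = c"
  shows "f c \<odot> f c = f c"
proof -
  define h where "h = inv f"
  have fh: "f (h u) = u" "h (f u) = u" for u
    using bij by (simp_all add: h_def bij_is_surj surj_f_inv_f bij_is_inj)
  have h: "linear h"
    unfolding h_def using f bij by (simp add: bij_is_inj bij_is_surj inj_linear_imp_inv_linear)
  have him: "h ` symmetric_cone \<subseteq> symmetric_cone"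
    using im fh by (metis (no_types, lifting) equalityE image_subset_iff imageE subsetI)
  note fsq = linear_square_cone_image[OF f equalityD1[OF im]]
    and hsq = linear_square_cone_image[OF h him]
  have c': "(jone - c) \<odot> (jone - c) = jone - c"
    by (simp add: jprod.diff_left jprod.diff_right c)
  note csq = idempotent_in_square_cone[OF c] idempotent_in_square_cone[OF c']
  obtain D m where D: "idempotent_partition D" and fc: "f c = jcomb D m"
    using idempotent_decomposition by blast
  have "jcomb D m \<in> square_cone"
    using fsq[OF csq(1)] fc by simp
  moreover have "jcomb D (\<lambda>d. 1 - m d) \<in> square_cone"
    using fsq[OF csq(2)] unfolding linear_diff[OF f] one fc
    by (simp add: jcomb_one[OF D, symmetric] jcomb_linear[OF D])
  ultimately have m: "0 \<le> m d" "m d \<le> 1" if "d \<in> D" for d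
    using that by (simp_all add: jcomb_in_square_cone[OF D])
  have "m d = 0 \<or> m d = 1" if d: "d \<in> D" for d
  proof (rule ccontr)
    assume "\<not> (m d = 0 \<or> m d = 1)"
    define \<epsilon> where "\<epsilon> = min (m d) (1 - m d)"
    have \<epsilon>: "0 < \<epsilon>" "\<epsilon> \<le> m d" "\<epsilon> \<le> 1 - m d"
      using m[OF d] \<open>\<not> (m d = 0 \<or> m d = 1)\<close> by (auto simp: \<epsilon>_def)
    have dd: "\<epsilon> *\<^sub>R d = jcomb D (\<lambda>d'. if d' = d then \<epsilon> else 0)"
    proof -
      have "jcomb D (\<lambda>d'. if d' = d then \<epsilon> else 0) = (\<Sum>d'\<in>D. if d' = d then \<epsilon> *\<^sub>R d else 0)"
        unfolding jcomb_def by (rule sum.cong) auto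
      then show ?thesis using d partition_facts(1)[OF D] by simp
    qed
    define z where "z = h (\<epsilon> *\<^sub>R d)"
    have z: "z \<in> square_cone"
      unfolding z_def dd using \<epsilon> by (intro hsq) (simp add: jcomb_in_square_cone[OF D])
    have "c - z \<in> square_cone"
    proof -
      have "f c - \<epsilon> *\<^sub>R d \<in> square_cone"
        unfolding fc dd using \<epsilon> m
        by (auto simp: jcomb_linear[OF D] jcomb_in_square_cone[OF D])
      from hsq[OF this] show ?thesis
        by (simp add: linear_diff[OF h] fh z_def)
    qed
    moreover have "jone - c - z \<in> square_cone"
    proof -
      have "jone - f c - \<epsilon> *\<^sub>R d \<in> square_cone"
        unfolding fc dd using \<epsilon> m
        by (auto simp: jcomb_linear[OF D] jcomb_in_square_cone[OF D] jcomb_one[OF D, symmetric])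
      from hsq[OF this] show ?thesis
        using fh(2)[of jone] by (simp add: linear_diff[OF h] fh z_def one)
    qed
    moreover have "c \<bullet> (jone - c) = 0"
      using inner_jprod[of c c jone] by (simp add: inner_diff_right c inner_commute)
    ultimately have "z \<bullet> (jone - c) = 0" "z \<bullet> c = 0"
      using square_cone_inner_nonneg[OF z csq(1)] square_cone_inner_nonneg[OF z csq(2)]
        square_cone_inner_nonneg[OF _ csq(1), of "jone - c - z"]
        square_cone_inner_nonneg[OF _ csq(2), of "c - z"]
      by (simp_all add: inner_diff_left inner_diff_right inner_commute)
    then have "z = 0"
      by (intro square_cone_inner_jone_eq_0[OF z]) (simp add: inner_diff_right)
    then have "\<epsilon> *\<^sub>R d = 0"
      using fh(1)[of "\<epsilon> *\<^sub>R d"] by (simp add: z_def linear_0[OF f])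
    then show False
      using \<epsilon> partition_facts(3)[OF D d] by simp
  qed
  then have "jcomb D m \<odot> jcomb D m = jcomb D m"
    unfolding jcomb_jprod[OF D] by (intro jcomb_cong) auto
  then show ?thesis by (simp add: fc)
qed

lemma unital_cone_map_automorphism:
  fixes f :: "'a::euclidean_jordan_algebra \<Rightarrow> 'a"
  assumes f: "linear f" and bij: "bij f" and im: "f ` symmetric_cone = symmetric_cone"
    and one: "f jone = jone"
  shows "jordan_automorphism f"
proof -
  note idem = unital_cone_map_idempotent[OF assms]
  \<comment> \<open>Orthogonality of idempotents is idempotency of their sum.\<close>
  have orth: "f c \<odot> f d = 0" if "c \<odot> c = c" "d \<odot> d = d" "c \<odot> d = 0" for c d
  proof -
    have "(c + d) \<odot> (c + d) = c + d"
      using that by (simp add: jprod.add_left jprod.add_right jprod_commute[of d c])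
    from idem[OF this] show ?thesis
      using idem[OF that(1)] idem[OF that(2)]
      by (simp add: linear_add[OF f] jprod.add_left jprod.add_right jprod_commute[of "f d" "f c"]
          flip: scaleR_2)
  qed
  have sq: "f (x \<odot> x) = f x \<odot> f x" for x
  proof -
    obtain C l where C: "idempotent_partition C" and x: "x = jcomb C l"
      using idempotent_decomposition by blast
    note fC = partition_facts[OF C]
    have "f x \<odot> f x = (\<Sum>c\<in>C. \<Sum>d\<in>C. (l c * l d) *\<^sub>R (f c \<odot> f d))"
      unfolding x jcomb_def linear_sum[OF f] jprod.sum_left jprod.sum_right
      by (simp add: linear_scale[OF f] jprod.scaleR_left jprod.scaleR_right)
        (subst sum.swap, simp add: mult.commute)
    also have "\<dots> = (\<Sum>c\<in>C. \<Sum>d\<in>C. if d = c then (l c * l c) *\<^sub>R f c else 0)"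
      using fC(2,4) idem orth by (intro sum.cong refl) auto
    also have "\<dots> = f (x \<odot> x)"
      unfolding x jcomb_jprod[OF C] using fC(1)
      by (simp add: jcomb_def linear_sum[OF f] linear_scale[OF f])
    finally show ?thesis ..
  qed
  have "f (x \<odot> y) = f x \<odot> f y" for x y
  proof -
    have "(x + y) \<odot> (x + y) = x \<odot> x + y \<odot> y + 2 *\<^sub>R (x \<odot> y)" for x y :: 'a
      by (simp add: jprod.add_left jprod.add_right jprod_commute[of y x] scaleR_2)
    then show ?thesis
      using sq[of "x + y"] sq[of x] sq[of y] by (simp add: linear_add[OF f] linear_scale[OF f])
  qed
  then show ?thesis
    using f bij by (simp add: jordan_automorphism_def)
qed

section \<open>Jordan automorphisms\<close>

context
  fixes f :: "'a::euclidean_jordan_algebra \<Rightarrow> 'a"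
  assumes f: "jordan_automorphism f"
begin

lemma automorphism_facts:
  shows "linear f" and "bij f" and "f (x \<odot> y) = f x \<odot> f y"
  using f by (auto simp: jordan_automorphism_def)

lemma automorphism_jone: "f jone = jone"
proof -
  obtain u where "f u = jone"
    using automorphism_facts(2) by (metis bij_pointE)
  then show ?thesis
    using automorphism_facts(3)[of u jone] by (metis jprod_jone jprod_jone_right)
qed

lemma automorphism_inv: "jordan_automorphism (inv f)"
  unfolding jordan_automorphism_def
proof (intro conjI allI)
  show "linear (inv f)" "bij (inv f)"
    using automorphism_facts(1,2)
    by (simp_all add: bij_is_inj bij_is_surj inj_linear_imp_inv_linear bij_imp_bij_inv)
  show "inv f (x \<odot> y) = inv f x \<odot> inv f y" for x y
    by (metis automorphism_facts(2,3) bij_inv_eq_iff)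
qed

lemma automorphism_square_cone: "f ` square_cone = square_cone"
proof -
  have "f ` square_cone = (\<lambda>x. x \<odot> x) ` range f"
    unfolding square_cone_def image_image automorphism_facts(3) ..
  then show ?thesis
    using automorphism_facts(2) by (simp add: bij_is_surj square_cone_def)
qed

lemma automorphism_symmetric_cone: "f ` symmetric_cone = symmetric_cone"
  by (rule linear_bij_symmetric_cone[OF automorphism_facts(1,2) automorphism_square_cone])

lemma automorphism_in_symmetric_cone: "x \<in> symmetric_cone \<Longrightarrow> f x \<in> symmetric_cone"
  using automorphism_symmetric_cone by blast

lemma automorphism_quad_rep: "f (quad_rep x y) = quad_rep (f x) (f y)"
  by (simp add: quad_rep_apply linear_diff[OF automorphism_facts(1)]
      linear_scale[OF automorphism_facts(1)] automorphism_facts(3))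

lemma automorphism_jcomb: "f (jcomb C l) = jcomb (f ` C) (l \<circ> inv f)"
proof -
  have inj: "inj f" using automorphism_facts(2) by (rule bij_is_inj)
  show ?thesis
    unfolding jcomb_def linear_sum[OF automorphism_facts(1)]
    by (subst sum.reindex[OF inj_on_subset[OF inj subset_UNIV]])
      (simp add: linear_scale[OF automorphism_facts(1)] inj)
qed

lemma automorphism_idempotent_partition:
  assumes "idempotent_partition C" shows "idempotent_partition (f ` C)"
proof -
  have inj: "inj f" using automorphism_facts(2) by (rule bij_is_inj)
  note lin = automorphism_facts(1)
  show ?thesis
    unfolding idempotent_partition_def
  proof (intro conjI)
    have "\<Sum>(f ` C) = f (\<Sum>C)"
      unfolding linear_sum[OF lin] by (subst sum.reindex[OF inj_on_subset[OF inj subset_UNIV]]) simp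
    then show "\<Sum>(f ` C) = jone"
      by (simp add: partition_facts(5)[OF assms] automorphism_jone)
    show "pairwise (\<lambda>c d. c \<odot> d = 0) (f ` C)"
      using assms linear_0[OF lin]
      by (auto simp: idempotent_partition_def pairwise_def simp flip: automorphism_facts(3))
        metis
    show "\<forall>c\<in>f ` C. c \<odot> c = c \<and> c \<noteq> 0"
      using assms inj linear_0[OF lin]
      by (auto simp: idempotent_partition_def simp flip: automorphism_facts(3)) (metis injD)
  qed (simp add: partition_facts(1)[OF assms])
qed

lemma automorphism_powj: "f (x powj \<alpha>) = f x powj \<alpha>"
proof -
  obtain C l where C: "idempotent_partition C" and x: "x = jcomb C l"
    using idempotent_decomposition by blast
  show ?thesis
    unfolding x powj_jcomb[OF C] automorphism_jcomb
      powj_jcomb[OF automorphism_idempotent_partition[OF C]]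
    by (simp add: comp_def)
qed

end

lemma automorphism_primitive:
  fixes f :: "'a::euclidean_jordan_algebra \<Rightarrow> 'a"
  assumes f: "jordan_automorphism f" and c: "primitive_idempotent c"
  shows "primitive_idempotent (f c)"
proof -
  note ff = automorphism_facts[OF f] and fi = automorphism_facts[OF automorphism_inv[OF f]]
  have f0: "f u = 0 \<longleftrightarrow> u = 0" "inv f u = 0 \<longleftrightarrow> u = 0" for u
    using linear_0[OF ff(1)] linear_0[OF fi(1)] ff(2) fi(2) by (metis bij_pointE)+
  have fc: "inv f (f c) = c"
    using ff(2) by (simp add: bij_is_inj)
  show ?thesis
    unfolding primitive_idempotent_def
  proof (intro conjI notI)
    show "jidempotent (f c)"
      using c by (simp add: primitive_idempotent_def jidempotent_def flip: ff(3))
    show False if "f c = 0"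
      using that c f0 by (simp add: primitive_idempotent_def)
    assume "\<exists>d d'. jidempotent d \<and> jidempotent d' \<and> d \<noteq> 0 \<and> d' \<noteq> 0 \<and> d \<odot> d' = 0 \<and> f c = d + d'"
    then obtain d d' where d: "jidempotent d" "jidempotent d'" "d \<noteq> 0" "d' \<noteq> 0" "d \<odot> d' = 0"
      and fcd: "f c = d + d'"
      by blast
    have "jidempotent (inv f d)" "jidempotent (inv f d')" "inv f d \<odot> inv f d' = 0"
      using d f0 by (simp_all add: jidempotent_def flip: fi(3))
    moreover have "inv f d \<noteq> 0" "inv f d' \<noteq> 0"
      using d f0 by simp_all
    moreover have "c = inv f d + inv f d'"
      using fc unfolding fcd linear_add[OF fi(1)] by simp
    ultimately show False
      using c unfolding primitive_idempotent_def by blast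
  qed
qed

lemma automorphism_spectral_decomposition:
  fixes f :: "'a::euclidean_jordan_algebra \<Rightarrow> 'a"
  assumes f: "jordan_automorphism f" and sd: "spectral_decomposition x C l"
  shows "spectral_decomposition (f x) (f ` C) (l \<circ> inv f)" and "(\<Sum>c\<in>f ` C. (l \<circ> inv f) c) = sum l C"
proof -
  have C: "jordan_frame C" and x: "x = jcomb C l"
    using sd by (auto simp: spectral_decomposition_def jcomb_def)
  have "idempotent_partition (f ` C)"
    by (rule automorphism_idempotent_partition[OF f jordan_frame_partition[OF C]])
  then have "jordan_frame (f ` C)"
    using C automorphism_primitive[OF f] by (auto simp: jordan_frame_def idempotent_partition_def)
  then show "spectral_decomposition (f x) (f ` C) (l \<circ> inv f)"
    unfolding x automorphism_jcomb[OF f] by (simp add: spectral_decomposition_def jcomb_def)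
  have inj: "inj f" using automorphism_facts(2)[OF f] by (rule bij_is_inj)
  show "(\<Sum>c\<in>f ` C. (l \<circ> inv f) c) = sum l C"
    by (subst sum.reindex[OF inj_on_subset[OF inj subset_UNIV]]) (simp add: inj)
qed

text \<open>The automorphism carries the spectral decompositions of \<open>x\<close> to those of \<open>f x\<close>, with the same sums of
  spectral values, so the two traces are definite descriptions with the same defining property.\<close>

lemma automorphism_jtrace:
  fixes f :: "'a::euclidean_jordan_algebra \<Rightarrow> 'a"
  assumes f: "jordan_automorphism f"
  shows "jtrace (f x) = jtrace x"
proof -
  have le: "\<exists>C l. spectral_decomposition (g x) C l \<and> t = sum l C"
    if "jordan_automorphism g" "\<exists>C l. spectral_decomposition x C l \<and> t = sum l C" for g x and t :: real
    using that automorphism_spectral_decomposition[of g x] by metis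
  have "inv f (f x) = x"
    using automorphism_facts(2)[OF f] by (simp add: bij_is_inj)
  then have "(\<exists>C l. spectral_decomposition (f x) C l \<and> t = sum l C) \<longleftrightarrow>
      (\<exists>C l. spectral_decomposition x C l \<and> t = sum l C)" for t
    using le[OF f, of x t] le[OF automorphism_inv[OF f], of "f x" t] by auto
  then show ?thesis
    unfolding jtrace_def by presburger
qed

section \<open>Polar decomposition and the fundamental formula\<close>

lemma blinfun_linear: "linear (blinfun_apply g)"
  by (rule bounded_linear.linear[OF blinfun.bounded_linear_right])

lemma cone_group_jone: "g \<in> cone_group \<Longrightarrow> g jone \<in> symmetric_cone"
  using jone_in_symmetric_cone by (auto simp: cone_group_def)

text \<open>Dividing \<open>g\<close> by \<open>P(y\<^sup>1\<^sup>/\<^sup>2)\<close>, where \<open>y = g jone\<close>, gives an automorphism of the cone that fixes the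
  unit.\<close>

lemma polar_part_automorphism:
  fixes g :: "'a::euclidean_jordan_algebra \<Rightarrow>\<^sub>L 'a"
  assumes g: "g \<in> cone_group"
  shows "quad_rep ((g jone) powj (-1/2)) o\<^sub>L g \<in> Aut_group"
proof -
  define y where "y = g jone"
  have y: "y \<in> symmetric_cone"
    using cone_group_jone[OF g] by (simp add: y_def)
  have k: "quad_rep (y powj (-1/2)) o\<^sub>L g \<in> cone_group"
    by (intro cone_group_comp quad_rep_cone_group powj_in_cone y g)
  have "quad_rep (y powj (-1/2)) y = jone"
    using quad_rep_powj_jone[OF y, of "1/2"] quad_rep_powj_inverse(2)[OF y, of "1/2" jone]
    by (simp add: powj_one[OF y])
  then have "(quad_rep (y powj (-1/2)) o\<^sub>L g) jone = jone"
    by (simp add: y_def)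
  then have "jordan_automorphism (quad_rep (y powj (-1/2)) o\<^sub>L g)"
    using k by (intro unital_cone_map_automorphism[OF blinfun_linear]) (simp_all only: cone_group_def mem_Collect_eq)
  then show ?thesis
    by (simp add: Aut_group_def y_def)
qed

lemma Aut_group_jone: "k \<in> Aut_group \<Longrightarrow> k jone = jone"
  by (simp add: Aut_group_def automorphism_jone)

lemma Aut_group_subset_cone_group: "Aut_group \<subseteq> cone_group"
  unfolding Aut_group_def cone_group_def
  using automorphism_symmetric_cone automorphism_facts(2) by blast

context
  assumes inner_trace: "\<And>x y :: 'a::euclidean_jordan_algebra. x \<bullet> y = jtrace (x \<odot> y)"
begin

lemma automorphism_inner:
  fixes f :: "'a \<Rightarrow> 'a"
  assumes "jordan_automorphism f"
  shows "f x \<bullet> f y = x \<bullet> y"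
  by (simp add: inner_trace automorphism_jtrace[OF assms] flip: automorphism_facts(3)[OF assms])

text \<open>Automorphisms are orthogonal, so they cancel in the product of \<open>g\<close> with its adjoint.\<close>

lemma cone_group_adjoint:
  fixes g :: "'a \<Rightarrow>\<^sub>L 'a"
  assumes g: "g \<in> cone_group"
  shows "g (adjoint g v) = quad_rep (g jone) v"
proof -
  define y where "y = g jone"
  have y: "y \<in> symmetric_cone"
    using cone_group_jone[OF g] by (simp add: y_def)
  define k where "k = blinfun_apply (quad_rep (y powj (-1/2)) o\<^sub>L g)"
  have k: "jordan_automorphism k"
    using polar_part_automorphism[OF g] by (simp add: k_def Aut_group_def y_def)
  have gk: "g u = quad_rep (y powj (1/2)) (k u)" for u
    using quad_rep_powj_inverse(1)[OF y, of "1/2"] by (simp add: k_def)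
  define h where "h v = inv k (quad_rep (y powj (1/2)) v)" for v
  have kh: "k (h v) = quad_rep (y powj (1/2)) v" for v
    using automorphism_facts(2)[OF k] by (simp add: h_def bij_is_surj surj_f_inv_f)
  have "g u \<bullet> v = u \<bullet> h v" for u v
    using automorphism_inner[OF k, of u "h v"] by (simp add: gk quad_rep_self_adjoint kh)
  then have "adjoint g = h"
    by (intro adjoint_unique) simp
  then have "g (adjoint g v) = quad_rep (y powj (1/2)) (quad_rep (y powj (1/2)) v)"
    by (simp add: gk kh)
  also have "\<dots> = quad_rep y v"
    by (simp add: quad_rep_powj_add[OF y] powj_one[OF y])
  finally show ?thesis by (simp add: y_def)
qed

text \<open>The cone automorphism \<open>g = P(x) P(y\<^sup>1\<^sup>/\<^sup>2)\<close> maps the unit to \<open>P(x) y\<close>, and its product with its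
  adjoint is \<open>P(x) P(y) P(x)\<close>.\<close>

lemma fundamental_formula:
  fixes x y :: 'a
  assumes x: "x \<in> symmetric_cone" and y: "y \<in> symmetric_cone"
  shows "quad_rep (quad_rep x y) v = quad_rep x (quad_rep y (quad_rep x v))"
proof -
  define q where "q = quad_rep (y powj (1/2))"
  define g where "g = quad_rep x o\<^sub>L q"
  have g: "g \<in> cone_group"
    unfolding g_def q_def by (intro cone_group_comp quad_rep_cone_group powj_in_cone x y)
  have qq: "q (q u) = quad_rep y u" for u
    by (simp add: q_def quad_rep_powj_add[OF y] powj_one[OF y])
  have "adjoint g = (\<lambda>u. q (quad_rep x u))"
    by (rule adjoint_unique) (simp add: g_def q_def quad_rep_self_adjoint)
  moreover have "g jone = quad_rep x y"
    by (simp add: g_def q_def quad_rep_powj_jone[OF y] powj_one[OF y])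
  ultimately show ?thesis
    using cone_group_adjoint[OF g, of v] by (simp add: g_def qq)
qed

section \<open>Geometric means\<close>

text \<open>Both sides are mapped to \<open>P(y) w\<close> by \<open>P(P(y) w)\<close>, which is injective.\<close>

lemma quad_rep_inverse_arg:
  fixes y w :: 'a
  assumes y: "y \<in> symmetric_cone" and w: "w \<in> symmetric_cone"
  shows "(quad_rep y w) powj (-1) = quad_rep (y powj (-1)) (w powj (-1))"
proof (rule quad_rep_inject)
  show "quad_rep y w \<in> symmetric_cone"
    by (rule quad_rep_symmetric_cone[OF y w])
  have "quad_rep y (quad_rep (y powj (-1)) v) = v" for v
    using quad_rep_powj_inverse(1)[OF y, of 1] by (simp add: powj_one[OF y])
  then show "quad_rep (quad_rep y w) (quad_rep y w powj (-1))
      = quad_rep (quad_rep y w) (quad_rep (y powj (-1)) (w powj (-1)))"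
    by (simp add: quad_rep_powj_minus_one(1) quad_rep_symmetric_cone y w fundamental_formula)
qed

text \<open>The Riccati equation \<open>P(y) a\<^sup>-\<^sup>1 = b\<close> characterizes the mean \<open>y\<close>, and gives access to its symmetry and
  to its behaviour under inversion. By the fundamental formula, \<open>P(a \<sharp> b)\<close> is \<open>P(a\<^sup>1\<^sup>/\<^sup>2) P(m\<^sup>1\<^sup>/\<^sup>2) P(a\<^sup>1\<^sup>/\<^sup>2)\<close>
  with \<open>m = P(a\<^sup>-\<^sup>1\<^sup>/\<^sup>2) b\<close>.\<close>

lemma metric_geometric_mean_riccati:
  fixes a b :: 'a
  assumes a: "a \<in> symmetric_cone" and b: "b \<in> symmetric_cone"
  shows "a \<sharp> b \<in> symmetric_cone" and "quad_rep (a \<sharp> b) (a powj (-1)) = b"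
proof -
  define m where "m = quad_rep (a powj (-1/2)) b"
  have m: "m \<in> symmetric_cone"
    unfolding m_def by (intro quad_rep_symmetric_cone powj_in_cone a b)
  have mean: "a \<sharp> b = quad_rep (a powj (1/2)) (m powj (1/2))"
    by (simp add: metric_geometric_mean_def m_def)
  show "a \<sharp> b \<in> symmetric_cone"
    unfolding mean by (intro quad_rep_symmetric_cone powj_in_cone a m)
  show "quad_rep (a \<sharp> b) (a powj (-1)) = b"
    unfolding mean fundamental_formula[OF powj_in_cone[OF a] powj_in_cone[OF m]]
      quad_rep_powj_minus_one(2)[OF a] quad_rep_powj_minus_one(4)[OF m]
    unfolding m_def using quad_rep_powj_inverse(1)[OF a, of "1/2"] by simp
qed

text \<open>By the fundamental formula \<open>P(a\<^sup>-\<^sup>1\<^sup>/\<^sup>2) y\<close> is the square root of \<open>P(a\<^sup>-\<^sup>1\<^sup>/\<^sup>2) P(y) a\<^sup>-\<^sup>1\<close>.\<close>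

lemma metric_geometric_mean_unique:
  fixes a y :: 'a
  assumes a: "a \<in> symmetric_cone" and y: "y \<in> symmetric_cone"
  shows "a \<sharp> quad_rep y (a powj (-1)) = y"
proof -
  define z where "z = quad_rep (a powj (-1/2)) y"
  have z: "z \<in> symmetric_cone"
    unfolding z_def by (intro quad_rep_symmetric_cone powj_in_cone a y)
  have "quad_rep (a powj (-1/2)) jone = a powj (-1)"
    by (simp add: quad_rep_powj_jone[OF a])
  then have "z \<odot> z = quad_rep (a powj (-1/2)) (quad_rep y (a powj (-1)))"
    unfolding quad_rep_jone_arg[symmetric] z_def fundamental_formula[OF powj_in_cone[OF a] y] by simp
  from this[symmetric] show ?thesis
    unfolding metric_geometric_mean_def
    using powj_half_square[OF z] quad_rep_powj_inverse(1)[OF a, of "1/2"] by (simp add: z_def)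
qed

text \<open>Taking inverses on both sides of the Riccati equation exchanges \<open>a\<close> and \<open>b\<close>.\<close>

lemma metric_geometric_mean_commute:
  fixes a b :: 'a
  assumes a: "a \<in> symmetric_cone" and b: "b \<in> symmetric_cone"
  shows "a \<sharp> b = b \<sharp> a"
proof -
  define y where "y = a \<sharp> b"
  have y: "y \<in> symmetric_cone" and "quad_rep y (a powj (-1)) = b"
    unfolding y_def using metric_geometric_mean_riccati[OF a b] by auto
  then have "b powj (-1) = quad_rep (y powj (-1)) a"
    using quad_rep_inverse_arg[OF y powj_in_cone[OF a], of "-1"]
    by (simp add: powj_powj[OF a] powj_one[OF a])
  then have "quad_rep y (b powj (-1)) = a"
    using quad_rep_powj_inverse(1)[OF y, of 1] by (simp add: powj_one[OF y])
  then show ?thesis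
    using metric_geometric_mean_unique[OF b y] by (simp add: y_def)
qed

section \<open>Factorization of cone elements along an involution\<close>

text \<open>With \<open>a = x \<sharp> \<sigma> x\<close>, symmetry of the mean gives \<open>\<sigma> a = a\<close>, and \<open>b = P(a\<^sup>-\<^sup>1\<^sup>/\<^sup>2) x\<close> is mapped by \<open>\<sigma>\<close>
  to \<open>P(a\<^sup>-\<^sup>1\<^sup>/\<^sup>2) P(a) x\<^sup>-\<^sup>1 = b\<^sup>-\<^sup>1\<close> by the Riccati equation. Inverting that equation shows that
  \<open>a\<^sup>-\<^sup>1\<close> is the mean of \<open>x\<^sup>-\<^sup>1\<close> and \<open>\<sigma> x\<^sup>-\<^sup>1\<close>, so that \<open>b\<close> is a spectral geometric mean.\<close>

lemma involution_factorization:
  fixes \<sigma> :: "'a \<Rightarrow> 'a"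
  assumes \<sigma>: "involutive_jordan_automorphism \<sigma>" and x: "x \<in> symmetric_cone"
  defines "a \<equiv> x \<sharp> \<sigma> x"
  shows "a \<in> cone_fixed \<sigma>" and "quad_rep (a powj (-1/2)) x \<in> cone_inverted \<sigma>"
    and "x \<natural> \<sigma> (x powj (-1)) = quad_rep (a powj (-1/2)) x"
proof -
  have aut: "jordan_automorphism \<sigma>" and inv: "\<sigma> (\<sigma> u) = u" for u
    using \<sigma> by (auto simp: involutive_jordan_automorphism_def dest: fun_cong)
  note pres = automorphism_quad_rep[OF aut] automorphism_powj[OF aut]
  have sx: "\<sigma> x \<in> symmetric_cone"
    by (rule automorphism_in_symmetric_cone[OF aut x])
  have a: "a \<in> symmetric_cone" and ric: "quad_rep a (x powj (-1)) = \<sigma> x"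
    unfolding a_def using metric_geometric_mean_riccati[OF x sx] by auto
  have "\<sigma> a = \<sigma> x \<sharp> x"
    unfolding a_def metric_geometric_mean_def by (simp add: pres inv)
  then have sa: "\<sigma> a = a"
    by (simp add: a_def metric_geometric_mean_commute[OF x sx])
  then show "a \<in> cone_fixed \<sigma>"
    using a by (simp add: cone_fixed_def)
  define b where "b = quad_rep (a powj (-1/2)) x"
  have b: "b \<in> symmetric_cone"
    unfolding b_def by (intro quad_rep_symmetric_cone powj_in_cone a x)
  have "\<sigma> b = quad_rep (a powj (-1/2)) (quad_rep a (x powj (-1)))"
    by (simp add: b_def pres sa ric)
  also have "\<dots> = quad_rep (a powj (1/2)) (x powj (-1))"
    using quad_rep_powj_add[OF a, of "-1/2" 1] by (simp add: powj_one[OF a])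
  also have "\<dots> = b powj (-1)"
    unfolding b_def quad_rep_inverse_arg[OF powj_in_cone[OF a] x] powj_powj[OF a] by simp
  finally show "quad_rep (a powj (-1/2)) x \<in> cone_inverted \<sigma>"
    using b by (simp add: b_def cone_inverted_def)
  have "(x powj (-1)) \<sharp> \<sigma> (x powj (-1)) = a powj (-1)"
  proof -
    have "\<sigma> (x powj (-1)) = quad_rep (a powj (-1)) x"
      unfolding automorphism_powj[OF aut] ric[symmetric]
        quad_rep_inverse_arg[OF a powj_in_cone[OF x]] powj_powj[OF x]
      by (simp add: powj_one[OF x])
    then show ?thesis
      using metric_geometric_mean_unique[OF powj_in_cone[OF x, of "-1"] powj_in_cone[OF a, of "-1"]]
      by (simp add: powj_powj[OF x] powj_one[OF x])
  qed
  then show "x \<natural> \<sigma> (x powj (-1)) = quad_rep (a powj (-1/2)) x"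
    by (simp add: spectral_geometric_mean_def powj_powj[OF a])
qed

text \<open>The element \<open>a\<close> solves the Riccati equation of \<open>x \<sharp> \<sigma> x\<close>, because both \<open>P(a) x\<^sup>-\<^sup>1\<close> and \<open>\<sigma> x\<close> are
  equal to \<open>P(a\<^sup>1\<^sup>/\<^sup>2) b\<^sup>-\<^sup>1\<close>.\<close>

lemma involution_factorization_unique:
  fixes \<sigma> :: "'a \<Rightarrow> 'a"
  assumes \<sigma>: "involutive_jordan_automorphism \<sigma>"
    and a: "a \<in> cone_fixed \<sigma>" and b: "b \<in> cone_inverted \<sigma>"
    and x: "x = quad_rep (a powj (1/2)) b"
  shows "x \<sharp> \<sigma> x = a" and "quad_rep (a powj (-1/2)) x = b"
proof -
  have aut: "jordan_automorphism \<sigma>"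
    using \<sigma> by (simp add: involutive_jordan_automorphism_def)
  have a': "a \<in> symmetric_cone" "\<sigma> a = a" and b': "b \<in> symmetric_cone" "\<sigma> b = b powj (-1)"
    using a b by (auto simp: cone_fixed_def cone_inverted_def)
  have "x \<in> symmetric_cone"
    unfolding x by (intro quad_rep_symmetric_cone powj_in_cone a' b')
  have "quad_rep a (x powj (-1)) = quad_rep a (quad_rep (a powj (-1/2)) (b powj (-1)))"
    unfolding x quad_rep_inverse_arg[OF powj_in_cone[OF a'(1)] b'(1)] powj_powj[OF a'(1)] by simp
  also have "\<dots> = quad_rep (a powj (1/2)) (b powj (-1))"
    using quad_rep_powj_add[OF a'(1), of 1 "-1/2"] by (simp add: powj_one[OF a'(1)])
  also have "\<dots> = \<sigma> x"
    by (simp add: x automorphism_quad_rep[OF aut] automorphism_powj[OF aut] a' b')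
  finally show "x \<sharp> \<sigma> x = a"
    using metric_geometric_mean_unique[OF \<open>x \<in> symmetric_cone\<close> a'(1)] by simp
  show "quad_rep (a powj (-1/2)) x = b"
    unfolding x using quad_rep_powj_inverse(2)[OF a'(1), of "1/2"] by simp
qed

end

section \<open>Convergent power series\<close>

text \<open>A germ at \<open>0\<close> whose power series, measured by majorants at radius \<open>r\<close>, has norm at most \<open>S\<close>.\<close>

definition power_bound :: "('a::real_normed_vector \<Rightarrow> 'b::banach) \<Rightarrow> real \<Rightarrow> real \<Rightarrow> bool" where
  "power_bound f r S \<longleftrightarrow> 0 < r \<and> (\<exists>m M.
     (\<forall>n. multilinear_map n (m n) \<and> 0 \<le> M n \<and> (\<forall>v. norm (m n v) \<le> M n * (\<Prod>i<n. norm (v i)))) \<and>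
     summable (\<lambda>n. M n * r ^ n) \<and> (\<Sum>n. M n * r ^ n) \<le> S \<and>
     (\<forall>h. norm h < r \<longrightarrow> (\<lambda>n. m n (\<lambda>_. h)) sums f h))"

lemma power_boundE:
  fixes f :: "'a::real_normed_vector \<Rightarrow> 'b::banach"
  assumes "power_bound f r S"
  obtains m M where "0 < r" "\<And>n. multilinear_map n (m n)" "\<And>n. 0 \<le> M n"
    "\<And>n v. norm (m n v) \<le> M n * (\<Prod>i<n. norm (v i))" "summable (\<lambda>n. M n * r ^ n)"
    "(\<Sum>n. M n * r ^ n) \<le> S" "\<And>h. norm h < r \<Longrightarrow> (\<lambda>n. m n (\<lambda>_. h)) sums f h"
proof -
  from assms obtain m M where *: "0 < r" "\<forall>n. multilinear_map n (m n) \<and> 0 \<le> M n \<and>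
      (\<forall>v. norm (m n v) \<le> M n * (\<Prod>i<n. norm (v i)))" "summable (\<lambda>n. M n * r ^ n)"
    "(\<Sum>n. M n * r ^ n) \<le> S" "\<forall>h. norm h < r \<longrightarrow> (\<lambda>n. m n (\<lambda>_. h)) sums f h"
    unfolding power_bound_def by (elim conjE exE)
  show thesis
    by (rule that[of m M]) (use * in auto)
qed

lemma power_boundI:
  fixes f :: "'a::real_normed_vector \<Rightarrow> 'b::banach"
  assumes "0 < r" "\<And>n. multilinear_map n (m n)" "\<And>n. 0 \<le> M n"
    "\<And>n v. norm (m n v) \<le> M n * (\<Prod>i<n. norm (v i))" "summable (\<lambda>n. M n * r ^ n)"
    "(\<Sum>n. M n * r ^ n) \<le> S" "\<And>h. norm h < r \<Longrightarrow> (\<lambda>n. m n (\<lambda>_. h)) sums f h"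
  shows "power_bound f r S"
  unfolding power_bound_def using assms by (intro conjI exI[of _ m] exI[of _ M]) auto

lemma power_bound_pos: "power_bound f r S \<Longrightarrow> 0 < r"
  by (simp add: power_bound_def)

lemma power_bound_nonneg: "power_bound f r S \<Longrightarrow> 0 \<le> S"
proof (erule power_boundE)
  fix M :: "nat \<Rightarrow> real"
  assume "0 < r" "\<And>n. 0 \<le> M n" "summable (\<lambda>n. M n * r ^ n)" and le: "(\<Sum>n. M n * r ^ n) \<le> S"
  then have "0 \<le> (\<Sum>n. M n * r ^ n)"
    by (intro suminf_nonneg) auto
  then show ?thesis using le by linarith
qed

lemma power_bound_cong:
  assumes "power_bound f r S" "\<And>h. norm h < r \<Longrightarrow> f h = g h"
  shows "power_bound g r S"
  using assms(1) by (rule power_boundE) (rule power_boundI, use assms(2) in auto)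

lemma power_bound_mono:
  assumes "power_bound f r S" and r': "0 < r'" "r' \<le> r" and S': "S \<le> S'"
  shows "power_bound f r' S'"
  using assms(1)
proof (rule power_boundE)
  fix m M
  assume *: "0 < r" "\<And>n. multilinear_map n (m n)" "\<And>n. 0 \<le> M n"
    "\<And>n v. norm (m n v) \<le> M n * (\<Prod>i<n. norm (v i))" "summable (\<lambda>n. M n * r ^ n)"
    "(\<Sum>n. M n * r ^ n) \<le> S" "\<And>h. norm h < r \<Longrightarrow> (\<lambda>n. m n (\<lambda>_. h)) sums f h"
  have le: "M n * r' ^ n \<le> M n * r ^ n" for n
    using * r' by (intro mult_left_mono power_mono) auto
  have sm: "summable (\<lambda>n. M n * r' ^ n)"
    by (rule summable_comparison_test'[OF *(5)]) (use le *(3) r' in auto)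
  have "(\<Sum>n. M n * r' ^ n) \<le> S'"
    using suminf_le[OF le sm *(5)] *(6) S' by linarith
  then show ?thesis
    using * r' sm by (intro power_boundI[of r' m M]) auto
qed

lemma power_bound_norm_le:
  fixes f :: "'a::real_normed_vector \<Rightarrow> 'b::banach"
  assumes "power_bound f r S" and h: "norm h < r"
  shows "norm (f h) \<le> S"
  using assms(1)
proof (rule power_boundE)
  fix m M
  assume *: "0 < r" "\<And>n. multilinear_map n (m n)" "\<And>n. 0 \<le> M n"
    "\<And>n v. norm (m n v) \<le> M n * (\<Prod>i<n. norm (v i))" "summable (\<lambda>n. M n * r ^ n)"
    "(\<Sum>n. M n * r ^ n) \<le> S" "\<And>h. norm h < r \<Longrightarrow> (\<lambda>n. m n (\<lambda>_. h)) sums f h"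
  have "norm (m n (\<lambda>_. h)) \<le> M n * r ^ n" for n
  proof -
    have "norm (m n (\<lambda>_. h)) \<le> M n * norm h ^ n"
      using *(4)[of n "\<lambda>_. h"] by simp
    also have "\<dots> \<le> M n * r ^ n"
      using *(3) h by (intro mult_left_mono power_mono) auto
    finally show ?thesis .
  qed
  then have "norm (\<Sum>n. m n (\<lambda>_. h)) \<le> (\<Sum>n. M n * r ^ n)"
    by (rule norm_suminf_le[OF _ *(5)])
  then show ?thesis
    using *(6) sums_unique[OF *(7)[OF h]] by simp
qed

text \<open>Without constant term, the majorant sum is at most proportional to the radius.\<close>

lemma power_bound_small:
  fixes f :: "'a::real_normed_vector \<Rightarrow> 'b::banach"
  assumes "power_bound f r S" and f0: "f 0 = 0" and \<epsilon>: "0 < \<epsilon>"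
  obtains r' where "0 < r'" "r' \<le> r" "power_bound f r' \<epsilon>"
  using assms(1)
proof (rule power_boundE)
  fix m M
  assume *: "0 < r" "\<And>n. multilinear_map n (m n)" "\<And>n. 0 \<le> M n"
    "\<And>n v. norm (m n v) \<le> M n * (\<Prod>i<n. norm (v i))" "summable (\<lambda>n. M n * r ^ n)"
    "(\<Sum>n. M n * r ^ n) \<le> S" "\<And>h. norm h < r \<Longrightarrow> (\<lambda>n. m n (\<lambda>_. h)) sums f h"
  have S0: "0 \<le> S" using power_bound_nonneg[OF assms(1)] .
  define r' where "r' = min r (r * \<epsilon> / (S + 1))"
  have r': "0 < r'" "r' \<le> r"
    using *(1) \<epsilon> S0 by (auto simp: r'_def)
  have "r' * (S + 1) \<le> r * \<epsilon>"
    using S0 by (simp add: r'_def flip: pos_le_divide_eq)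
  then have "r' * S \<le> r * \<epsilon>" using r' by (simp add: algebra_simps)
  then have q: "(r' / r) * S \<le> \<epsilon>" using *(1) by (simp add: field_simps)
  have mz: "m n (\<lambda>_. 0) = 0" if "n \<noteq> 0" for n
    using *(4)[of n "\<lambda>_. 0"] that by (simp add: power_0_left)
  have "(\<lambda>n. m n (\<lambda>_. 0)) sums m 0 (\<lambda>_. 0)"
    using sums_finite[of "{0}" "\<lambda>n. m n (\<lambda>_. 0)"] mz by simp
  moreover have "(\<lambda>n. m n (\<lambda>_. 0)) sums f 0"
    using *(1,7) by simp
  ultimately have m0: "m 0 (\<lambda>_. 0) = 0"
    using f0 sums_unique2 by metis
  have m00: "m 0 v = 0" for v
    using *(2)[of 0] m0 unfolding multilinear_map_def by (metis less_nat_zero_code)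
  define M' where "M' n = (if n = 0 then 0 else M n)" for n
  have le: "M' n * r' ^ n \<le> (r' / r) * (M n * r ^ n)" for n
  proof (cases n)
    case (Suc k)
    have "r' ^ k \<le> r ^ k" using r' by (intro power_mono) auto
    then have "M n * (r' * r' ^ k) \<le> M n * (r' * r ^ k)"
      using *(3) r' by (intro mult_left_mono) auto
    then show ?thesis using *(1) by (simp add: M'_def Suc mult_ac)
  qed (use *(1,3) r' in \<open>simp add: M'_def\<close>)
  have sm: "summable (\<lambda>n. M' n * r' ^ n)"
    by (rule summable_comparison_test'[OF summable_mult[OF *(5), of "r' / r"]])
      (use le *(3) r' in \<open>auto simp: M'_def\<close>)
  have "(\<Sum>n. M' n * r' ^ n) \<le> (r' / r) * (\<Sum>n. M n * r ^ n)"
    using suminf_le[OF le sm summable_mult[OF *(5)]] suminf_mult[OF *(5)] by metis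
  also have "\<dots> \<le> (r' / r) * S"
    using *(1,6) r' by (intro mult_left_mono) auto
  finally have "(\<Sum>n. M' n * r' ^ n) \<le> \<epsilon>" using q by linarith
  then have "power_bound f r' \<epsilon>"
    using * r' sm m00 by (intro power_boundI[of r' m M']) (auto simp: M'_def)
  then show thesis using that r' by blast
qed

lemma power_bound_const: "0 < r \<Longrightarrow> power_bound (\<lambda>_. c) r (norm c)"
proof (rule power_boundI[of r "\<lambda>n v. if n = 0 then c else 0" "\<lambda>n. if n = 0 then norm c else 0"])
  show "(\<lambda>n. if n = 0 then c else 0) sums c"
    using sums_single[of 0 "\<lambda>_. c"] by simp
  have *: "(\<lambda>n. (if n = 0 then norm c else 0) * r ^ n) = (\<lambda>n. if n = 0 then norm c else 0)"
    by auto
  show "summable (\<lambda>n. (if n = 0 then norm c else 0) * r ^ n)"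
    "(\<Sum>n. (if n = 0 then norm c else 0) * r ^ n) \<le> norm c"
    unfolding * using sums_single[of 0 "\<lambda>_. norm c"] by (auto simp: sums_iff)
qed (auto simp: multilinear_map_def linear_zero intro: linear_zero)

lemma power_bound_linear:
  fixes f :: "'a::real_normed_vector \<Rightarrow> 'b::banach"
  assumes r: "0 < r" and f: "bounded_linear f"
  shows "power_bound f r (onorm f * r)"
proof (rule power_boundI[of r "\<lambda>n v. if n = 1 then f (v 0) else 0" "\<lambda>n. if n = 1 then onorm f else 0"])
  show "(\<lambda>n. if n = 1 then f h else 0) sums f h" for h
    using sums_single[of 1 "\<lambda>_. f h"] by simp
  have *: "(\<lambda>n. (if n = 1 then onorm f else 0) * r ^ n) = (\<lambda>n. if n = 1 then onorm f * r else 0)"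
    by auto
  show "summable (\<lambda>n. (if n = 1 then onorm f else 0) * r ^ n)"
    "(\<Sum>n. (if n = 1 then onorm f else 0) * r ^ n) \<le> onorm f * r"
    unfolding * using sums_single[of 1 "\<lambda>_. onorm f * r"] by (auto simp: sums_iff)
  show "multilinear_map n (\<lambda>v. if n = 1 then f (v 0) else 0)" for n
    using bounded_linear.linear[OF f] by (cases "n = 1") (auto simp: multilinear_map_def linear_zero)
  show "norm (if n = 1 then f (v 0) else 0) \<le> (if n = 1 then onorm f else 0) * (\<Prod>i<n. norm (v i))" for n :: nat and v :: "nat \<Rightarrow> 'a"
    using onorm[OF f, of "v 0"] by (cases "n = Suc 0") auto
qed (use r onorm_pos_le[OF f] in auto)

lemma multilinear_map_zero: "multilinear_map n (\<lambda>_. 0)"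
  by (simp add: multilinear_map_def linear_zero)

text \<open>Countable sums of germs with summable bounds: the coefficients add up degree by degree, and the
  two summations are interchanged by dominated convergence.\<close>

lemma power_bound_suminf:
  fixes f :: "nat \<Rightarrow> 'a::real_normed_vector \<Rightarrow> 'b::banach"
  assumes pb: "\<And>j. power_bound (f j) r (S j)" and S: "summable S"
  shows "power_bound (\<lambda>h. \<Sum>j. f j h) r (\<Sum>j. S j)"
proof -
  have r: "0 < r" using power_bound_pos[OF pb] .
  have "\<forall>j. \<exists>m M. (\<forall>n. multilinear_map n (m n) \<and> 0 \<le> M n \<and>
        (\<forall>v. norm (m n v) \<le> M n * (\<Prod>i<n. norm (v i)))) \<and>
      summable (\<lambda>n. M n * r ^ n) \<and> (\<Sum>n. M n * r ^ n) \<le> S j \<and>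
      (\<forall>h. norm h < r \<longrightarrow> (\<lambda>n. m n (\<lambda>_. h)) sums f j h)"
    using pb unfolding power_bound_def by simp
  from choice[OF this] obtain m where "\<forall>j. \<exists>M. (\<forall>n. multilinear_map n (m j n) \<and> 0 \<le> M n \<and>
        (\<forall>v. norm (m j n v) \<le> M n * (\<Prod>i<n. norm (v i)))) \<and>
      summable (\<lambda>n. M n * r ^ n) \<and> (\<Sum>n. M n * r ^ n) \<le> S j \<and>
      (\<forall>h. norm h < r \<longrightarrow> (\<lambda>n. m j n (\<lambda>_. h)) sums f j h)"
    by (rule exE)
  from choice[OF this] obtain M where all: "\<forall>j. (\<forall>n. multilinear_map n (m j n) \<and> 0 \<le> M j n \<and>
        (\<forall>v. norm (m j n v) \<le> M j n * (\<Prod>i<n. norm (v i)))) \<and>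
      summable (\<lambda>n. M j n * r ^ n) \<and> (\<Sum>n. M j n * r ^ n) \<le> S j \<and>
      (\<forall>h. norm h < r \<longrightarrow> (\<lambda>n. m j n (\<lambda>_. h)) sums f j h)"
    by (rule exE)
  have ml: "multilinear_map n (m j n)" and M0: "0 \<le> M j n"
    and mM: "norm (m j n v) \<le> M j n * (\<Prod>i<n. norm (v i))"
    and Msum: "summable (\<lambda>n. M j n * r ^ n)" and MS: "(\<Sum>n. M j n * r ^ n) \<le> S j"
    and ms: "norm h < r \<Longrightarrow> (\<lambda>n. m j n (\<lambda>_. h)) sums f j h" for j n v h
    using all by blast+
  have Mr0: "0 \<le> M j n * r ^ n" for j n using M0 r by simp
  have partial: "(\<Sum>n<N. M j n * r ^ n) \<le> S j" for j N
    by (rule order_trans[OF sum_le_suminf[OF Msum] MS]) (simp_all add: Mr0)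
  have MrS: "M j n * r ^ n \<le> S j" for j n
    using order_trans[OF sum_le_suminf[OF Msum, of "{n}" j] MS] by (simp add: Mr0)
  have sMj: "summable (\<lambda>j. M j n * r ^ n)" for n
    by (rule summable_comparison_test'[OF S]) (use MrS Mr0 in auto)
  have sM: "summable (\<lambda>j. M j n)" for n
    using summable_mult2[OF sMj[of n], of "1 / r ^ n"] r by simp
  have smn: "summable (\<lambda>j. norm (m j n v))" for n v
    by (rule summable_comparison_test'[OF summable_mult2[OF sM[of n], of "\<Prod>i<n. norm (v i)"]])
      (use mM in auto)
  then have sm: "summable (\<lambda>j. m j n v)" for n v
    by (rule summable_norm_cancel)
  define m' where "m' n v = (\<Sum>j. m j n v)" for n v
  define M' where "M' n = (\<Sum>j. M j n)" for n
  have partial': "(\<Sum>n<N. M' n * r ^ n) \<le> (\<Sum>j. S j)" for N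
  proof -
    have "(\<Sum>n<N. M' n * r ^ n) = (\<Sum>n<N. \<Sum>j. M j n * r ^ n)"
      unfolding M'_def by (simp add: suminf_mult2[OF sM])
    also have "\<dots> = (\<Sum>j. \<Sum>n<N. M j n * r ^ n)"
      by (rule suminf_sum[symmetric]) (rule sMj)
    also have "\<dots> \<le> (\<Sum>j. S j)"
      by (intro suminf_le partial summable_sum sMj S)
    finally show ?thesis .
  qed
  show ?thesis
  proof (rule power_boundI[of r m' M'])
    show "0 < r" by fact
    show M'0: "0 \<le> M' n" for n
      unfolding M'_def by (intro suminf_nonneg sM M0)
    show sM': "summable (\<lambda>n. M' n * r ^ n)"
      using partial' M'0 r by (intro summableI_nonneg_bounded) auto
    then show "(\<Sum>n. M' n * r ^ n) \<le> (\<Sum>j. S j)"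
      by (rule suminf_le_const) (rule partial')
    show "norm (m' n v) \<le> M' n * (\<Prod>i<n. norm (v i))" for n v
      unfolding m'_def M'_def suminf_mult2[OF sM]
      by (intro norm_suminf_le mM summable_mult2 sM)
    show "multilinear_map n (m' n)" for n
      unfolding multilinear_map_def
    proof (intro conjI allI impI)
      show "m' n v = m' n w" if "\<forall>i<n. v i = w i" for v w
      proof -
        have "m j n v = m j n w" for j
          using ml[of n j] that unfolding multilinear_map_def by blast
        then show ?thesis by (simp add: m'_def)
      qed
      show "linear (\<lambda>x. m' n (v(i := x)))" if "i < n" for v i
      proof -
        have l: "linear (\<lambda>x. m j n (v(i := x)))" for j
          using ml[of n j] that unfolding multilinear_map_def by blast
        show ?thesis
          unfolding m'_def
          by (rule linearI)
            (simp_all add: linear_add[OF l] linear_scale[OF l] suminf_add[OF sm sm] suminf_scaleR_right[OF sm])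
      qed
    qed
    show "(\<lambda>n. m' n (\<lambda>_. h)) sums (\<Sum>j. f j h)" if h: "norm h < r" for h
    proof -
      have fS: "norm (f j h) \<le> S j" for j
        by (rule power_bound_norm_le[OF pb h])
      have sf: "summable (\<lambda>j. f j h)"
        by (rule summable_comparison_test'[OF S]) (use fS in auto)
      have hb: "norm (m j n (\<lambda>_. h)) \<le> M j n * r ^ n" for j n
      proof -
        have "norm (m j n (\<lambda>_. h)) \<le> M j n * norm h ^ n"
          using mM[of j n "\<lambda>_. h"] by simp
        also have "\<dots> \<le> M j n * r ^ n"
          using M0 h by (intro mult_left_mono power_mono) auto
        finally show ?thesis .
      qed
      define R where "R j N = norm (f j h - (\<Sum>n<N. m j n (\<lambda>_. h)))" for j N
      have RS: "R j N \<le> 2 * S j" for j N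
      proof -
        have "norm (\<Sum>n<N. m j n (\<lambda>_. h)) \<le> (\<Sum>n<N. M j n * r ^ n)"
          by (intro sum_norm_le hb)
        then have "norm (\<Sum>n<N. m j n (\<lambda>_. h)) \<le> S j"
          using partial[where j = j and N = N] by linarith
        then show ?thesis
          unfolding R_def using fS[of j] norm_triangle_ineq4[of "f j h" "\<Sum>n<N. m j n (\<lambda>_. h)"] by linarith
      qed
      have "(R j \<longlongrightarrow> 0) sequentially" for j
        using tendsto_norm[OF tendsto_diff[OF tendsto_const ms[OF h, of j, unfolded sums_def], of "f j h"]]
        by (simp add: R_def[abs_def])
      moreover have "eventually (\<lambda>(j, N). norm (R j N) \<le> 2 * S j) (sequentially \<times>\<^sub>F sequentially)"
        using RS by (intro always_eventually) (auto simp: R_def)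
      ultimately have "(\<lambda>N. \<Sum>j. R j N) \<longlonglongrightarrow> (\<Sum>j. 0 :: real)"
        using tannerys_theorem[of R "\<lambda>_. 0" sequentially "\<lambda>j. 2 * S j"] summable_mult[OF S]
          sequentially_bot by blast
      then have lim: "(\<lambda>N. \<Sum>j. R j N) \<longlonglongrightarrow> 0" by simp
      have sR: "summable (\<lambda>j. R j N)" for N
        by (rule summable_comparison_test'[OF summable_mult[OF S, of 2]]) (use RS in \<open>auto simp: R_def\<close>)
      have est: "norm ((\<Sum>n<N. m' n (\<lambda>_. h)) - (\<Sum>j. f j h)) \<le> (\<Sum>j. R j N)" for N
      proof -
        have "(\<Sum>n<N. m' n (\<lambda>_. h)) = (\<Sum>j. \<Sum>n<N. m j n (\<lambda>_. h))"
          unfolding m'_def by (rule suminf_sum[symmetric]) (rule sm)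
        then have "(\<Sum>j. f j h) - (\<Sum>n<N. m' n (\<lambda>_. h)) = (\<Sum>j. f j h - (\<Sum>n<N. m j n (\<lambda>_. h)))"
          using suminf_diff[OF sf summable_sum[OF sm]] by simp
        then have "norm ((\<Sum>j. f j h) - (\<Sum>n<N. m' n (\<lambda>_. h))) \<le> (\<Sum>j. R j N)"
          using norm_suminf_le[OF _ sR, of "\<lambda>j. f j h - (\<Sum>n<N. m j n (\<lambda>_. h))"] by (simp add: R_def)
        then show ?thesis by (simp add: norm_minus_commute)
      qed
      have "(\<lambda>N. (\<Sum>n<N. m' n (\<lambda>_. h)) - (\<Sum>j. f j h)) \<longlonglongrightarrow> 0"
        by (rule Lim_null_comparison[OF _ lim]) (use est in auto)
      then show ?thesis
        unfolding sums_def by (simp add: LIM_zero_iff)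
    qed
  qed
qed

lemma power_bound_add:
  assumes f: "power_bound f r S" and g: "power_bound g r T"
  shows "power_bound (\<lambda>h. f h + g h) r (S + T)"
proof -
  have r: "0 < r" using f by (rule power_bound_pos)
  define F where "F j = (if j = 0 then f else if j = 1 then g else (\<lambda>_. 0))" for j :: nat
  define U where "U j = (if j = 0 then S else if j = 1 then T else 0)" for j :: nat
  have U: "U sums (S + T)"
    using sums_finite[of "{0, 1}" U] by (simp add: U_def)
  have Fh: "(\<lambda>j. F j h) sums (f h + g h)" for h
    using sums_finite[of "{0, 1}" "\<lambda>j. F j h"] by (simp add: F_def)
  have "power_bound (\<lambda>_ :: 'a. 0 :: 'b) r 0"
    using power_bound_const[OF r, where c = "0 :: 'b"] by simp
  then have "power_bound (F j) r (U j)" for j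
    using f g by (simp add: F_def U_def)
  then have "power_bound (\<lambda>h. \<Sum>j. F j h) r (\<Sum>j. U j)"
    by (rule power_bound_suminf[OF _ sums_summable[OF U]])
  then show ?thesis
    using sums_unique[OF Fh] sums_unique[OF U] by simp
qed

lemma prod_lessThan_split:
  fixes f :: "nat \<Rightarrow> 'a::comm_monoid_mult"
  shows "(\<Prod>k<i + j. f k) = (\<Prod>k<i. f k) * (\<Prod>k<j. f (k + i))"
  by (induction j) (simp_all add: mult.assoc add.commute)

text \<open>One homogeneous term times a series is the series shifted in degree; summing over the
  homogeneous terms of the first factor gives the product of two series.\<close>

lemma power_bound_homogeneous_mult:
  fixes p :: "(nat \<Rightarrow> 'a::real_normed_vector) \<Rightarrow> 'b::real_normed_vector"
    and g :: "'a \<Rightarrow> 'c::real_normed_vector" and B :: "'b \<Rightarrow> 'c \<Rightarrow> 'd::banach"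
  assumes B: "bounded_bilinear B" and K: "\<And>x y. norm (B x y) \<le> norm x * norm y * K" "0 \<le> K"
    and p: "multilinear_map d p" "\<And>v. norm (p v) \<le> P * (\<Prod>i<d. norm (v i))" "0 \<le> P"
    and r: "0 < r" and m: "\<And>n. multilinear_map n (m n)" "\<And>n. 0 \<le> M n"
    "\<And>n v. norm (m n v) \<le> M n * (\<Prod>i<n. norm (v i))" "summable (\<lambda>n. M n * r ^ n)"
    "(\<Sum>n. M n * r ^ n) \<le> T" "\<And>h. norm h < r \<Longrightarrow> (\<lambda>n. m n (\<lambda>_. h)) sums g h"
  shows "power_bound (\<lambda>h. B (p (\<lambda>_. h)) (g h)) r (K * (P * r ^ d) * T)"
proof -
  interpret B: bounded_bilinear B by (rule B)
  define m' where "m' n v = (if n < d then 0 else B (p v) (m (n - d) (\<lambda>k. v (k + d))))" for n v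
  define M' where "M' n = (if n < d then 0 else K * P * M (n - d))" for n
  have sums: "(\<lambda>n. M' n * r ^ n) sums (K * (P * r ^ d) * (\<Sum>n. M n * r ^ n))"
  proof -
    have "(\<lambda>n. M' (n + d) * r ^ (n + d)) sums (K * (P * r ^ d) * (\<Sum>n. M n * r ^ n))"
      using sums_mult[OF summable_sums[OF m(4)], of "K * (P * r ^ d)"]
      by (simp add: M'_def power_add mult_ac)
    moreover have "M' i * r ^ i = 0" if "i < d" for i using that by (simp add: M'_def)
    ultimately show ?thesis
      using sums_zero_iff_shift[of d "\<lambda>n. M' n * r ^ n"] by blast
  qed
  show ?thesis
  proof (rule power_boundI[of r m' M'])
    show "0 < r" by fact
    show "0 \<le> M' n" for n using K p m by (simp add: M'_def)
    show "summable (\<lambda>n. M' n * r ^ n)" using sums by (rule sums_summable)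
    have "K * (P * r ^ d) * (\<Sum>n. M n * r ^ n) \<le> K * (P * r ^ d) * T"
      using K p r m by (intro mult_left_mono) auto
    then show "(\<Sum>n. M' n * r ^ n) \<le> K * (P * r ^ d) * T"
      using sums_unique[OF sums] by simp
    show "norm (m' n v) \<le> M' n * (\<Prod>i<n. norm (v i))" for n v
    proof (cases "n < d")
      case False
      then have n: "n = d + (n - d)" by simp
      have "norm (m' n v) \<le> norm (p v) * norm (m (n - d) (\<lambda>k. v (k + d))) * K"
        using K(1) False by (simp add: m'_def)
      also have "\<dots> \<le> (P * (\<Prod>i<d. norm (v i))) * (M (n - d) * (\<Prod>i<n - d. norm (v (i + d)))) * K"
        using K p m by (intro mult_right_mono mult_mono) (auto intro!: mult_nonneg_nonneg prod_nonneg)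
      also have "\<dots> = M' n * ((\<Prod>i<d. norm (v i)) * (\<Prod>i<n - d. norm (v (i + d))))"
        using False by (simp add: M'_def mult_ac)
      also have "\<dots> = M' n * (\<Prod>i<n. norm (v i))"
        by (subst (3) n) (simp only: prod_lessThan_split)
      finally show ?thesis .
    qed (simp add: m'_def M'_def)
    show "multilinear_map n (m' n)" for n
    proof (cases "n < d")
      case True
      then show ?thesis using multilinear_map_zero[of n] by (simp add: m'_def[abs_def])
    next
      case False
      have pv: "p v = p w" if "\<forall>i<d. v i = w i" for v w
        using p(1) that unfolding multilinear_map_def by blast
      have mv: "m k v = m k w" if "\<forall>i<k. v i = w i" for k v w
        using m(1) that unfolding multilinear_map_def by blast
      show ?thesis
        unfolding multilinear_map_def
      proof (intro conjI allI impI)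
        show "m' n v = m' n w" if vw: "\<forall>i<n. v i = w i" for v w
        proof -
          have "p v = p w" by (rule pv) (use vw False in auto)
          moreover have "m (n - d) (\<lambda>k. v (k + d)) = m (n - d) (\<lambda>k. w (k + d))"
            by (rule mv) (use vw False in auto)
          ultimately show ?thesis by (simp add: m'_def)
        qed
        show "linear (\<lambda>x. m' n (v(i := x)))" if i: "i < n" for v i
        proof (cases "i < d")
          case True
          have "m (n - d) (\<lambda>k. (v(i := x)) (k + d)) = m (n - d) (\<lambda>k. v (k + d))" for x
            by (rule mv) (use True in auto)
          then have eq: "m' n (v(i := x)) = B (p (v(i := x))) (m (n - d) (\<lambda>k. v (k + d)))" for x
            using False by (simp add: m'_def)
          have lin: "linear (\<lambda>x. p (v(i := x)))"
            using p(1) True unfolding multilinear_map_def by blast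
          show ?thesis
            unfolding eq
            by (rule linearI) (simp_all only: linear_add[OF lin] linear_scale[OF lin] B.add_left B.scaleR_left)
        next
          case i': False
          have "p (v(i := x)) = p v" for x
            by (rule pv) (use i' in auto)
          moreover have "(\<lambda>k. (v(i := x)) (k + d)) = (\<lambda>k. v (k + d))(i - d := x)" for x
            using i' by (auto simp: fun_eq_iff)
          ultimately have eq: "m' n (v(i := x)) = B (p v) (m (n - d) ((\<lambda>k. v (k + d))(i - d := x)))" for x
            using False by (simp only: m'_def if_False)
          have "i - d < n - d" using i i' by simp
          then have lin: "linear (\<lambda>x. m (n - d) ((\<lambda>k. v (k + d))(i - d := x)))"
            using m(1)[of "n - d"] unfolding multilinear_map_def by blast
          show ?thesis
            unfolding eq
            by (rule linearI) (simp_all only: linear_add[OF lin] linear_scale[OF lin] B.add_right B.scaleR_right)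
        qed
      qed
    qed
    show "(\<lambda>n. m' n (\<lambda>_. h)) sums B (p (\<lambda>_. h)) (g h)" if h: "norm h < r" for h
    proof -
      have "(\<lambda>n. B (p (\<lambda>_. h)) (m n (\<lambda>_. h))) sums B (p (\<lambda>_. h)) (g h)"
        by (rule bounded_linear.sums[OF B.bounded_linear_right m(6)[OF h]])
      then have "(\<lambda>n. m' (n + d) (\<lambda>_. h)) sums B (p (\<lambda>_. h)) (g h)"
        by (simp add: m'_def)
      moreover have "m' i (\<lambda>_. h) = 0" if "i < d" for i using that by (simp add: m'_def)
      ultimately show ?thesis
        using sums_zero_iff_shift[of d "\<lambda>n. m' n (\<lambda>_. h)"] by blast
    qed
  qed
qed

lemma power_bound_bilinear:
  fixes f :: "'a::real_normed_vector \<Rightarrow> 'b::banach" and g :: "'a \<Rightarrow> 'c::banach"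
    and B :: "'b \<Rightarrow> 'c \<Rightarrow> 'd::banach"
  assumes B: "bounded_bilinear B" and K: "\<And>x y. norm (B x y) \<le> norm x * norm y * K" "0 \<le> K"
    and f: "power_bound f r S" and g: "power_bound g r T"
  shows "power_bound (\<lambda>h. B (f h) (g h)) r (K * S * T)"
proof -
  interpret B: bounded_bilinear B by (rule B)
  have r: "0 < r" and T: "0 \<le> T"
    using power_bound_pos[OF f] power_bound_nonneg[OF g] by auto
  obtain m M where m: "\<And>n. multilinear_map n (m n)" "\<And>n. 0 \<le> M n"
    "\<And>n v. norm (m n v) \<le> M n * (\<Prod>i<n. norm (v i))" "summable (\<lambda>n. M n * r ^ n)"
    "(\<Sum>n. M n * r ^ n) \<le> S" "\<And>h. norm h < r \<Longrightarrow> (\<lambda>n. m n (\<lambda>_. h)) sums f h"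
    using f by (rule power_boundE) blast
  obtain m2 M2 where m2: "\<And>n. multilinear_map n (m2 n)" "\<And>n. 0 \<le> M2 n"
    "\<And>n v. norm (m2 n v) \<le> M2 n * (\<Prod>i<n. norm (v i))" "summable (\<lambda>n. M2 n * r ^ n)"
    "(\<Sum>n. M2 n * r ^ n) \<le> T" "\<And>h. norm h < r \<Longrightarrow> (\<lambda>n. m2 n (\<lambda>_. h)) sums g h"
    using g by (rule power_boundE) blast
  have terms: "power_bound (\<lambda>h. B (m d (\<lambda>_. h)) (g h)) r (K * (M d * r ^ d) * T)" for d
    by (rule power_bound_homogeneous_mult[where m = m2 and M = M2])
      (fact B K m(1-3) r m2)+
  have sums: "(\<lambda>d. K * (M d * r ^ d) * T) sums (K * (\<Sum>d. M d * r ^ d) * T)"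
    by (intro sums_mult2 sums_mult summable_sums m(4))
  have "power_bound (\<lambda>h. \<Sum>d. B (m d (\<lambda>_. h)) (g h)) r (\<Sum>d. K * (M d * r ^ d) * T)"
    by (rule power_bound_suminf[OF terms sums_summable[OF sums]])
  moreover have "(\<Sum>d. K * (M d * r ^ d) * T) \<le> K * S * T"
    unfolding sums_unique[OF sums, symmetric] using K T m(5)
    by (intro mult_right_mono mult_left_mono) auto
  ultimately have "power_bound (\<lambda>h. \<Sum>d. B (m d (\<lambda>_. h)) (g h)) r (K * S * T)"
    using power_bound_mono[OF _ r order_refl] by blast
  then show ?thesis
  proof (rule power_bound_cong)
    show "(\<Sum>d. B (m d (\<lambda>_. h)) (g h)) = B (f h) (g h)" if "norm h < r" for h
      using bounded_linear.sums[OF B.bounded_linear_left m(6)[OF that]] by (simp add: sums_iff)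
  qed
qed

text \<open>The powers \<open>x\<^sup>1\<^sup>/\<^sup>2\<close> and \<open>x\<^sup>-\<^sup>1\<close> of an analytic germ solve, after translation and division by an
  invertible linear map, a fixed point equation with linear and quadratic terms. Picard iteration
  converges geometrically in majorant norm.\<close>

lemma power_bound_fixpoint:
  fixes u :: "'a::real_normed_vector \<Rightarrow> 'b::banach" and G :: "'a \<Rightarrow> 'c::banach"
    and B :: "'c \<Rightarrow> 'b \<Rightarrow> 'b" and Q :: "'b \<Rightarrow> 'b \<Rightarrow> 'b"
  assumes B: "bounded_bilinear B" and Q: "bounded_bilinear Q"
    and u: "\<And>\<epsilon>. 0 < \<epsilon> \<Longrightarrow> \<exists>r>0. power_bound u r \<epsilon>"
    and G: "\<And>\<epsilon>. 0 < \<epsilon> \<Longrightarrow> \<exists>r>0. power_bound G r \<epsilon>" and \<epsilon>: "0 < \<epsilon>"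
  shows "\<exists>r z. power_bound z r \<epsilon> \<and>
    (\<forall>h. norm h < r \<longrightarrow> z h = u h + B (G h) (z h) + Q (z h) (z h))"
proof -
  interpret B: bounded_bilinear B by (rule B)
  interpret Q: bounded_bilinear Q by (rule Q)
  obtain K where K: "0 \<le> K" "\<And>a b. norm (B a b) \<le> norm a * norm b * K"
    using B.nonneg_bounded by blast
  obtain L where L: "0 \<le> L" "\<And>a b. norm (Q a b) \<le> norm a * norm b * L"
    using Q.nonneg_bounded by blast
  define \<eta> \<gamma> where "\<eta> = min \<epsilon> (1 / (8 * (L + 1)))" and "\<gamma> = 1 / (4 * (K + 1))"
  have \<eta>: "0 < \<eta>" "\<eta> \<le> \<epsilon>" and \<gamma>: "0 < \<gamma>"
    using \<epsilon> K(1) L(1) by (auto simp: \<eta>_def \<gamma>_def)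
  have K\<gamma>: "K * \<gamma> \<le> 1 / 4"
    using K(1) by (simp add: \<gamma>_def field_simps)
  have "L * \<eta> \<le> L * (1 / (8 * (L + 1)))"
    using L(1) by (intro mult_left_mono) (auto simp: \<eta>_def)
  also have "\<dots> \<le> 1 / 8"
    using L(1) by (simp add: field_simps)
  finally have L\<eta>: "L * \<eta> \<le> 1 / 8" .
  obtain ru where ru: "0 < ru" "power_bound u ru (\<eta> / 2)"
    using u[of "\<eta> / 2"] \<eta> by auto
  obtain rG where rG: "0 < rG" "power_bound G rG \<gamma>"
    using G[OF \<gamma>] by auto
  define r where "r = min ru rG"
  have r: "0 < r" using ru rG by (simp add: r_def)
  have pu: "power_bound u r (\<eta> / 2)"
    by (rule power_bound_mono[OF ru(2) r]) (simp_all add: r_def)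
  have pG: "power_bound G r \<gamma>"
    by (rule power_bound_mono[OF rG(2) r]) (simp_all add: r_def)
  define F where "F w h = u h + B (G h) (w h) + Q (w h) (w h)" for w h
  define Z where "Z k = (F ^^ k) (\<lambda>_. 0)" for k
  have Z0: "Z 0 h = 0" and ZS: "Z (Suc k) h = u h + B (G h) (Z k h) + Q (Z k h) (Z k h)" for k h
    by (simp_all add: Z_def F_def)
  define D where "D k h = Z (Suc k) h - Z k h" for k h
  have D0: "D 0 h = u h" for h
    by (simp add: D_def ZS Z0 B.zero_right Q.zero_right)
  have DS: "D (Suc k) h = B (G h) (D k h) + (Q (D k h) (Z (Suc k) h) + Q (Z k h) (D k h))" for k h
  proof -
    have "D (Suc k) h = (u h + B (G h) (Z (Suc k) h) + Q (Z (Suc k) h) (Z (Suc k) h))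
        - (u h + B (G h) (Z k h) + Q (Z k h) (Z k h))"
      by (simp only: D_def ZS)
    then show ?thesis
      by (simp only: D_def[of k] B.diff_right Q.diff_right Q.diff_left) simp
  qed
  have bounds: "power_bound (Z k) r (\<eta> * (1 - (1/2) ^ k)) \<and> power_bound (D k) r (\<eta> / 2 * (1/2) ^ k)" for k
  proof (induction k)
    case 0
    have "power_bound (Z 0) r 0"
      by (rule power_bound_cong[of "\<lambda>_. 0"]) (use power_bound_const[OF r, where c = "0 :: 'b"] Z0 in auto)
    moreover have "power_bound (D 0) r (\<eta> / 2)"
      by (rule power_bound_cong[OF pu]) (simp add: D0)
    ultimately show ?case by simp
  next
    case (Suc k)
    define \<delta> where "\<delta> = \<eta> / 2 * (1/2) ^ k"
    have \<delta>: "0 < \<delta>" using \<eta> by (simp add: \<delta>_def)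
    have pD: "power_bound (D k) r \<delta>" using Suc by (simp add: \<delta>_def)
    have "power_bound (\<lambda>h. Z k h + D k h) r (\<eta> * (1 - (1/2) ^ k) + \<delta>)"
      by (rule power_bound_add) (use Suc pD in auto)
    moreover have "(\<lambda>h. Z k h + D k h) = Z (Suc k)"
      by (simp add: D_def)
    moreover have "\<eta> * (1 - (1/2) ^ k) + \<delta> = \<eta> * (1 - (1/2) ^ Suc k)"
      by (simp add: \<delta>_def algebra_simps)
    ultimately have ZSuc: "power_bound (Z (Suc k)) r (\<eta> * (1 - (1/2) ^ Suc k))"
      by simp
    have le: "\<eta> * (1 - (1/2) ^ j) \<le> \<eta>" for j :: nat
      using \<eta> by (simp add: mult_le_cancel_left1)
    have Zk: "power_bound (Z k) r \<eta>" and ZSk: "power_bound (Z (Suc k)) r \<eta>"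
      using Suc ZSuc le power_bound_mono[OF _ r order_refl] by blast+
    have "power_bound (\<lambda>h. B (G h) (D k h) + (Q (D k h) (Z (Suc k) h) + Q (Z k h) (D k h))) r
        (K * \<gamma> * \<delta> + (L * \<delta> * \<eta> + L * \<eta> * \<delta>))"
      by (intro power_bound_add power_bound_bilinear[OF B K(2,1)] power_bound_bilinear[OF Q L(2,1)]
          pG pD Zk ZSk)
    moreover have "K * \<gamma> * \<delta> + (L * \<delta> * \<eta> + L * \<eta> * \<delta>) \<le> \<eta> / 2 * (1/2) ^ Suc k"
    proof -
      have "K * \<gamma> * \<delta> \<le> 1 / 4 * \<delta>" "L * \<eta> * \<delta> \<le> 1 / 8 * \<delta>"
        using K\<gamma> L\<eta> \<delta> by (intro mult_right_mono; simp)+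
      then show ?thesis by (simp add: \<delta>_def mult_ac)
    qed
    ultimately have "power_bound (\<lambda>h. B (G h) (D k h) + (Q (D k h) (Z (Suc k) h) + Q (Z k h) (D k h))) r
        (\<eta> / 2 * (1/2) ^ Suc k)"
      by (rule power_bound_mono[OF _ r order_refl])
    then have "power_bound (D (Suc k)) r (\<eta> / 2 * (1/2) ^ Suc k)"
      by (rule power_bound_cong) (simp only: DS)
    then show ?case using ZSuc by blast
  qed
  have geo: "(\<lambda>k. \<eta> / 2 * (1/2) ^ k) sums \<eta>"
    using sums_mult[OF geometric_sums[of "1/2 :: real"], of "\<eta> / 2"] by simp
  define z where "z h = (\<Sum>k. D k h)" for h
  have pD: "power_bound (D k) r (\<eta> / 2 * (1/2) ^ k)" for k using bounds by blast
  have "power_bound z r (\<Sum>k. \<eta> / 2 * (1/2) ^ k)"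
    unfolding z_def by (rule power_bound_suminf[OF pD sums_summable[OF geo]])
  then have "power_bound z r \<epsilon>"
    using power_bound_mono[OF _ r order_refl] \<eta>(2) sums_unique[OF geo] by metis
  moreover have "z h = u h + B (G h) (z h) + Q (z h) (z h)" if h: "norm h < r" for h
  proof -
    have "norm (D k h) \<le> \<eta> / 2 * (1/2) ^ k" for k
      by (rule power_bound_norm_le[OF pD h])
    then have "summable (\<lambda>k. D k h)"
      by (intro summable_comparison_test'[OF sums_summable[OF geo], of 0]) auto
    then have "(\<lambda>N. \<Sum>k<N. D k h) \<longlonglongrightarrow> z h"
      unfolding z_def by (rule summable_LIMSEQ)
    moreover have "(\<Sum>k<N. D k h) = Z N h" for N
      unfolding D_def by (simp add: sum_lessThan_telescope[of "\<lambda>k. Z k h"] Z0)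
    ultimately have lim: "(\<lambda>N. Z N h) \<longlonglongrightarrow> z h" by simp
    then have "(\<lambda>N. Z (Suc N) h) \<longlonglongrightarrow> z h" by (rule LIMSEQ_Suc)
    moreover have "(\<lambda>N. Z (Suc N) h) \<longlonglongrightarrow> u h + B (G h) (z h) + Q (z h) (z h)"
      unfolding ZS by (intro tendsto_add tendsto_const B.tendsto Q.tendsto lim)
    ultimately show ?thesis by (rule LIMSEQ_unique)
  qed
  ultimately show ?thesis by blast
qed

section \<open>Real analyticity of Jordan operations\<close>

definition has_expansion :: "('a::real_normed_vector \<Rightarrow> 'b::banach) \<Rightarrow> 'a \<Rightarrow> bool" where
  "has_expansion f p \<longleftrightarrow> (\<exists>r S. power_bound (\<lambda>h. f (p + h)) r S)"

lemma has_expansion_real_analytic: "has_expansion f p \<Longrightarrow> real_analytic_at f p"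
proof -
  assume "has_expansion f p"
  then obtain r S where "power_bound (\<lambda>h. f (p + h)) r S"
    by (auto simp: has_expansion_def)
  then show ?thesis
  proof (rule power_boundE)
    fix m M
    assume "0 < r" "\<And>n. multilinear_map n (m n)" "\<And>n :: nat. 0 \<le> M n"
    "\<And>n v. norm (m n v) \<le> M n * (\<Prod>i<n. norm (v i))" "summable (\<lambda>n. M n * r ^ n)"
    "\<And>h. norm h < r \<Longrightarrow> (\<lambda>n. m n (\<lambda>_. h)) sums f (p + h)"
    then show ?thesis
      unfolding real_analytic_at_def by (intro exI[of _ r] exI[of _ m] exI[of _ M]) auto
  qed
qed

lemma has_expansion_cong:
  assumes "has_expansion f p" and ev: "eventually (\<lambda>x. f x = g x) (nhds p)"
  shows "has_expansion g p"
proof -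
  obtain r S where pb: "power_bound (\<lambda>h. f (p + h)) r S"
    using assms(1) by (auto simp: has_expansion_def)
  obtain \<delta> where \<delta>: "0 < \<delta>" "\<And>x. dist x p < \<delta> \<Longrightarrow> f x = g x"
    using ev by (auto simp: eventually_nhds_metric)
  have "0 < min r \<delta>" using \<delta> power_bound_pos[OF pb] by simp
  then have "power_bound (\<lambda>h. f (p + h)) (min r \<delta>) S"
    by (rule power_bound_mono[OF pb]) simp_all
  then have "power_bound (\<lambda>h. g (p + h)) (min r \<delta>) S"
    by (rule power_bound_cong) (simp add: \<delta>(2) dist_norm)
  then show ?thesis by (auto simp: has_expansion_def)
qed

lemma has_expansion_const: "has_expansion (\<lambda>_. c) p"
  using power_bound_const[of 1 c] by (auto simp: has_expansion_def)

lemma has_expansion_common_radius: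
  assumes "has_expansion f p" "has_expansion g p"
  obtains r S T where "power_bound (\<lambda>h. f (p + h)) r S" "power_bound (\<lambda>h. g (p + h)) r T"
proof -
  obtain r S r' T where f: "power_bound (\<lambda>h. f (p + h)) r S" and g: "power_bound (\<lambda>h. g (p + h)) r' T"
    using assms by (auto simp: has_expansion_def)
  have "0 < min r r'" using power_bound_pos[OF f] power_bound_pos[OF g] by simp
  then show thesis
    using that power_bound_mono[OF f] power_bound_mono[OF g] by (meson min.cobounded1 min.cobounded2 order_refl)
qed

lemma has_expansion_add:
  assumes "has_expansion f p" "has_expansion g p"
  shows "has_expansion (\<lambda>x. f x + g x) p"
  using assms by (rule has_expansion_common_radius) (auto simp: has_expansion_def dest: power_bound_add)

lemma has_expansion_bilinear:
  assumes B: "bounded_bilinear B" and "has_expansion f p" "has_expansion g p"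
  shows "has_expansion (\<lambda>x. B (f x) (g x)) p"
  using assms(2,3)
proof (rule has_expansion_common_radius)
  fix r S T
  assume pb: "power_bound (\<lambda>h. f (p + h)) r S" "power_bound (\<lambda>h. g (p + h)) r T"
  obtain K where K: "0 \<le> K" "\<And>a b. norm (B a b) \<le> norm a * norm b * K"
    using bounded_bilinear.nonneg_bounded[OF B] by blast
  show ?thesis
    using power_bound_bilinear[OF B K(2,1) pb] by (auto simp: has_expansion_def)
qed

lemma has_expansion_linear:
  assumes L: "bounded_linear L"
  shows "has_expansion L p"
proof -
  have "power_bound (\<lambda>h. L p + L h) 1 (norm (L p) + onorm L * 1)"
    by (intro power_bound_add power_bound_const power_bound_linear L) simp_all
  then show ?thesis
    by (auto simp: has_expansion_def linear_add[OF bounded_linear.linear[OF L]])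
qed

lemma has_expansion_compose_linear:
  assumes L: "bounded_linear L" and f: "has_expansion f p"
  shows "has_expansion (\<lambda>x. L (f x)) p"
proof -
  have "bounded_bilinear (\<lambda>(t :: real) y. t *\<^sub>R L y)"
    by (rule bounded_bilinear.comp[OF bounded_bilinear_scaleR bounded_linear_ident L])
  from has_expansion_bilinear[OF this has_expansion_const[of 1] f] show ?thesis by simp
qed

lemma has_expansion_diff:
  assumes "has_expansion f p" "has_expansion g p"
  shows "has_expansion (\<lambda>x. f x - g x) p"
  using has_expansion_add[OF assms(1) has_expansion_compose_linear[OF bounded_linear_minus[OF bounded_linear_ident] assms(2)]]
  by simp

lemma has_expansion_Pair:
  assumes f: "has_expansion f p" and g: "has_expansion g p"
  shows "has_expansion (\<lambda>x. (f x, g x)) p"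
proof -
  have "has_expansion (\<lambda>x. (f x, 0) + (0, g x)) p"
    by (intro has_expansion_add has_expansion_compose_linear[of "\<lambda>y. (y, 0)"]
        has_expansion_compose_linear[of "\<lambda>y. (0, y)"] f g bounded_linear_Pair bounded_linear_ident
        bounded_linear_zero)
  then show ?thesis by simp
qed

lemma has_expansion_small:
  assumes f: "has_expansion f p" and \<epsilon>: "0 < \<epsilon>"
  shows "\<exists>r>0. power_bound (\<lambda>h. f (p + h) - f p) r \<epsilon>"
proof -
  have "has_expansion (\<lambda>x. f x - f p) p"
    by (intro has_expansion_diff f has_expansion_const)
  then obtain r S where pb: "power_bound (\<lambda>h. f (p + h) - f p) r S"
    by (auto simp: has_expansion_def)
  show ?thesis
    by (rule power_bound_small[OF pb _ \<epsilon>]) auto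
qed

lemma has_expansion_isCont:
  assumes f: "has_expansion f p"
  shows "isCont f p"
  unfolding isCont_def
proof (rule LIM_I)
  fix \<epsilon> :: real assume "0 < \<epsilon>"
  then obtain r where r: "0 < r" "power_bound (\<lambda>h. f (p + h) - f p) r (\<epsilon> / 2)"
    using has_expansion_small[OF f, of "\<epsilon> / 2"] by auto
  have "norm (f x - f p) < \<epsilon>" if "norm (x - p) < r" for x
    using power_bound_norm_le[OF r(2) that] \<open>0 < \<epsilon>\<close> by simp
  then show "\<exists>s>0. \<forall>x. x \<noteq> p \<and> norm (x - p) < s \<longrightarrow> norm (f x - f p) < \<epsilon>"
    using r by blast
qed

lemma has_expansion_eventually_open:
  assumes "has_expansion f p" "open U" "f p \<in> U"
  shows "eventually (\<lambda>x. f x \<in> U) (nhds p)"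
  using has_expansion_isCont[OF assms(1)] assms(2,3)
  by (simp add: isCont_def tendsto_at_iff_tendsto_nhds topological_tendstoD)

lemma bounded_linear_jmult: "bounded_linear (jmult :: 'a::euclidean_jordan_algebra \<Rightarrow> _)"
proof -
  have "linear (jmult :: 'a \<Rightarrow> _)"
    by (rule linearI; rule blinfun_eqI)
      (simp_all add: jmult_apply blinfun.bilinear_simps jprod.add_left jprod.scaleR_left)
  then show ?thesis by (simp add: linear_conv_bounded_linear)
qed

lemma has_expansion_quad_rep:
  fixes f :: "'a::real_normed_vector \<Rightarrow> 'b::euclidean_jordan_algebra"
  assumes f: "has_expansion f p"
  shows "has_expansion (\<lambda>x. quad_rep (f x)) p"
  unfolding quad_rep_def
  by (intro has_expansion_diff has_expansion_compose_linear[OF bounded_linear_jmult]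
      has_expansion_compose_linear[OF bounded_linear_scaleR_right]
      has_expansion_bilinear[OF bounded_bilinear_blinfun_compose]
      has_expansion_bilinear[OF jprod.bounded_bilinear_axioms] f)

lemma bounded_bilinear_zero: "bounded_bilinear (\<lambda>_ _. 0)"
  by (rule bounded_bilinear.intro) (auto intro: exI[of _ 0])

text \<open>The form \<open>(q \<odot> v) \<bullet> v\<close> is a positive combination of the nonnegative forms \<open>(c \<odot> v) \<bullet> v\<close>, whose
  vanishing forces \<open>c \<odot> v = 0\<close> for every spectral idempotent \<open>c\<close>.\<close>

lemma jprod_symmetric_cone_inj:
  fixes q v :: "'a::euclidean_jordan_algebra"
  assumes q: "q \<in> symmetric_cone" and zero: "q \<odot> v = 0"
  shows "v = 0"
  using q
proof (rule symmetric_cone_cases)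
  fix C :: "'a set" and l
  assume C: "idempotent_partition C" and q: "q = jcomb C l" and l: "\<forall>c\<in>C. 0 < l c"
  have nn: "0 \<le> (c \<odot> v) \<bullet> v" if "c \<in> C" for c
    by (rule idempotent_inner_nonneg[OF partition_facts(2)[OF C that]])
  have "(\<Sum>c\<in>C. l c * ((c \<odot> v) \<bullet> v)) = (q \<odot> v) \<bullet> v"
    unfolding q jcomb_def jprod.sum_left inner_sum_left by (simp add: jprod.scaleR_left)
  then have "(\<Sum>c\<in>C. l c * ((c \<odot> v) \<bullet> v)) = 0" using zero by simp
  then have "\<forall>c\<in>C. l c * ((c \<odot> v) \<bullet> v) = 0"
    by (subst (asm) sum_nonneg_eq_0_iff) (use nn l partition_facts(1)[OF C] in \<open>auto intro: less_imp_le\<close>)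
  then have "c \<odot> v = 0" if "c \<in> C" for c
    using l that idempotent_inner_eq_0[OF partition_facts(2)[OF C that], of v] by force
  then have "\<Sum>C \<odot> v = 0"
    unfolding jprod.sum_left by simp
  then show ?thesis by (simp add: partition_facts(5)[OF C])
qed

text \<open>With \<open>q\<close> the root at \<open>p\<close>, the increment \<open>z\<close> of the root solves
  \<open>2 *\<^sub>R (q \<odot> z) = (f (p + h) - f p) - z \<odot> z\<close>, and multiplication by \<open>q\<close> is invertible.\<close>

lemma has_expansion_powj_half:
  fixes f :: "'a::real_normed_vector \<Rightarrow> 'b::euclidean_jordan_algebra"
  assumes f: "has_expansion f p" and fp: "f p \<in> symmetric_cone"
  shows "has_expansion (\<lambda>x. f x powj (1/2)) p"
proof -
  define q where "q = f p powj (1/2)"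
  have q: "q \<in> symmetric_cone" and qq: "q \<odot> q = f p"
    unfolding q_def using powj_in_cone[OF fp] square_powj_half[OF fp] by auto
  define M where "M v = 2 *\<^sub>R (q \<odot> v)" for v
  have M: "linear M"
    by (rule linearI) (simp_all add: M_def jprod.add_right jprod.scaleR_right scaleR_right_distrib)
  have "inj M"
    unfolding linear_injective_0[OF M] using jprod_symmetric_cone_inj[OF q] by (simp add: M_def)
  then have surj: "surj M"
    using linear_injective_imp_surjective[OF M] by blast
  define A where "A = inv M"
  have MA: "M (A v) = v" for v
    unfolding A_def by (rule surj_f_inv_f[OF surj])
  have A: "linear A"
    unfolding A_def by (rule inj_linear_imp_inv_linear[OF M \<open>inj M\<close>])
  define Q where "Q x y = - A (x \<odot> y)" for x y
  have "bilinear Q"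
    unfolding bilinear_def Q_def
    by (auto intro!: linearI simp: jprod.add_left jprod.add_right jprod.scaleR_left
        jprod.scaleR_right linear_add[OF A] linear_scale[OF A])
  then have Q: "bounded_bilinear Q" by (simp add: bilinear_conv_bounded_bilinear)
  obtain \<epsilon> where \<epsilon>: "0 < \<epsilon>" "cball q \<epsilon> \<subseteq> symmetric_cone"
    using open_contains_cball_eq[OF open_symmetric_cone] q by blast
  have "has_expansion (\<lambda>x. A (f x)) p"
    by (rule has_expansion_compose_linear[OF A[unfolded linear_conv_bounded_linear] f])
  from has_expansion_small[OF this]
  have u: "\<exists>r>0. power_bound (\<lambda>h. A (f (p + h) - f p)) r \<delta>" if "0 < \<delta>" for \<delta>
    using that by (simp add: linear_diff[OF A])
  have zero: "\<exists>r>0. power_bound (\<lambda>_ :: 'a. 0 :: real) r \<delta>" if "0 < \<delta>" for \<delta>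
  proof -
    have "power_bound (\<lambda>_ :: 'a. 0 :: real) 1 (norm (0 :: real))"
      by (rule power_bound_const) simp
    then have "power_bound (\<lambda>_ :: 'a. 0 :: real) 1 \<delta>"
      by (rule power_bound_mono) (use that in simp_all)
    then show ?thesis by (intro exI[of _ 1]) simp
  qed
  have "\<exists>r z. power_bound z r \<epsilon> \<and>
      (\<forall>h. norm h < r \<longrightarrow> z h = A (f (p + h) - f p) + 0 + Q (z h) (z h))"
    by (rule power_bound_fixpoint[OF bounded_bilinear_zero Q]) (erule u, erule zero, rule \<epsilon>(1))
  then obtain r z where z: "power_bound z r \<epsilon>"
    and "\<forall>h. norm h < r \<longrightarrow> z h = A (f (p + h) - f p) + 0 + Q (z h) (z h)"
    by (elim exE conjE)
  then have eq: "z h = A (f (p + h) - f p) + Q (z h) (z h)" if "norm h < r" for h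
    using that by (simp only: add_0_right)
  have root: "q + z h = f (p + h) powj (1/2)" if h: "norm h < r" for h
  proof -
    have "q + z h \<in> symmetric_cone"
      using \<epsilon>(2) power_bound_norm_le[OF z h] by (auto simp: dist_norm)
    moreover have "(q + z h) \<odot> (q + z h) = f (p + h)"
    proof -
      have "M (z h) = M (A (f (p + h) - f p)) - M (A (z h \<odot> z h))"
        by (subst eq[OF h]) (simp add: Q_def linear_diff[OF M])
      then have "M (z h) = f (p + h) - f p - z h \<odot> z h"
        by (simp add: MA)
      then show ?thesis
        by (simp add: M_def jprod.add_left jprod.add_right qq jprod_commute[of "z h" q] scaleR_2 algebra_simps)
    qed
    ultimately show ?thesis
      using powj_half_square[of "q + z h"] by simp
  qed
  have "power_bound (\<lambda>h. q + z h) r (norm q + \<epsilon>)"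
    by (intro power_bound_add power_bound_const power_bound_pos[OF z] z)
  then have "power_bound (\<lambda>h. f (p + h) powj (1/2)) r (norm q + \<epsilon>)"
    by (rule power_bound_cong) (rule root)
  then show ?thesis by (auto simp: has_expansion_def)
qed

text \<open>The inverse \<open>y\<close> of \<open>x\<close> is the solution of the linear equation \<open>P(x) y = x\<close>, which is solved by
  perturbation from \<open>P(f p)\<close>.\<close>

lemma has_expansion_powj_minus_one:
  fixes f :: "'a::real_normed_vector \<Rightarrow> 'b::euclidean_jordan_algebra"
  assumes f: "has_expansion f p" and fp: "f p \<in> symmetric_cone"
  shows "has_expansion (\<lambda>x. f x powj (-1)) p"
proof -
  define y where "y = f p powj (-1)"
  define S where "S = quad_rep y"
  have PS: "quad_rep (f p) (S v) = v" for v
    unfolding S_def y_def using quad_rep_powj_inverse(1)[OF fp, of 1] by (simp add: powj_one[OF fp])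
  define G where "G x = S o\<^sub>L (quad_rep (f p) - quad_rep (f x))" for x
  define u where "u x = S (f x - f p) + G x y" for x
  have G: "has_expansion G p"
    unfolding G_def
    by (intro has_expansion_bilinear[OF bounded_bilinear_blinfun_compose] has_expansion_diff
        has_expansion_const has_expansion_quad_rep f)
  have u: "has_expansion u p"
    unfolding u_def
    by (intro has_expansion_add has_expansion_bilinear[OF bounded_bilinear_blinfun_apply] G
        has_expansion_const has_expansion_diff f)
  have "G p = 0" and "u p = 0"
    by (simp_all add: u_def G_def blinfun.bilinear_simps)
  then have uG: "\<exists>r>0. power_bound (\<lambda>h. u (p + h)) r \<delta>" "\<exists>r>0. power_bound (\<lambda>h. G (p + h)) r \<delta>"
    if "0 < \<delta>" for \<delta>
    using has_expansion_small[OF u that] has_expansion_small[OF G that] by simp_all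
  have "\<exists>r z. power_bound z r 1 \<and>
      (\<forall>h. norm h < r \<longrightarrow> z h = u (p + h) + G (p + h) (z h) + 0)"
    by (rule power_bound_fixpoint[OF bounded_bilinear_blinfun_apply bounded_bilinear_zero])
      (erule uG(1), erule uG(2), rule zero_less_one)
  then obtain r z where z: "power_bound z r 1"
    and "\<forall>h. norm h < r \<longrightarrow> z h = u (p + h) + G (p + h) (z h) + 0"
    by (elim exE conjE)
  then have eq: "z h = u (p + h) + G (p + h) (z h)" if "norm h < r" for h
    using that by (simp only: add_0_right)
  have inv: "y + z h = f (p + h) powj (-1)" if h: "norm h < r" and c: "f (p + h) \<in> symmetric_cone" for h
  proof (rule quad_rep_inject[OF c])
    have "quad_rep (f p) (z h) = quad_rep (f p) (u (p + h)) + quad_rep (f p) (G (p + h) (z h))"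
      by (subst eq[OF h]) (simp add: blinfun.bilinear_simps)
    also have "\<dots> = f (p + h) - f p + (quad_rep (f p) (y + z h) - quad_rep (f (p + h)) (y + z h))"
      by (simp add: u_def G_def blinfun.bilinear_simps PS)
    finally have *: "quad_rep (f p) (z h) = f (p + h) - f p
        + (quad_rep (f p) y + quad_rep (f p) (z h) - quad_rep (f (p + h)) (y + z h))"
      by (simp only: blinfun.add_right[of "quad_rep (f p)"])
    have cancel: "b = c + d" if "a = c + (d + a - b)" for a b c d :: 'b
    proof -
      have "b + a = (c + (d + a - b)) + b" using that by (metis add.commute)
      also have "\<dots> = (c + d) + a" by simp
      finally show ?thesis by (rule add_right_imp_eq)
    qed
    have "quad_rep (f (p + h)) (y + z h) = f (p + h) - f p + quad_rep (f p) y"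
      by (rule cancel[OF *])
    also have "quad_rep (f p) y = f p"
      unfolding y_def by (rule quad_rep_powj_minus_one(1)[OF fp])
    finally show "quad_rep (f (p + h)) (y + z h) = quad_rep (f (p + h)) (f (p + h) powj (-1))"
      by (simp add: quad_rep_powj_minus_one(1)[OF c])
  qed
  have "power_bound (\<lambda>h. y + z h) r (norm y + 1)"
    by (intro power_bound_add power_bound_const power_bound_pos[OF z] z)
  then have he: "has_expansion (\<lambda>x. y + z (x - p)) p"
    by (auto simp: has_expansion_def)
  have "eventually (\<lambda>x. dist x p < r) (nhds p)"
    using power_bound_pos[OF z] by (auto simp: eventually_nhds_metric)
  then have "eventually (\<lambda>x. y + z (x - p) = f x powj (-1)) (nhds p)"
    using has_expansion_eventually_open[OF f open_symmetric_cone fp]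
  proof eventually_elim
    case (elim x)
    then show ?case using inv[of "x - p"] by (simp add: dist_norm)
  qed
  with he show ?thesis by (rule has_expansion_cong)
qed

lemma has_expansion_powj_minus_half:
  fixes f :: "'a::real_normed_vector \<Rightarrow> 'b::euclidean_jordan_algebra"
  assumes f: "has_expansion f p" and fp: "f p \<in> symmetric_cone"
  shows "has_expansion (\<lambda>x. f x powj (-1/2)) p"
proof -
  have "has_expansion (\<lambda>x. (f x powj (1/2)) powj (-1)) p"
    by (rule has_expansion_powj_minus_one[OF has_expansion_powj_half[OF assms] powj_in_cone[OF fp]])
  moreover have "eventually (\<lambda>x. (f x powj (1/2)) powj (-1) = f x powj (-1/2)) (nhds p)"
    using has_expansion_eventually_open[OF f open_symmetric_cone fp]
    by eventually_elim (simp add: powj_powj)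
  ultimately show ?thesis by (rule has_expansion_cong)
qed

lemma has_expansion_metric_geometric_mean:
  fixes f g :: "'a::real_normed_vector \<Rightarrow> 'b::euclidean_jordan_algebra"
  assumes f: "has_expansion f p" "f p \<in> symmetric_cone" and g: "has_expansion g p" "g p \<in> symmetric_cone"
  shows "has_expansion (\<lambda>x. f x \<sharp> g x) p"
  unfolding metric_geometric_mean_def
  by (intro has_expansion_bilinear[OF bounded_bilinear_blinfun_apply] has_expansion_quad_rep
      has_expansion_powj_half has_expansion_powj_minus_half quad_rep_symmetric_cone powj_in_cone f g)

section \<open>Identity components\<close>

lemma blinfun_compose_assoc: "(f o\<^sub>L g) o\<^sub>L h = f o\<^sub>L (g o\<^sub>L h)"
  by (rule blinfun_eqI) simp

lemma isCont_quad_rep: "isCont quad_rep x"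
  by (rule has_expansion_isCont[OF has_expansion_quad_rep[OF has_expansion_linear[OF bounded_linear_ident]]])

lemma id_in_Aut_group: "id_blinfun \<in> Aut_group"
  by (simp add: Aut_group_def jordan_automorphism_def linear_iff bij_iff)

lemma Aut_group0_subset: "Aut_group0 \<subseteq> Aut_group"
  unfolding Aut_group0_def by (rule connected_component_subset)

lemma cone_group0_subset: "cone_group0 \<subseteq> cone_group"
  unfolding cone_group0_def by (rule connected_component_subset)

lemma id_in_cone_group0: "id_blinfun \<in> cone_group0"
  unfolding cone_group0_def using id_in_Aut_group Aut_group_subset_cone_group
  by (auto simp: connected_component_refl)

lemma Aut_group0_subset_cone_group0: "Aut_group0 \<subseteq> cone_group0"
  unfolding Aut_group0_def cone_group0_def
  by (rule connected_component_mono[OF Aut_group_subset_cone_group])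

text \<open>The cone is connected and contains the unit, so left multiplication by \<open>P(x)\<close> does not leave
  the identity component.\<close>

lemma quad_rep_comp_cone_group0:
  fixes x :: "'a::euclidean_jordan_algebra"
  assumes x: "x \<in> symmetric_cone" and g: "g \<in> cone_group0"
  shows "quad_rep x o\<^sub>L g \<in> cone_group0"
proof -
  define S where "S = (\<lambda>(y :: 'a, h). quad_rep y o\<^sub>L h) ` (symmetric_cone \<times> cone_group0)"
  have "connected S"
    unfolding S_def
  proof (rule connected_continuous_image)
    show "connected (symmetric_cone \<times> (cone_group0 :: ('a \<Rightarrow>\<^sub>L 'a) set))"
      unfolding cone_group0_def
      by (intro connected_Times connected_symmetric_cone connected_connected_component)
    have "continuous_on UNIV (quad_rep :: 'a \<Rightarrow> _)"
      by (simp add: continuous_on_eq_continuous_at isCont_quad_rep)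
    from continuous_on_compose2[OF this continuous_on_fst[OF continuous_on_id]]
    have "continuous_on (symmetric_cone \<times> cone_group0) (\<lambda>t :: 'a \<times> ('a \<Rightarrow>\<^sub>L 'a). quad_rep (fst t))"
      by simp
    then show "continuous_on (symmetric_cone \<times> cone_group0) (\<lambda>(y :: 'a, h). quad_rep y o\<^sub>L h)"
      unfolding case_prod_beta
      by (intro bounded_bilinear.continuous_on[OF bounded_bilinear_blinfun_compose]
          continuous_on_snd continuous_on_id)
  qed
  moreover have "S \<subseteq> cone_group"
    using cone_group0_subset by (auto simp: S_def intro!: cone_group_comp quad_rep_cone_group)
  moreover have "id_blinfun \<in> S"
    unfolding S_def using jone_in_symmetric_cone id_in_cone_group0
    by (intro image_eqI[of _ _ "(jone, id_blinfun)"]) (auto simp: quad_rep_jone blinfun_eqI)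
  ultimately have "S \<subseteq> cone_group0"
    unfolding cone_group0_def by (intro connected_component_maximal)
  then show ?thesis
    using x g by (auto simp: S_def)
qed

text \<open>Continuity of the polar decomposition maps one identity component into the other.\<close>

lemma polar_part_Aut_group0:
  fixes g :: "'a::euclidean_jordan_algebra \<Rightarrow>\<^sub>L 'a"
  assumes g: "g \<in> cone_group0"
  shows "quad_rep ((g jone) powj (-1/2)) o\<^sub>L g \<in> Aut_group0"
proof -
  define \<phi> where "\<phi> g = quad_rep ((blinfun_apply g jone) powj (-1/2)) o\<^sub>L g" for g :: "'a \<Rightarrow>\<^sub>L 'a"
  have "isCont \<phi> h" if "h \<in> cone_group" for h
    unfolding \<phi>_def
    by (intro has_expansion_isCont has_expansion_bilinear[OF bounded_bilinear_blinfun_compose]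
        has_expansion_quad_rep has_expansion_powj_minus_half has_expansion_linear
        blinfun.bounded_linear_left bounded_linear_ident cone_group_jone that)
  then have "continuous_on cone_group0 \<phi>"
    using cone_group0_subset by (intro continuous_at_imp_continuous_on) auto
  moreover have "connected (cone_group0 :: ('a \<Rightarrow>\<^sub>L 'a) set)"
    unfolding cone_group0_def by (rule connected_connected_component)
  ultimately have "connected (\<phi> ` cone_group0)"
    by (rule connected_continuous_image)
  moreover have "\<phi> ` cone_group0 \<subseteq> Aut_group"
    using cone_group0_subset polar_part_automorphism by (auto simp: \<phi>_def)
  moreover have "id_blinfun \<in> \<phi> ` cone_group0"
  proof (rule image_eqI)
    have "(jone :: 'a) powj (-1/2) = jone"
      using powj_powj[OF jone_in_symmetric_cone, of 0 "-1/2"] by (simp add: powj_zero[OF jone_in_symmetric_cone])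
    then show "id_blinfun = \<phi> id_blinfun"
      by (simp add: \<phi>_def quad_rep_jone blinfun_eqI)
  qed (rule id_in_cone_group0)
  ultimately have "\<phi> ` cone_group0 \<subseteq> Aut_group0"
    unfolding Aut_group0_def by (intro connected_component_maximal)
  then show ?thesis using g by (auto simp: \<phi>_def)
qed

text \<open>Such an element is its own polar part.\<close>

lemma cone_group0_fixing_jone:
  fixes k :: "'a::euclidean_jordan_algebra \<Rightarrow>\<^sub>L 'a"
  assumes k: "k \<in> cone_group0" "k jone = jone"
  shows "k \<in> Aut_group0"
proof -
  have "(jone :: 'a) powj (-1/2) = jone"
    using powj_powj[OF jone_in_symmetric_cone, of 0 "-1/2"] by (simp add: powj_zero[OF jone_in_symmetric_cone])
  moreover have "id_blinfun o\<^sub>L k = k" by (rule blinfun_eqI) simp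
  ultimately show ?thesis
    using polar_part_Aut_group0[OF k(1)] by (simp add: k(2) quad_rep_jone)
qed

section \<open>The involutive polar decomposition\<close>

text \<open>Written in terms of \<open>x = g jone\<close>, which is linear in \<open>g\<close>, instead of the square root of
  \<open>g (adjoint g jone)\<close>, and with \<open>b\<close> in the form \<open>P(a\<^sup>-\<^sup>1\<^sup>/\<^sup>2) x\<close>, in which its analyticity is visible.\<close>

definition Psi_inverse :: "('a::euclidean_jordan_algebra \<Rightarrow> 'a) \<Rightarrow> ('a \<Rightarrow>\<^sub>L 'a) \<Rightarrow> 'a \<times> 'a \<times> ('a \<Rightarrow>\<^sub>L 'a)" where
  "Psi_inverse \<sigma> g = (let x = g jone; a = x \<sharp> \<sigma> x; b = quad_rep (a powj (-1/2)) x
     in (a, b, quad_rep (b powj (-1/2)) o\<^sub>L quad_rep (a powj (-1/2)) o\<^sub>L g))"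

lemma has_expansion_Psi:
  fixes t :: "'a::euclidean_jordan_algebra \<times> 'a \<times> ('a \<Rightarrow>\<^sub>L 'a)"
  assumes "fst t \<in> symmetric_cone" "fst (snd t) \<in> symmetric_cone"
  shows "has_expansion Psi t"
proof -
  have "Psi = (\<lambda>t :: 'a \<times> 'a \<times> ('a \<Rightarrow>\<^sub>L 'a). quad_rep (fst t powj (1/2)) o\<^sub>L quad_rep (fst (snd t) powj (1/2))
      o\<^sub>L snd (snd t))"
    by (rule ext) (metis Psi.simps prod.collapse)
  moreover have "has_expansion (\<lambda>t :: 'a \<times> 'a \<times> ('a \<Rightarrow>\<^sub>L 'a). quad_rep (fst t powj (1/2))
      o\<^sub>L quad_rep (fst (snd t) powj (1/2)) o\<^sub>L snd (snd t)) t"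
    by (intro has_expansion_bilinear[OF bounded_bilinear_blinfun_compose] has_expansion_quad_rep
        has_expansion_powj_half has_expansion_linear assms bounded_linear_fst
        bounded_linear_fst_comp bounded_linear_snd_comp bounded_linear_snd)
  ultimately show ?thesis by simp
qed

lemma has_expansion_Psi_inverse:
  fixes g :: "'a::euclidean_jordan_algebra \<Rightarrow>\<^sub>L 'a"
  assumes inner_trace: "\<And>x y :: 'a. x \<bullet> y = jtrace (x \<odot> y)"
    and \<sigma>: "jordan_automorphism \<sigma>" and g: "g jone \<in> symmetric_cone"
  shows "has_expansion (Psi_inverse \<sigma>) g"
proof -
  have x: "has_expansion (\<lambda>g :: 'a \<Rightarrow>\<^sub>L 'a. g jone) g"
    by (rule has_expansion_linear[OF blinfun.bounded_linear_left])
  have sx: "has_expansion (\<lambda>g :: 'a \<Rightarrow>\<^sub>L 'a. \<sigma> (g jone)) g"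
    using automorphism_facts(1)[OF \<sigma>] by (intro has_expansion_compose_linear[OF _ x])
      (simp add: linear_conv_bounded_linear)
  have sg: "\<sigma> (g jone) \<in> symmetric_cone"
    by (rule automorphism_in_symmetric_cone[OF \<sigma> g])
  have a: "has_expansion (\<lambda>g :: 'a \<Rightarrow>\<^sub>L 'a. (g jone) \<sharp> \<sigma> (g jone)) g"
    by (rule has_expansion_metric_geometric_mean[OF x g sx sg])
  have ac: "(g jone) \<sharp> \<sigma> (g jone) \<in> symmetric_cone"
    by (rule metric_geometric_mean_riccati(1)[OF inner_trace g sg])
  have b: "has_expansion (\<lambda>g :: 'a \<Rightarrow>\<^sub>L 'a. quad_rep (((g jone) \<sharp> \<sigma> (g jone)) powj (-1/2)) (g jone)) g"
    by (intro has_expansion_bilinear[OF bounded_bilinear_blinfun_apply] has_expansion_quad_rep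
        has_expansion_powj_minus_half a ac x)
  have bc: "quad_rep (((g jone) \<sharp> \<sigma> (g jone)) powj (-1/2)) (g jone) \<in> symmetric_cone"
    by (intro quad_rep_symmetric_cone powj_in_cone ac g)
  show ?thesis
    unfolding Psi_inverse_def[abs_def] Let_def
    by (intro has_expansion_Pair has_expansion_bilinear[OF bounded_bilinear_blinfun_compose]
        has_expansion_quad_rep has_expansion_powj_minus_half a ac b bc
        has_expansion_linear[OF bounded_linear_ident])
qed

context
  fixes \<sigma> :: "'a::euclidean_jordan_algebra \<Rightarrow> 'a"
  assumes inner_trace: "\<And>x y :: 'a. x \<bullet> y = jtrace (x \<odot> y)"
    and \<sigma>: "involutive_jordan_automorphism \<sigma>"
begin

lemma Psi_in_cone_group0:
  assumes "a \<in> symmetric_cone" "b \<in> symmetric_cone" "k \<in> Aut_group0"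
  shows "Psi (a, b, k) \<in> cone_group0"
proof -
  have "quad_rep (a powj (1/2)) o\<^sub>L (quad_rep (b powj (1/2)) o\<^sub>L k) \<in> cone_group0"
    using assms Aut_group0_subset_cone_group0
    by (intro quad_rep_comp_cone_group0 powj_in_cone) auto
  then show ?thesis
    by (simp add: blinfun_compose_assoc)
qed

lemma Psi_inverse_Psi:
  assumes a: "a \<in> cone_fixed \<sigma>" and b: "b \<in> cone_inverted \<sigma>" and k: "k \<in> Aut_group"
  shows "Psi_inverse \<sigma> (Psi (a, b, k)) = (a, b, k)"
proof -
  have ac: "a \<in> symmetric_cone" and bc: "b \<in> symmetric_cone"
    using a b by (auto simp: cone_fixed_def cone_inverted_def)
  define x where "x = quad_rep (a powj (1/2)) b"
  have "Psi (a, b, k) jone = x"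
    by (simp add: x_def Aut_group_jone[OF k] quad_rep_powj_minus_one(4)[OF bc])
  moreover have "quad_rep (b powj (-1/2)) o\<^sub>L quad_rep (a powj (-1/2)) o\<^sub>L Psi (a, b, k) = k"
    using quad_rep_powj_inverse(2)[OF ac, of "1/2"] quad_rep_powj_inverse(2)[OF bc, of "1/2"]
    by (intro blinfun_eqI) simp
  ultimately show ?thesis
    using involution_factorization_unique[OF inner_trace \<sigma> a b x_def]
    by (simp add: Psi_inverse_def Let_def)
qed

lemma Psi_inverse_in_domain:
  assumes g: "g \<in> cone_group0"
  shows "Psi_inverse \<sigma> g \<in> cone_fixed \<sigma> \<times> cone_inverted \<sigma> \<times> Aut_group0" (is "_ \<in> ?M")
    and "Psi (Psi_inverse \<sigma> g) = g"
proof -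
  define x a b k where "x = g jone" and "a = x \<sharp> \<sigma> x" and "b = quad_rep (a powj (-1/2)) x"
    and "k = quad_rep (b powj (-1/2)) o\<^sub>L quad_rep (a powj (-1/2)) o\<^sub>L g"
  have inverse: "Psi_inverse \<sigma> g = (a, b, k)"
    by (simp add: Psi_inverse_def Let_def x_def a_def b_def k_def)
  have x: "x \<in> symmetric_cone"
    using g cone_group0_subset cone_group_jone by (auto simp: x_def)
  have a: "a \<in> cone_fixed \<sigma>" and b: "b \<in> cone_inverted \<sigma>"
    using involution_factorization(1,2)[OF inner_trace \<sigma> x] by (simp_all add: a_def b_def)
  then have ac: "a \<in> symmetric_cone" and bc: "b \<in> symmetric_cone"
    by (auto simp: cone_fixed_def cone_inverted_def)
  have "quad_rep (b powj (-1/2)) o\<^sub>L (quad_rep (a powj (-1/2)) o\<^sub>L g) \<in> cone_group0"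
    by (intro quad_rep_comp_cone_group0 powj_in_cone ac bc g)
  then have "k \<in> cone_group0"
    by (simp add: k_def blinfun_compose_assoc)
  moreover have "k jone = jone"
    using quad_rep_powj_minus_one(3)[OF bc] unfolding k_def b_def x_def by simp
  ultimately have "k \<in> Aut_group0"
    by (rule cone_group0_fixing_jone)
  then show "Psi_inverse \<sigma> g \<in> ?M"
    using a b by (simp add: inverse)
  show "Psi (Psi_inverse \<sigma> g) = g"
    unfolding inverse
    using quad_rep_powj_inverse(1)[OF ac, of "1/2"] quad_rep_powj_inverse(1)[OF bc, of "1/2"]
    by (intro blinfun_eqI) (simp add: k_def)
qed

lemma bij_betw_Psi: "bij_betw Psi (cone_fixed \<sigma> \<times> cone_inverted \<sigma> \<times> Aut_group0) cone_group0"
proof (rule bij_betw_byWitness[where f' = "Psi_inverse \<sigma>"])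
  show "\<forall>t\<in>cone_fixed \<sigma> \<times> cone_inverted \<sigma> \<times> Aut_group0. Psi_inverse \<sigma> (Psi t) = t"
    using Psi_inverse_Psi Aut_group0_subset by fastforce
  show "\<forall>g\<in>cone_group0. Psi (Psi_inverse \<sigma> g) = g"
    using Psi_inverse_in_domain(2) by blast
  show "Psi ` (cone_fixed \<sigma> \<times> cone_inverted \<sigma> \<times> Aut_group0) \<subseteq> cone_group0"
    using Psi_in_cone_group0 by (fastforce simp: cone_fixed_def cone_inverted_def)
  show "Psi_inverse \<sigma> ` cone_group0 \<subseteq> cone_fixed \<sigma> \<times> cone_inverted \<sigma> \<times> Aut_group0"
    using Psi_inverse_in_domain(1) by blast
qed

lemma inv_into_Psi:
  assumes "g \<in> cone_group0"
  shows "inv_into (cone_fixed \<sigma> \<times> cone_inverted \<sigma> \<times> Aut_group0) Psi g = Psi_inverse \<sigma> g"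
  using bij_betw_Psi Psi_inverse_in_domain[OF assms] by (metis bij_betw_imp_inj_on inv_into_f_eq)

lemma real_analytic_diffeomorphism_Psi:
  "real_analytic_diffeomorphism (cone_fixed \<sigma> \<times> cone_inverted \<sigma> \<times> Aut_group0) cone_group0 Psi"
  unfolding real_analytic_diffeomorphism_def
proof (intro conjI bij_betw_Psi)
  show "real_analytic_map_on (cone_fixed \<sigma> \<times> cone_inverted \<sigma> \<times> Aut_group0) Psi"
    unfolding real_analytic_map_on_def
  proof
    fix p assume "p \<in> cone_fixed \<sigma> \<times> cone_inverted \<sigma> \<times> (Aut_group0 :: ('a \<Rightarrow>\<^sub>L 'a) set)"
    then have "p \<in> symmetric_cone \<times> symmetric_cone \<times> (UNIV :: ('a \<Rightarrow>\<^sub>L 'a) set)"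
      by (auto simp: cone_fixed_def cone_inverted_def)
    moreover have "open (symmetric_cone \<times> symmetric_cone \<times> (UNIV :: ('a \<Rightarrow>\<^sub>L 'a) set))"
      by (intro open_Times open_symmetric_cone open_UNIV)
    moreover have "real_analytic_at Psi q" if "q \<in> symmetric_cone \<times> symmetric_cone \<times> (UNIV :: ('a \<Rightarrow>\<^sub>L 'a) set)" for q
      using that by (intro has_expansion_real_analytic has_expansion_Psi) auto
    ultimately show "\<exists>U F. open U \<and> p \<in> U \<and> (\<forall>q\<in>U. real_analytic_at F q) \<and>
        (\<forall>x\<in>(cone_fixed \<sigma> \<times> cone_inverted \<sigma> \<times> Aut_group0) \<inter> U. F x = Psi x)"
      by blast
  qed
  show "real_analytic_map_on cone_group0 (inv_into (cone_fixed \<sigma> \<times> cone_inverted \<sigma> \<times> Aut_group0) Psi)"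
    unfolding real_analytic_map_on_def
  proof
    fix g :: "'a \<Rightarrow>\<^sub>L 'a" assume g: "g \<in> cone_group0"
    define U where "U = {h :: 'a \<Rightarrow>\<^sub>L 'a. h jone \<in> symmetric_cone}"
    have "open U"
      using open_vimage[OF open_symmetric_cone, of "\<lambda>h :: 'a \<Rightarrow>\<^sub>L 'a. h jone"]
      by (simp add: U_def vimage_def continuous_intros)
    moreover have "g \<in> U"
      using g cone_group0_subset cone_group_jone by (auto simp: U_def)
    moreover have "real_analytic_at (Psi_inverse \<sigma>) q" if "q \<in> U" for q
      using that \<sigma> by (intro has_expansion_real_analytic has_expansion_Psi_inverse[OF inner_trace])
        (auto simp: U_def involutive_jordan_automorphism_def)
    ultimately show "\<exists>U F. open U \<and> g \<in> U \<and> (\<forall>q\<in>U. real_analytic_at F q) \<and>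
        (\<forall>x\<in>cone_group0 \<inter> U. F x = inv_into (cone_fixed \<sigma> \<times> cone_inverted \<sigma> \<times> Aut_group0) Psi x)"
      using inv_into_Psi by (intro exI[of _ U] exI[of _ "Psi_inverse \<sigma>"]) auto
  qed
qed

end

theorem theorem6p1:
  fixes \<sigma> :: "'a::euclidean_jordan_algebra \<Rightarrow> 'a"
  assumes simple: "simple_jordan_algebra TYPE('a)"
    and inner_trace: "\<And>x y :: 'a. x \<bullet> y = jtrace (x \<odot> y)"
    and \<sigma>: "involutive_jordan_automorphism \<sigma>"
  shows "real_analytic_diffeomorphism (cone_fixed \<sigma> \<times> cone_inverted \<sigma> \<times> Aut_group0) cone_group0 Psi
    \<and> (\<forall>g\<in>cone_group0.
        let x = (blinfun_apply g (adjoint (blinfun_apply g) jone)) powj (1/2);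
            a = x \<sharp> \<sigma> x;
            b = x \<natural> \<sigma> (x powj (-1));
            k = quad_rep (b powj (-1/2)) o\<^sub>L quad_rep (a powj (-1/2)) o\<^sub>L g
        in x \<in> symmetric_cone \<and> a \<in> cone_fixed \<sigma> \<and> b \<in> cone_inverted \<sigma> \<and> k \<in> Aut_group0 \<and>
           inv_into (cone_fixed \<sigma> \<times> cone_inverted \<sigma> \<times> Aut_group0) Psi g = (a, b, k))
    \<and> (\<forall>g\<in>cone_group0. \<exists>!t. case t of (a, b, k) \<Rightarrow>
          a \<in> cone_fixed \<sigma> \<and> b \<in> cone_inverted \<sigma> \<and> k \<in> Aut_group0 \<and>
          g = quad_rep (a powj (1/2)) o\<^sub>L quad_rep (b powj (1/2)) o\<^sub>L k)"
proof (intro conjI ballI)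
  let ?M = "cone_fixed \<sigma> \<times> cone_inverted \<sigma> \<times> (Aut_group0 :: ('a \<Rightarrow>\<^sub>L 'a) set)"
  show "real_analytic_diffeomorphism ?M cone_group0 Psi"
    by (rule real_analytic_diffeomorphism_Psi[OF inner_trace \<sigma>])
  fix g :: "'a \<Rightarrow>\<^sub>L 'a" assume g: "g \<in> cone_group0"
  have gG: "g \<in> cone_group" using g cone_group0_subset by blast
  have x: "g jone \<in> symmetric_cone" by (rule cone_group_jone[OF gG])
  have "g (adjoint g jone) = g jone \<odot> g jone"
    unfolding cone_group_adjoint[OF inner_trace gG] by (rule quad_rep_jone_arg)
  then have root: "(g (adjoint g jone)) powj (1/2) = g jone"
    by (simp add: powj_half_square[OF x])
  show "let x = (blinfun_apply g (adjoint (blinfun_apply g) jone)) powj (1/2);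
            a = x \<sharp> \<sigma> x;
            b = x \<natural> \<sigma> (x powj (-1));
            k = quad_rep (b powj (-1/2)) o\<^sub>L quad_rep (a powj (-1/2)) o\<^sub>L g
        in x \<in> symmetric_cone \<and> a \<in> cone_fixed \<sigma> \<and> b \<in> cone_inverted \<sigma> \<and> k \<in> Aut_group0 \<and>
           inv_into ?M Psi g = (a, b, k)"
    unfolding root Let_def involution_factorization(3)[OF inner_trace \<sigma> x]
    using x Psi_inverse_in_domain(1)[OF inner_trace \<sigma> g] inv_into_Psi[OF inner_trace \<sigma> g]
    by (auto simp: Psi_inverse_def Let_def)
  have "\<exists>!t. t \<in> ?M \<and> g = Psi t"
    using bij_betw_Psi[OF inner_trace \<sigma>] g unfolding bij_betw_def inj_on_def by blast
  moreover have "(t \<in> ?M \<and> g = Psi t) \<longleftrightarrow> (case t of (a, b, k) \<Rightarrow>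
          a \<in> cone_fixed \<sigma> \<and> b \<in> cone_inverted \<sigma> \<and> k \<in> Aut_group0 \<and>
          g = quad_rep (a powj (1/2)) o\<^sub>L quad_rep (b powj (1/2)) o\<^sub>L k)" for t
    by (cases t) auto
  ultimately show "\<exists>!t. case t of (a, b, k) \<Rightarrow>
          a \<in> cone_fixed \<sigma> \<and> b \<in> cone_inverted \<sigma> \<and> k \<in> Aut_group0 \<and>
          g = quad_rep (a powj (1/2)) o\<^sub>L quad_rep (b powj (1/2)) o\<^sub>L k"
    by simp
qed

end
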